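(* Let $R\in(0,+\infty)$, $u_*\in\mathbb{H}^\infty_{\Sigma 0}$, $N\in\{0,1,2,\dots\}$. For $t\in[0,+\infty)$ let $$u_0(t):=e^{t\Delta}u_*,\qquad u_j(t):=\sum_{\ell=0}^{j-1}\int_0^tds\,e^{(t-s)\Delta}\mathscr{P}(u_\ell(s),u_{j-\ell-1}(s))\ \ (j=1,\dots,N),\qquad u^N(t):=\sum_{j=0}^NR^ju_j(t).$$ (i) Choose a real $n>d/2+1$. Let $\mathcal{D}_n,\mathcal{D}_{n+1},\epsilon_n\in C([0,+\infty),[0,+\infty))$ be such that, for all $t\in[0,+\infty)$, $$\|u^N(t)\|_n\le\mathcal{D}_n(t),\qquad\|u^N(t)\|_{n+1}\le\mathcal{D}_{n+1}(t),\qquad\Big\|\Big(\frac{du^N}{dt}-\Delta u^N-R\,\mathscr{P}(u^N,u^N)\Big)(t)\Big\|_n\le\epsilon_n(t).$$ Assume there is a function $\mathscr{R}_n\in C^1([0,T_{\mathtt c}),\mathbf{R})$, with $T_{\mathtt c}\in(0,+\infty]$, solving the control Cauchy problem $$\frac{d\mathscr{R}_n}{dt}=-\mathscr{R}_n+R\,(G_n\mathcal{D}_n+K_n\mathcal{D}_{n+1})\mathscr{R}_n+R\,G_n\mathscr{R}_n^2+\epsilon_n,\qquad\mathscr{R}_n(0)=0.$$ If $u\in C^\infty([0,T),\mathbb{H}^\infty_{\Sigma 0})$ is the maximal solution of the Navier-Stokes Cauchy problem $$\frac{du}{dt}=\Delta u+R\,\mathscr{P}(u,u),\qquad u(0)=u_*,$$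 then $$T\ge T_{\mathtt c},\qquad\|u(t)-u^N(t)\|_n\le\mathscr{R}_n(t)\quad\text{for }t\in[0,T_{\mathtt c}).$$ In particular, $u$ is global ($T=+\infty$) if the control Cauchy problem has a global solution ($T_{\mathtt c}=+\infty$). (ii) In the situation of (i), consider a real $p>n$ and let $\mathcal{D}_p,\mathcal{D}_{p+1},\epsilon_p\in C([0,+\infty),[0,+\infty))$ be such that, for all $t\in[0,+\infty)$, $\|u^N(t)\|_p\le\mathcal{D}_p(t)$, $\|u^N(t)\|_{p+1}\le\mathcal{D}_{p+1}(t)$ and $\|(\frac{du^N}{dt}-\Delta u^N-R\,\mathscr{P}(u^N,u^N))(t)\|_p\le\epsilon_p(t)$. Let $\mathscr{R}_p\in C([0,T_{\mathtt c}),\mathbf{R})$ be the solution of the linear problem $$\frac{d\mathscr{R}_p}{dt}=-\mathscr{R}_p+R\,(G_p\mathcal{D}_p+K_p\mathcal{D}_{p+1}+G_{pn}\mathscr{R}_n)\mathscr{R}_p+\epsilon_p,\qquad\mathscr{R}_p(0)=0,$$ which is given explicitly by $$\mathscr{R}_p(t)=e^{-t+R\mathscr{A}_p(t)}\int_0^tds\,e^{s-R\mathscr{A}_p(s)}\epsilon_p(s)\quad\text{for }t\in[0,T_{\mathtt c}),\qquad\mathscr{A}_p(t):=\int_0^tds\,\big(G_p\mathcal{D}_p(s)+K_p\mathcal{D}_{p+1}(s)+G_{pn}\mathscr{R}_n(s)\big).$$ Then $$\|u(t)-u^N(t)\|_p\le\mathscr{R}_p(t)\quad\text{for }t\in[0,T_{\mathtt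 c}).$$
   Context: Let $d\ge 2$ be the space dimension (typically $d=3$) and $\mathbf{T}^d:=(\mathbf{R}/2\pi\mathbf{Z})^d$. An $\mathbf{R}^d$-valued distribution $v$ on $\mathbf{T}^d$ has Fourier expansion $v=\sum_{k\in\mathbf{Z}^d}v_ke_k$, $e_k(x):=e^{ik\cdot x}$, with $v_k\in\mathbf{C}^d$, $\overline{v_k}=v_{-k}$. The Laplacian and its semigroup act by $(\Delta v)_k=-|k|^2v_k$ and $(e^{t\Delta}v)_k=e^{-t|k|^2}v_k$, $t\ge0$. For $n\in\mathbf{R}$, $\mathbb{H}^n_{\Sigma 0}$ is the Hilbert space of $\mathbf{R}^d$-valued distributions $v$ on $\mathbf{T}^d$ that are divergence free ($k\cdot v_k=0$ for all $k$), have zero mean ($v_0=0$) and satisfy $\sum_{k\ne0}|k|^{2n}|v_k|^2<+\infty$, with inner product $\langle v|w\rangle_n:=(2\pi)^d\sum_{k\neq0}|k|^{2n}\overline{v_k}\cdot w_k$ (where $a\cdot b:=\sum_r a_rb_r$) and norm $\|v\|_n:=\sqrt{\langle v|v\rangle_n}$. $\mathbb{H}^\infty_{\Sigma 0}:=\bigcap_{n\in\mathbf{R}}\mathbb{H}^n_{\Sigma 0}$ is a Fréchet space with the topology of the family of norms $(\|\cdot\|_n)_{n\in\mathbf{R}}$; it coincides with the space of $C^\infty$ divergence free, zero mean vector fields on $\mathbf{T}^d$. The bilinear map $\mathscr{P}$ is $\mathscr{P}(v,w):=-\mathfrak{L}(v\cdot\partial w)$, where $(v\cdot\partial w)_r:=\sum_{s=1}^d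 v_s\partial_sw_r$ and $\mathfrak{L}$ is the Leray projection onto divergence free vector fields (on Fourier coefficients, $\mathfrak{L}$ acts as the orthogonal projection onto the orthogonal complement of $k$). $\mathscr{P}$ maps $\mathbb{H}^\infty_{\Sigma 0}\times\mathbb{H}^\infty_{\Sigma 0}$ continuously into $\mathbb{H}^\infty_{\Sigma 0}$. The functions $u_0,\dots,u_N$ of the claim belong to $C^\infty([0,+\infty),\mathbb{H}^\infty_{\Sigma 0})$. It is known that there exist constants (depending also on $d$) such that: for real $n>d/2$, $\|\mathscr{P}(v,w)\|_n\le K_n\|v\|_n\|w\|_{n+1}$ for $v\in\mathbb{H}^n_{\Sigma 0}$, $w\in\mathbb{H}^{n+1}_{\Sigma 0}$; for real $n>d/2+1$, $|\langle\mathscr{P}(v,w)|w\rangle_n|\le G_n\|v\|_n\|w\|_n^2$ for $v\in\mathbb{H}^n_{\Sigma 0}$, $w\in\mathbb{H}^{n+1}_{\Sigma 0}$; for real $p\ge n>d/2+1$, $|\langle\mathscr{P}(v,w)|w\rangle_p|\le\tfrac12G_{pn}(\|v\|_p\|w\|_n+\|v\|_n\|w\|_p)\|w\|_p$ for $v\in\mathbb{H}^p_{\Sigma 0}$, $w\in\mathbb{H}^{p+1}_{\Sigma 0}$. Throughout, $K_n,G_n$ and $K_p,G_p$ (the first two inequalities, with $n$ replaced by $p$ in the second case) and $G_{pn}$ denote any fixed constants fulfilling these inequalities. It is known that the Navier-Stokes Cauchy problem of the claim (unknown $u\in C^\infty([0,T),\mathbb{H}^\infty_{\Sigma 0})$)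 has a unique maximal (i.e., not extendable) solution, with domain $[0,T)$, $T\in(0,+\infty]$, of which any other solution is a restriction. *)

theory Defs
  imports "HOL-Analysis.Analysis"
begin

text \<open>The torus is the quotient of real d-space by the lattice of period \<open>2 \<pi>\<close>; the dimension
  is the cardinality of the index type \<open>'d\<close>.  A distribution on the torus is represented by the
  family \<open>(v k)\<close> of its Fourier coefficients, indexed by the integer vectors \<open>k\<close>.  The families
  that arise in this way are exactly those of at most polynomial growth, and a distribution is
  real valued iff \<open>cnj (v k) = v (- k)\<close>.\<close>

type_synonym 'd field = "int ^ 'd \<Rightarrow> complex ^ 'd"

definition wvec :: "int ^ 'd \<Rightarrow> real ^ 'd" where
  "wvec k = (\<chi> r. real_of_int (k $ r))"

definition real_distribution :: "('d::finite) field \<Rightarrow> bool" where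
  "real_distribution v \<longleftrightarrow>
     (\<exists>C m. \<forall>k. norm (v k) \<le> C * (1 + norm (wvec k)) ^ m) \<and>
     (\<forall>k r. cnj (v k $ r) = v (- k) $ r)"

definition div_free :: "('d::finite) field \<Rightarrow> bool" where
  "div_free v \<longleftrightarrow> (\<forall>k. (\<Sum>r\<in>UNIV. of_int (k $ r) * v k $ r) = 0)"

definition Sob :: "real \<Rightarrow> ('d::finite) field set" where
  "Sob n = {v. real_distribution v \<and> div_free v \<and> v 0 = 0 \<and>
     (\<lambda>k. norm (wvec k) powr (2 * n) * (norm (v k))\<^sup>2) summable_on (UNIV - {0})}"

text \<open>For \<open>v\<close>, \<open>w\<close> in \<open>Sob n\<close> the series converges absolutely and its sum is real, by the reality
  condition on the coefficients; \<open>Re\<close> is only a change of type.\<close>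

definition sob_inner :: "real \<Rightarrow> ('d::finite) field \<Rightarrow> 'd field \<Rightarrow> real" where
  "sob_inner n v w = (2 * pi) ^ CARD('d) *
     Re (\<Sum>\<^sub>\<infinity>k\<in>UNIV - {0}. of_real (norm (wvec k) powr (2 * n)) *
           (\<Sum>r\<in>UNIV. cnj (v k $ r) * w k $ r))"

definition sob_norm :: "real \<Rightarrow> ('d::finite) field \<Rightarrow> real" where
  "sob_norm n v = sqrt (sob_inner n v v)"

definition Sob_inf :: "('d::finite) field set" where
  "Sob_inf = (\<Inter>n. Sob n)"

definition laplace :: "('d::finite) field \<Rightarrow> 'd field" where
  "laplace v = (\<lambda>k. - ((norm (wvec k))\<^sup>2 *\<^sub>R v k))"

definition heat :: "real \<Rightarrow> ('d::finite) field \<Rightarrow> 'd field" where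
  "heat t v = (\<lambda>k. exp (- t * (norm (wvec k))\<^sup>2) *\<^sub>R v k)"

definition fourier_series :: "(int ^ 'd \<Rightarrow> complex) \<Rightarrow> real ^ 'd \<Rightarrow> complex" where
  "fourier_series f x = (\<Sum>\<^sub>\<infinity>k. f k * exp (\<i> * of_real (wvec k \<bullet> x)))"

definition fourier_coeff :: "(real ^ 'd \<Rightarrow> complex) \<Rightarrow> int ^ 'd \<Rightarrow> complex" where
  "fourier_coeff g k = integral (cbox 0 (\<chi> i. 2 * pi)) (\<lambda>x. g x * exp (- \<i> * of_real (wvec k \<bullet> x)))
     / of_real ((2 * pi) ^ CARD('d))"

text \<open>Coefficients of \<open>\<partial>\<^sub>s w\<^sub>r\<close>.\<close>

definition partial_coeff :: "'d \<Rightarrow> 'd \<Rightarrow> ('d::finite) field \<Rightarrow> int ^ 'd \<Rightarrow> complex" where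
  "partial_coeff s r w = (\<lambda>k. \<i> * of_int (k $ s) * w k $ r)"

text \<open>The pointwise product of functions on the torus, recorded again by its Fourier coefficients.
  It is meant for \<open>v\<close> in \<open>Sob n\<close> and \<open>w\<close> in \<open>Sob (n + 1)\<close> with \<open>n > d/2\<close>: then all the Fourier
  series involved converge absolutely and uniformly.\<close>

definition advect :: "('d::finite) field \<Rightarrow> 'd field \<Rightarrow> 'd field" where
  "advect v w = (\<lambda>k. \<chi> r. fourier_coeff
     (\<lambda>x. \<Sum>s\<in>UNIV. fourier_series (\<lambda>h. v h $ s) x * fourier_series (partial_coeff s r w) x) k)"

text \<open>Orthogonal projection of each coefficient onto the orthogonal complement of \<open>k\<close>; for
  \<open>k = 0\<close> the complement is the whole space and the formula gives the identity.\<close>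

definition leray :: "('d::finite) field \<Rightarrow> 'd field" where
  "leray f = (\<lambda>k. \<chi> r. f k $ r -
     (\<Sum>s\<in>UNIV. of_int (k $ s) * f k $ s) / of_real ((norm (wvec k))\<^sup>2) * of_int (k $ r))"

definition NSP :: "('d::finite) field \<Rightarrow> 'd field \<Rightarrow> 'd field" where
  "NSP v w = (\<lambda>k. - leray (advect v w) k)"

text \<open>Derivatives, along a set \<open>I\<close> of times, of functions with values in the Frechet space
  \<open>Sob_inf\<close>: the difference quotients converge in all the norms \<open>sob_norm n\<close>.\<close>

definition has_time_derivative ::
    "(real \<Rightarrow> ('d::finite) field) \<Rightarrow> 'd field \<Rightarrow> real \<Rightarrow> real set \<Rightarrow> bool" where
  "has_time_derivative f D t I \<longleftrightarrow>
     (\<forall>s\<in>I. f s \<in> Sob_inf) \<and> D \<in> Sob_inf \<and>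
     (\<forall>n. ((\<lambda>s. sob_norm n (\<lambda>k. (f s k - f t k) /\<^sub>R (s - t) - D k)) \<longlongrightarrow> 0) (at t within I))"

definition time_derivative ::
    "real set \<Rightarrow> (real \<Rightarrow> ('d::finite) field) \<Rightarrow> real \<Rightarrow> 'd field" where
  "time_derivative I f t = (SOME D. has_time_derivative f D t I)"

definition smooth_curve :: "real set \<Rightarrow> (real \<Rightarrow> ('d::finite) field) \<Rightarrow> bool" where
  "smooth_curve I f \<longleftrightarrow>
     (\<exists>F :: nat \<Rightarrow> real \<Rightarrow> 'd field. (\<forall>t\<in>I. F 0 t = f t) \<and>
        (\<forall>j. \<forall>t\<in>I. has_time_derivative (F j) (F (Suc j) t) t I))"

text \<open>Integrals of distribution valued functions are taken coefficient by coefficient; for a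
  continuous function with values in \<open>Sob_inf\<close> this is the integral in that Frechet space, since
  the coefficients are continuous linear functionals that separate points.\<close>

definition field_integral :: "real \<Rightarrow> real \<Rightarrow> (real \<Rightarrow> ('d::finite) field) \<Rightarrow> 'd field" where
  "field_integral a b f = (\<lambda>k. integral {a..b} (\<lambda>s. f s k))"

fun expansion :: "('d::finite) field \<Rightarrow> nat \<Rightarrow> real \<Rightarrow> 'd field" where
  "expansion us 0 t = heat t us"
| "expansion us (Suc j) t = (\<lambda>k. \<Sum>l<Suc j.
     field_integral 0 t (\<lambda>s. heat (t - s) (NSP (expansion us l s) (expansion us (Suc j - l - 1) s))) k)"

definition partial_expansion :: "real \<Rightarrow> ('d::finite) field \<Rightarrow> nat \<Rightarrow> real \<Rightarrow> 'd field" where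
  "partial_expansion R us N t = (\<lambda>k. \<Sum>j\<le>N. R ^ j *\<^sub>R expansion us j t k)"

definition NS_rhs :: "real \<Rightarrow> ('d::finite) field \<Rightarrow> 'd field" where
  "NS_rhs R v = (\<lambda>k. laplace v k + R *\<^sub>R NSP v v k)"

definition NS_error :: "real \<Rightarrow> (real \<Rightarrow> ('d::finite) field) \<Rightarrow> real \<Rightarrow> 'd field" where
  "NS_error R f t = (\<lambda>k. time_derivative {0..} f t k - laplace (f t) k - R *\<^sub>R NSP (f t) (f t) k)"

text \<open>The interval \<open>[0,T)\<close>, where \<open>T\<close> may be infinite.\<close>

definition time_ivl :: "ereal \<Rightarrow> real set" where
  "time_ivl T = {t. 0 \<le> t \<and> ereal t < T}"

definition NS_solution ::
    "real \<Rightarrow> ('d::finite) field \<Rightarrow> ereal \<Rightarrow> (real \<Rightarrow> 'd field) \<Rightarrow> bool" where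
  "NS_solution R us T u \<longleftrightarrow> 0 < T \<and> smooth_curve (time_ivl T) u \<and>
     (\<forall>t\<in>time_ivl T. has_time_derivative u (NS_rhs R (u t)) t (time_ivl T)) \<and> u 0 = us"

definition NS_maximal_solution ::
    "real \<Rightarrow> ('d::finite) field \<Rightarrow> ereal \<Rightarrow> (real \<Rightarrow> 'd field) \<Rightarrow> bool" where
  "NS_maximal_solution R us T u \<longleftrightarrow> NS_solution R us T u \<and>
     \<not> (\<exists>T' u'. T < T' \<and> NS_solution R us T' u' \<and> (\<forall>t\<in>time_ivl T. u' t = u t))"

definition nonneg_cont :: "(real \<Rightarrow> real) \<Rightarrow> bool" where
  "nonneg_cont f \<longleftrightarrow> continuous_on {0..} f \<and> (\<forall>t\<ge>0. 0 \<le> f t)"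

text \<open>Constants for the three basic inequalities; the \<open>itself\<close> argument carries the dimension.\<close>

definition K_const :: "'d::finite itself \<Rightarrow> real \<Rightarrow> real \<Rightarrow> bool" where
  "K_const _ n K \<longleftrightarrow> (\<forall>v \<in> Sob n. \<forall>w \<in> Sob (n + 1) :: 'd field set.
     sob_norm n (NSP v w) \<le> K * sob_norm n v * sob_norm (n + 1) w)"

definition G_const :: "'d::finite itself \<Rightarrow> real \<Rightarrow> real \<Rightarrow> bool" where
  "G_const _ n G \<longleftrightarrow> (\<forall>v \<in> Sob n. \<forall>w \<in> Sob (n + 1) :: 'd field set.
     \<bar>sob_inner n (NSP v w) w\<bar> \<le> G * sob_norm n v * (sob_norm n w)\<^sup>2)"

definition G2_const :: "'d::finite itself \<Rightarrow> real \<Rightarrow> real \<Rightarrow> real \<Rightarrow> bool" where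
  "G2_const _ p n G \<longleftrightarrow> (\<forall>v \<in> Sob p. \<forall>w \<in> Sob (p + 1) :: 'd field set.
     \<bar>sob_inner p (NSP v w) w\<bar> \<le>
       1 / 2 * G * (sob_norm p v * sob_norm n w + sob_norm n v * sob_norm p w) * sob_norm p w)"

text \<open>Local bounds for an approximate solution \<open>f\<close>: growth estimators \<open>D\<close>, \<open>D1\<close> of orders \<open>n\<close>,
  \<open>n + 1\<close> and error estimator \<open>e\<close> of order \<open>n\<close>.\<close>

definition estimators :: "real \<Rightarrow> (real \<Rightarrow> ('d::finite) field) \<Rightarrow> real \<Rightarrow>
    (real \<Rightarrow> real) \<Rightarrow> (real \<Rightarrow> real) \<Rightarrow> (real \<Rightarrow> real) \<Rightarrow> bool" where
  "estimators R f n D D1 e \<longleftrightarrow> nonneg_cont D \<and> nonneg_cont D1 \<and> nonneg_cont e \<and>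
     (\<forall>t\<ge>0. sob_norm n (f t) \<le> D t \<and> sob_norm (n + 1) (f t) \<le> D1 t \<and>
        sob_norm n (NS_error R f t) \<le> e t)"

end

theory Submission
  imports Defs
begin

text \<open>
  Put \<open>f = u\<^sup>N\<close> and \<open>w = u - f\<close>.  By bilinearity, \<open>w' = \<Delta> w + R (P(f, w) + P(w, f) + P(w, w)) - e\<close>, where
  \<open>e\<close> is the residual of \<open>f\<close>.  Pairing with \<open>w\<close> in the Sobolev space of order \<open>n\<close>, the Laplacian contributes
  at most \<open>- |w|\<^sub>n\<^sup>2\<close>, because all wave vectors have length at least \<open>1\<close>, and the three bilinear terms are
  estimated by the basic inequalities.  Hence \<open>|w|\<^sub>n\<close> satisfies, with \<open>\<le>\<close> in place of equality, the Riccati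
  equation of the control problem, and \<open>|w|\<^sub>n \<le> \<R>\<^sub>n\<close> follows by Gronwall's argument
  (\<open>energy_inequality\<close>, \<open>norm_control\<close>).  The same computation in order \<open>p\<close>, with the refined estimate of
  \<open>P(w, w)\<close>, leads to a linear inequality; the linear equation has an explicit solution
  (\<open>linear_ODE_iff_formula\<close>).

  These inequalities hold on the common interval of existence.  If \<open>T < T\<^sub>c\<close>, they bound \<open>|u|\<^sub>n\<close> on \<open>[0, T)\<close>, and
  what is left is to show that a solution bounded in order \<open>n > d/2 + 1\<close> can be continued
  (\<open>NS_solution_continuation\<close>).  All the analysis for this is done with Fourier coefficients and
  bounds of the form \<open>(1 + |k|)\<^sup>q |v\<^sub>k| \<le> C\<close> in place of Sobolev norms.  In these terms the nonlinearity is a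
  convolution whose symbol is bounded by \<open>2 |k|\<close> (\<open>has_sum_NSP\<close>, \<open>norm_symbol_le\<close>), so that
  \<open>(1 + |k|)\<^sup>q |P(v, v)\<^sub>k|\<close> is at most \<open>|k|\<close> times the \<open>q\<close>-th bound times the \<open>\<ell>\<^sup>1\<close> norm of the coefficients,
  up to a constant (\<open>weighted_norm_NSP_le\<close>).  As the heat kernel integrates to \<open>|k|\<^sup>-\<^sup>2\<close>, Duhamel's formula gains one
  power of \<open>|k|\<close>.  By the Cauchy-Schwarz inequality the bound in order \<open>n\<close> gives an \<open>\<ell>\<^sup>1\<close> bound, and repeated use of
  Duhamel's formula gives bounds for every \<open>q\<close>, uniformly up to \<open>T\<close> (\<open>decay_bootstrap\<close>).  A contraction argument
  in the space with the fixed weight \<open>q = d + 2\<close>, whose time step depends only on the corresponding bound, then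
  solves the Duhamel equation from a time close to \<open>T\<close> to a time beyond \<open>T\<close> (\<open>mild_fixed_point\<close>); the result agrees with
  \<open>u\<close> before \<open>T\<close> (\<open>mild_unique\<close>) and is smooth (\<open>mild_NS_solution\<close>).

  The Frechet space enters through one device: a curve whose coefficients are continuous in time,
  with decay bounds of every order that are locally uniform in time, is called tame.  If a tame curve has
  coefficientwise a tame derivative, then dominated convergence makes this the derivative in all the
  norms (\<open>has_time_derivative_tame\<close>).  Tame curves are stable under all the operations in the
  equation, so smoothness in time of mild solutions follows by induction on the order.
\<close>

section \<open>Sums over the lattice of wave vectors\<close>

definition wt :: "int ^ ('d::finite) \<Rightarrow> real" where
  "wt k = 1 + norm (wvec k)"

lemma wvec_add: "wvec (h + k) = wvec h + wvec k"
  and wvec_diff: "wvec (h - k) = wvec h - wvec k"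
  and wvec_minus: "wvec (- k) = - wvec k"
  and wvec_zero [simp]: "wvec 0 = 0"
  by (simp_all add: wvec_def vec_eq_iff)

lemma norm_wvec_ge_1:
  assumes "k \<noteq> 0"
  shows "1 \<le> norm (wvec k)"
proof -
  obtain r where r: "k $ r \<noteq> 0"
    using assms by (auto simp: vec_eq_iff)
  have "1 \<le> \<bar>real_of_int (k $ r)\<bar>"
    using r by linarith
  also have "\<dots> \<le> norm (wvec k)"
    using component_le_norm_cart[of "wvec k" r] by (simp add: wvec_def)
  finally show ?thesis .
qed

lemma wvec_eq_0_iff [simp]: "wvec k = 0 \<longleftrightarrow> k = 0"
  using norm_wvec_ge_1[of k] by (cases "k = 0") auto

lemma wt_ge_1: "1 \<le> wt k" and wt_pos [simp]: "0 < wt k" and wt_nonneg [simp]: "0 \<le> wt k"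
  and wt_nonzero [simp]: "wt k \<noteq> 0"
proof -
  show "1 \<le> wt k" by (simp add: wt_def)
  then show "0 < wt k" "0 \<le> wt k" "wt k \<noteq> 0" by linarith+
qed

lemma wt_minus [simp]: "wt (- k) = wt k"
  by (simp add: wt_def wvec_minus)

lemma norm_wvec_le_wt: "norm (wvec k) \<le> wt k"
  by (simp add: wt_def)

lemma wt_le_twice_norm: "k \<noteq> 0 \<Longrightarrow> wt k \<le> 2 * norm (wvec k)"
  using norm_wvec_ge_1[of k] by (simp add: wt_def)

text \<open>The larger of \<open>|h|\<close> and \<open>|k - h|\<close> is at least half of \<open>|k|\<close>.\<close>

lemma wt_pow_le: "wt k ^ q \<le> 2 ^ q * (wt h ^ q + wt (k - h) ^ q)"
proof -
  have "norm (wvec k) \<le> norm (wvec h) + norm (wvec (k - h))"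
    using norm_triangle_ineq[of "wvec h" "wvec (k - h)"] by (simp flip: wvec_add)
  then have "wt k \<le> 2 * max (wt h) (wt (k - h))"
    unfolding wt_def by (smt (verit) norm_ge_zero)
  then have "wt k ^ q \<le> (2 * max (wt h) (wt (k - h))) ^ q"
    by (intro power_mono) auto
  also have "\<dots> \<le> 2 ^ q * (wt h ^ q + wt (k - h) ^ q)"
    by (auto simp: power_mult_distrib max_def)
  finally show ?thesis .
qed

text \<open>Every coordinate is at most the norm, so \<open>(1 + |k|)\<^sup>-\<^sup>s\<close> is dominated by the product of the
  \<open>d\<close> one dimensional weights \<open>(1 + |k\<^sub>r|)\<^sup>-\<^sup>s\<^sup>/\<^sup>d\<close>, and \<open>s / d > 1\<close>.\<close>

lemma summable_wt_powr:
  assumes "s > real CARD('d::finite)"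
  shows "(\<lambda>k :: int ^ 'd. wt k powr (- s)) summable_on UNIV"
proof -
  define d where "d = real CARD('d)"
  define q where "q = s / d"
  have d: "d > 0" by (simp add: d_def)
  have q: "q > 1" using assms d by (simp add: q_def d_def)
  define g where "g = (\<lambda>j :: int. (1 + \<bar>real_of_int j\<bar>) powr (- q))"
  have g0: "g j \<ge> 0" for j by (simp add: g_def)
  have sn: "summable (\<lambda>i :: nat. (1 + real i) powr (- q))"
    using summable_Suc_iff[of "\<lambda>i. real i powr (- q)"] summable_real_powr_iff[of "- q"] q
    by (simp add: add.commute)
  \<comment> \<open>Counting \<open>j = 0\<close> twice does no harm to an upper bound.\<close>
  define Z where "Z = 2 * (\<Sum>i. (1 + real i) powr (- q))"
  have sumg: "sum g {- int B..int B} \<le> Z" for B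
  proof -
    have "sum g {- int B..int B} \<le> sum g (int ` {..B} \<union> (\<lambda>i. - int i) ` {..B})"
    proof (intro sum_mono2)
      show "{- int B..int B} \<subseteq> int ` {..B} \<union> (\<lambda>i. - int i) ` {..B}"
      proof
        fix j assume j: "j \<in> {- int B..int B}"
        show "j \<in> int ` {..B} \<union> (\<lambda>i. - int i) ` {..B}"
        proof (cases "j \<ge> 0")
          case True
          then have "j = int (nat j)" "nat j \<le> B" using j by auto
          then show ?thesis by blast
        next
          case False
          then have "j = - int (nat (- j))" "nat (- j) \<le> B" using j by auto
          then show ?thesis by blast
        qed
      qed
    qed (auto simp: g0)
    also have "\<dots> \<le> sum g (int ` {..B}) + sum g ((\<lambda>i. - int i) ` {..B})"
      by (subst sum.union_inter[symmetric]) (auto intro!: sum_nonneg simp: g0)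
    also have "\<dots> = 2 * (\<Sum>i\<le>B. (1 + real i) powr (- q))"
      by (subst (1 2) sum.reindex) (auto simp: inj_on_def g_def)
    also have "\<dots> \<le> Z"
      unfolding Z_def by (intro mult_left_mono sum_le_suminf sn) auto
    finally show ?thesis .
  qed
  have bound: "sum (\<lambda>k :: int ^ 'd. wt k powr (- s)) F \<le> Z ^ CARD('d)" if F: "finite F" for F
  proof -
    define B where "B = Max (insert 0 ((\<lambda>(k, r). nat \<bar>k $ r\<bar>) ` (F \<times> (UNIV :: 'd set))))"
    have B: "\<bar>k $ r\<bar> \<le> int B" if "k \<in> F" for k r
    proof -
      have "nat \<bar>k $ r\<bar> \<in> insert 0 ((\<lambda>(k, r). nat \<bar>k $ r\<bar>) ` (F \<times> (UNIV :: 'd set)))"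
        using that by force
      then have "nat \<bar>k $ r\<bar> \<le> B" unfolding B_def using F by (intro Max_ge) auto
      then show ?thesis by linarith
    qed
    have "wt k powr (- s) \<le> (\<Prod>r\<in>UNIV. g (k $ r))" for k :: "int ^ 'd"
    proof -
      have "(\<Prod>r\<in>(UNIV :: 'd set). (1 + \<bar>real_of_int (k $ r)\<bar>) powr q) \<le> (\<Prod>r\<in>(UNIV :: 'd set). wt k powr q)"
      proof (intro prod_mono conjI powr_mono2)
        fix r
        show "1 + \<bar>real_of_int (k $ r)\<bar> \<le> wt k"
          using component_le_norm_cart[of "wvec k" r] by (simp add: wvec_def wt_def)
      qed (use q in auto)
      also have "\<dots> = wt k powr s"
        using d by (simp add: powr_realpow[symmetric] powr_powr q_def d_def)
      finally have "inverse (wt k powr s) \<le> inverse (\<Prod>r\<in>(UNIV :: 'd set). (1 + \<bar>real_of_int (k $ r)\<bar>) powr q)"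
        by (intro le_imp_inverse_le prod_pos) auto
      also have "\<dots> = (\<Prod>r\<in>UNIV. g (k $ r))"
        by (simp add: g_def powr_minus prod_inversef[symmetric] o_def)
      finally show ?thesis by (simp add: powr_minus)
    qed
    then have "sum (\<lambda>k :: int ^ 'd. wt k powr (- s)) F \<le> (\<Sum>k\<in>F. \<Prod>r\<in>UNIV. g (k $ r))"
      by (rule sum_mono)
    also have "\<dots> = (\<Sum>f\<in>vec_nth ` F. \<Prod>r\<in>UNIV. g (f r))"
      by (subst sum.reindex) (auto simp: inj_on_def vec_eq_iff)
    also have "\<dots> \<le> (\<Sum>f\<in>PiE UNIV (\<lambda>r :: 'd. {- int B..int B}). \<Prod>r\<in>UNIV. g (f r))"
    proof (intro sum_mono2 finite_PiE)
      show "vec_nth ` F \<subseteq> (\<Pi>\<^sub>E r\<in>UNIV. {- int B..int B})"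
      proof
        fix f assume "f \<in> vec_nth ` F"
        then obtain k where k: "k \<in> F" "f = vec_nth k" by auto
        show "f \<in> (\<Pi>\<^sub>E r\<in>UNIV. {- int B..int B})"
          using B[OF k(1)] by (auto simp: k(2) abs_le_iff PiE_def) (smt (verit))
      qed
    qed (auto intro!: prod_nonneg simp: g0)
    also have "\<dots> = (\<Prod>r\<in>(UNIV :: 'd set). \<Sum>j\<in>{- int B..int B}. g j)"
      by (subst prod_sum_PiE) auto
    also have "\<dots> \<le> (\<Prod>r\<in>(UNIV :: 'd set). Z)"
      by (intro prod_mono conjI sum_nonneg sumg) (auto simp: g0)
    finally show ?thesis by simp
  qed
  show ?thesis
    by (rule nonneg_bdd_above_summable_on) (auto intro!: bdd_aboveI[of _ "Z ^ CARD('d)"] bound)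
qed

lemma summable_inverse_wt_pow:
  assumes "m > CARD('d::finite)"
  shows "(\<lambda>k :: int ^ 'd. 1 / wt k ^ m) summable_on UNIV"
proof -
  have "(\<lambda>k :: int ^ 'd. wt k powr (- real m)) summable_on UNIV"
    by (rule summable_wt_powr) (use assms in simp)
  then show ?thesis
    by (simp add: powr_minus powr_realpow divide_simps)
qed

lemma dominated_summable:
  fixes a :: "'a \<Rightarrow> 'c :: banach"
  assumes "\<And>h. h \<in> A \<Longrightarrow> norm (a h) \<le> M h" and M: "M summable_on A"
  shows "(\<lambda>h. norm (a h)) summable_on A" and "a summable_on A"
    and "norm (infsum a A) \<le> infsum M A"
proof -
  show 1: "(\<lambda>h. norm (a h)) summable_on A"
    by (rule summable_on_comparison_test[OF M]) (use assms(1) in auto)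
  then show "a summable_on A" by (rule abs_summable_summable)
  have "norm (infsum a A) \<le> (\<Sum>\<^sub>\<infinity>h\<in>A. norm (a h))"
    by (rule norm_infsum_bound[OF 1])
  also have "\<dots> \<le> infsum M A"
    by (rule infsum_mono[OF 1 M assms(1)])
  finally show "norm (infsum a A) \<le> infsum M A" .
qed

text \<open>Dominated convergence for unordered sums.  It turns convergence of single coefficients into
  convergence of convolutions and of Sobolev norms.\<close>

lemma tannery_infsum:
  fixes f :: "'a \<Rightarrow> 'b \<Rightarrow> 'c :: banach"
  assumes lim: "\<And>h. (f h \<longlongrightarrow> g h) F"
    and bound: "eventually (\<lambda>y. \<forall>h. norm (f h y) \<le> M h) F"
    and M: "M summable_on UNIV"
  shows "((\<lambda>y. \<Sum>\<^sub>\<infinity>h. f h y) \<longlongrightarrow> (\<Sum>\<^sub>\<infinity>h. g h)) F"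
proof (cases "F = bot")
  case False
  have gM: "norm (g h) \<le> M h" for h
    by (rule tendsto_upperbound[OF tendsto_norm[OF lim]])
       (use bound False in \<open>auto elim: eventually_mono\<close>)
  have MA: "M summable_on A" for A
    by (rule summable_on_subset_banach[OF M]) simp
  show ?thesis
  proof (rule tendstoI)
    fix e :: real assume e: "e > 0"
    \<comment> \<open>Outside \<open>H\<close> both sums are small by domination; on the finite set \<open>H\<close> limit and sum commute.\<close>
    obtain H where H: "finite H" "dist (sum M H) (infsum M UNIV) \<le> e / 8"
      using infsum_finite_approximation[OF M, of "e / 8"] e by auto
    have tail: "norm (infsum a UNIV - sum a H) \<le> e / 8" if "\<And>h. norm (a h) \<le> M h" for a :: "'a \<Rightarrow> 'c"
    proof -
      have "infsum a UNIV = infsum a H + infsum a (- H)"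
        using infsum_Un_disjoint[of a H "- H"] dominated_summable(2)[OF that MA] H(1)
        by (simp add: Compl_partition)
      then have "infsum a UNIV - sum a H = infsum a (- H)" using H(1) by simp
      also have "norm \<dots> \<le> infsum M (- H)"
        by (rule dominated_summable(3)[OF that MA])
      also have "\<dots> = infsum M UNIV - sum M H"
        using infsum_Un_disjoint[of M H "- H"] MA H(1)
        by (simp add: Compl_partition)
      also have "\<dots> \<le> e / 8" using H(2) unfolding dist_real_def by linarith
      finally show ?thesis .
    qed
    have "((\<lambda>y. \<Sum>h\<in>H. f h y) \<longlongrightarrow> (\<Sum>h\<in>H. g h)) F"
      by (intro tendsto_sum lim)
    then have "eventually (\<lambda>y. dist (\<Sum>h\<in>H. f h y) (\<Sum>h\<in>H. g h) < e / 2) F"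
      using e by (intro tendstoD) auto
    with bound show "eventually (\<lambda>y. dist (\<Sum>\<^sub>\<infinity>h. f h y) (\<Sum>\<^sub>\<infinity>h. g h) < e) F"
    proof eventually_elim
      case (elim y)
      have 1: "norm ((\<Sum>\<^sub>\<infinity>h. f h y) - (\<Sum>h\<in>H. f h y)) \<le> e / 8"
        using tail[of "\<lambda>h. f h y"] elim(1) by simp
      have 2: "norm ((\<Sum>\<^sub>\<infinity>h. g h) - (\<Sum>h\<in>H. g h)) \<le> e / 8"
        using tail[of g] gM by simp
      have "norm ((\<Sum>\<^sub>\<infinity>h. f h y) - (\<Sum>\<^sub>\<infinity>h. g h)) \<le>
         norm ((\<Sum>\<^sub>\<infinity>h. f h y) - (\<Sum>h\<in>H. f h y)) + norm ((\<Sum>h\<in>H. f h y) - (\<Sum>h\<in>H. g h))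
          + norm ((\<Sum>\<^sub>\<infinity>h. g h) - (\<Sum>h\<in>H. g h))"
        by norm
      also have "\<dots> < e"
        using 1 2 elim(2) e by (simp add: dist_norm)
      finally show ?case by (simp add: dist_norm)
    qed
  qed
qed auto

section \<open>Fourier coefficients of products\<close>

lemma integral_exp_period:
  assumes "m \<noteq> 0"
  shows "integral {0..2 * pi} (\<lambda>y. exp (- \<i> * of_real (of_int m * y))) = 0"
proof -
  define c where "c = - \<i> * of_int m"
  have c: "c \<noteq> 0" using assms by (simp add: c_def)
  have "((\<lambda>y. exp (c * of_real y)) has_integral
     exp (c * of_real (2 * pi)) / c - exp (c * of_real 0) / c) {0..2 * pi}"
  proof (rule fundamental_theorem_of_calculus)
    fix y :: real
    show "((\<lambda>y. exp (c * of_real y) / c) has_vector_derivative exp (c * of_real y)) (at y within {0..2 * pi})"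
      by (rule has_vector_derivative_real_field) (use c in \<open>auto intro!: derivative_eq_intros\<close>)
  qed simp
  moreover have "exp (c * of_real (2 * pi)) = 1"
    using exp_integer_2pi[of "- of_int m"] by (simp add: c_def algebra_simps)
  ultimately show ?thesis
    by (simp add: integral_unique c_def mult_ac)
qed

lemma set_integrable_compact:
  fixes f :: "'a::euclidean_space \<Rightarrow> 'b::{banach, second_countable_topology}"
  shows "compact S \<Longrightarrow> continuous_on S f \<Longrightarrow> set_integrable lborel S f"
  unfolding set_integrable_def by (rule borel_integrable_compact)

text \<open>The integral over the cube factors into one dimensional integrals, one of which runs over
  full periods of a nonconstant exponential.\<close>

lemma integral_cube_exp:
  "integral (cbox 0 (\<chi> i. 2 * pi)) (\<lambda>x :: real ^ 'd::finite. exp (- \<i> * of_real (wvec l \<bullet> x))) =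
     (if l = 0 then of_real ((2 * pi) ^ CARD('d)) else (0 :: complex))"
proof (cases "l = 0")
  case True
  have c0: "(0 :: real ^ 'd) \<le> (\<chi> i. 2 * pi)" by (simp add: less_eq_vec_def)
  have "measure lborel (cbox (0 :: real ^ 'd) (\<chi> i. 2 * pi)) = (2 * pi) ^ CARD('d)"
    by (subst content_cbox_cart) (auto simp: interval_ne_empty_cart)
  then show ?thesis using True by (simp add: integral_const scaleR_conv_of_real)
next
  case False
  then obtain r where r: "l $ r \<noteq> 0" by (auto simp: vec_eq_iff)
  define m where "m = (\<lambda>b :: real ^ 'd. wvec l \<bullet> b)"
  define g where "g = (\<lambda>b :: real ^ 'd. \<lambda>y :: real. indicat_real {0..2 * pi} y *\<^sub>R exp (- \<i> * of_real (m b * y)))"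
  have int_g: "integrable lborel (g b)" for b
    unfolding g_def by (intro borel_integrable_compact continuous_intros compact_Icc)
  have prod_g: "(\<Prod>b\<in>Basis. g b (x \<bullet> b)) =
      indicat_real (cbox 0 (\<chi> i. 2 * pi)) x *\<^sub>R exp (- \<i> * of_real (wvec l \<bullet> x))" for x :: "real ^ 'd"
  proof (cases "x \<in> cbox 0 (\<chi> i. 2 * pi)")
    case True
    then have "x \<bullet> b \<in> {0..2 * pi}" if "b \<in> Basis" for b
      using that by (auto simp: mem_box_cart Basis_vec_def inner_axis)
    then have "(\<Prod>b\<in>Basis. g b (x \<bullet> b)) = (\<Prod>b\<in>Basis. exp (- \<i> * of_real (m b * (x \<bullet> b))))"
      by (intro prod.cong refl) (simp add: g_def)
    also have "\<dots> = exp (\<Sum>b\<in>Basis. - \<i> * of_real (m b * (x \<bullet> b)))"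
      by (simp add: exp_sum)
    also have "(\<Sum>b\<in>Basis. - \<i> * of_real (m b * (x \<bullet> b))) = - \<i> * of_real (wvec l \<bullet> x)"
      by (subst euclidean_inner[of "wvec l" x]) (simp add: m_def sum_distrib_left sum_negf)
    finally show ?thesis using True by simp
  next
    case False
    then obtain i where "\<not> (0 \<le> x $ i \<and> x $ i \<le> 2 * pi)"
      by (auto simp: mem_box_cart)
    then have "g (axis i 1) (x \<bullet> axis i 1) = 0" by (auto simp: g_def inner_axis)
    moreover have "axis i (1::real) \<in> (Basis :: (real ^ 'd) set)" by (simp add: axis_in_Basis_iff)
    ultimately have "(\<Prod>b\<in>Basis. g b (x \<bullet> b)) = 0"
      by (intro prod_zero) auto
    then show ?thesis using False by simp
  qed
  interpret product_sigma_finite "\<lambda>_. lborel :: real measure"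
    by unfold_locales
  have "integral (cbox 0 (\<chi> i. 2 * pi)) (\<lambda>x :: real ^ 'd. exp (- \<i> * of_real (wvec l \<bullet> x))) =
      (LINT x : cbox 0 (\<chi> i. 2 * pi) | lborel. exp (- \<i> * of_real (wvec l \<bullet> x)))"
    by (rule set_borel_integral_eq_integral(2)[symmetric, OF set_integrable_compact[OF compact_cbox]])
      (intro continuous_intros)
  also have "\<dots> = (LINT x | lborel. (\<Prod>b\<in>Basis. g b (x \<bullet> b)))"
    unfolding set_lebesgue_integral_def by (simp only: prod_g)
  also have "\<dots> = (LINT f | (\<Pi>\<^sub>M b\<in>Basis. lborel). (\<Prod>b\<in>Basis. g b ((\<Sum>c\<in>Basis. f c *\<^sub>R c) \<bullet> b)))"
  proof -
    have gm: "g b \<in> borel_measurable borel" for b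
      using borel_measurable_integrable[OF int_g] by simp
    have im: "(\<lambda>x :: real ^ 'd. x \<bullet> b) \<in> borel_measurable borel" for b
      by (intro borel_measurable_continuous_onI continuous_intros)
    have gi: "(\<lambda>x :: real ^ 'd. g b (x \<bullet> b)) \<in> borel_measurable borel" for b
      by (rule measurable_compose[OF im gm])
    have meas: "(\<lambda>x :: real ^ 'd. (\<Prod>b\<in>Basis. g b (x \<bullet> b))) \<in> borel_measurable borel"
      by (rule borel_measurable_prod) (rule gi)
    have "(\<lambda>f. \<Sum>c\<in>Basis. f c *\<^sub>R c) \<in> borel_measurable (\<Pi>\<^sub>M b\<in>(Basis :: (real ^ 'd) set). (lborel :: real measure))"
    proof (intro borel_measurable_sum borel_measurable_scaleR borel_measurable_const)
      fix c :: "real ^ 'd" assume "c \<in> Basis"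
      then show "(\<lambda>f. f c) \<in> borel_measurable (\<Pi>\<^sub>M b\<in>(Basis :: (real ^ 'd) set). (lborel :: real measure))"
        using measurable_component_singleton[of c Basis "\<lambda>_. lborel :: real measure"] by simp
    qed
    from integral_distr[OF this meas]
    have "(LINT x | distr (\<Pi>\<^sub>M b\<in>(Basis :: (real ^ 'd) set). (lborel :: real measure)) borel (\<lambda>f. \<Sum>c\<in>Basis. f c *\<^sub>R c).
        (\<Prod>b\<in>Basis. g b (x \<bullet> b))) =
      (LINT f | (\<Pi>\<^sub>M b\<in>Basis. lborel). (\<Prod>b\<in>Basis. g b ((\<Sum>c\<in>Basis. f c *\<^sub>R c) \<bullet> b)))" .
    then show ?thesis
      by (simp only: lborel_eq[where 'a = "real ^ 'd", symmetric])
  qed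
  also have "\<dots> = (LINT f | (\<Pi>\<^sub>M b\<in>Basis. lborel). (\<Prod>b\<in>Basis. g b (f b)))"
    by (intro Bochner_Integration.integral_cong prod.cong refl) simp
  also have "\<dots> = (\<Prod>b\<in>Basis. (LINT y | lborel. g b y))"
    by (rule product_integral_prod[OF finite_Basis int_g])
  also have "\<dots> = 0"
  proof (rule prod_zero)
    have "(LINT y | lborel. g (axis r 1) y) = integral {0..2 * pi} (\<lambda>y. exp (- \<i> * of_real (of_int (l $ r) * y)))"
      unfolding g_def set_lebesgue_integral_def[symmetric]
      by (subst set_borel_integral_eq_integral(2))
        (auto intro!: set_integrable_compact continuous_intros simp: m_def inner_axis wvec_def)
    then show "\<exists>b\<in>Basis. (LINT y | lborel. g b y) = 0"
      using integral_exp_period[OF r]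
      by (intro bexI[of _ "axis r 1"]) (auto simp: axis_in_Basis_iff)
  qed simp
  finally show ?thesis using False by simp
qed

lemma continuous_on_fourier_series:
  assumes "(\<lambda>h. norm (a h)) summable_on UNIV"
  shows "continuous_on S (fourier_series a)"
proof -
  have "uniform_limit S (\<lambda>H x. \<Sum>h\<in>H. a h * exp (\<i> * of_real (wvec h \<bullet> x))) (fourier_series a)
     (finite_subsets_at_top UNIV)"
    unfolding fourier_series_def [abs_def]
    by (rule Weierstrass_m_test_general[OF _ assms]) (simp add: norm_mult)
  then show ?thesis
    by (rule uniform_limit_theorem[rotated]) (auto intro!: continuous_intros always_eventually)
qed

text \<open>The series of the first factor converges uniformly, so it may be integrated term by term, and
  multiplication by \<open>exp (i h x)\<close> shifts the coefficients of the other factor by \<open>h\<close>.  The case \<open>g = 1\<close>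
  says that a summable family is recovered from its Fourier series; applied with \<open>g\<close> the second series it
  yields the convolution formula, so that no double series has to be rearranged.\<close>

lemma fourier_coeff_mult_series:
  fixes a :: "int ^ ('d::finite) \<Rightarrow> complex"
  assumes a: "(\<lambda>h. norm (a h)) summable_on UNIV"
    and g: "continuous_on (cbox 0 (\<chi> i. 2 * pi)) g"
  shows "fourier_coeff (\<lambda>x. fourier_series a x * g x) k = (\<Sum>\<^sub>\<infinity>h. a h * fourier_coeff g (k - h))"
proof -
  define C where "C = cbox (0 :: real ^ 'd) (\<chi> i. 2 * pi)"
  define E where "E = (\<lambda>l (x :: real ^ 'd). exp (- \<i> * complex_of_real (wvec l \<bullet> x)))"
  have cE: "continuous_on C (E l)" for l
    unfolding E_def by (intro continuous_intros)
  have "compact (g ` C)" unfolding C_def by (intro compact_continuous_image g compact_cbox)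
  then obtain B where B: "norm (g x) \<le> B" if "x \<in> C" for x
    using compact_imp_bounded bounded_iff by (metis imageI)
  have "uniform_limit C (\<lambda>H x. \<Sum>h\<in>H. a h * (g x * E (k - h) x))
     (\<lambda>x. \<Sum>\<^sub>\<infinity>h. a h * (g x * E (k - h) x)) (finite_subsets_at_top UNIV)"
  proof (rule Weierstrass_m_test_general)
    show "(\<lambda>h. norm (a h) * B) summable_on UNIV"
      using a by (rule summable_on_cmult_left)
  qed (use B in \<open>auto simp: norm_mult E_def intro!: mult_left_mono\<close>)
  moreover have "(\<Sum>\<^sub>\<infinity>h. a h * (g x * E (k - h) x)) = fourier_series a x * g x * E k x" for x
  proof -
    have "(\<lambda>h. a h * (g x * E (k - h) x)) = (\<lambda>h. (a h * exp (\<i> * of_real (wvec h \<bullet> x))) * (g x * E k x))"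
      by (auto simp: E_def wvec_diff inner_diff_left algebra_simps simp flip: exp_add)
    then show ?thesis
      unfolding fourier_series_def
      using infsum_cmult_left'[of "\<lambda>h. a h * exp (\<i> * of_real (wvec h \<bullet> x))" "g x * E k x" UNIV]
      by (simp only: mult.assoc)
  qed
  ultimately have unif: "uniform_limit C (\<lambda>H x. \<Sum>h\<in>H. a h * (g x * E (k - h) x))
     (\<lambda>x. fourier_series a x * g x * E k x) (finite_subsets_at_top UNIV)"
    by simp
  have g': "continuous_on C g" using g by (simp add: C_def)
  have cont: "continuous_on C (\<lambda>x. \<Sum>h\<in>H. a h * (g x * E (k - h) x))" for H
    by (intro continuous_intros g' cE)
  obtain I J where IJ': "\<And>H. ((\<lambda>x. \<Sum>h\<in>H. a h * (g x * E (k - h) x)) has_integral I H) (cbox 0 (\<chi> i. 2 * pi))"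
      "((\<lambda>x. fourier_series a x * g x * E k x) has_integral J) (cbox 0 (\<chi> i. 2 * pi))"
      "(I \<longlongrightarrow> J) (finite_subsets_at_top UNIV)"
    by (rule uniform_limit_integral_cbox[OF unif[unfolded C_def] cont[unfolded C_def] finite_subsets_at_top_neq_bot]) blast
  note IJ = IJ'[folded C_def]
  define D where "D = complex_of_real ((2 * pi) ^ CARD('d))"
  have D: "D \<noteq> 0" by (simp add: D_def)
  have fc: "fourier_coeff f l = integral C (\<lambda>x. f x * E l x) / D" for f l
    by (simp add: fourier_coeff_def C_def E_def D_def)
  have I: "I H = (\<Sum>h\<in>H. a h * (D * fourier_coeff g (k - h)))" if "finite H" for H
  proof -
    have "((\<lambda>x. \<Sum>h\<in>H. a h * (g x * E (k - h) x)) has_integral (\<Sum>h\<in>H. a h * (D * fourier_coeff g (k - h)))) C"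
    proof (intro has_integral_sum that has_integral_mult_right)
      fix h
      have "(\<lambda>x. g x * E (k - h) x) integrable_on C"
        unfolding C_def by (intro integrable_continuous continuous_intros g'[unfolded C_def] cE[unfolded C_def])
      then show "((\<lambda>x. g x * E (k - h) x) has_integral D * fourier_coeff g (k - h)) C"
        by (simp add: fc D integrable_integral)
    qed
    then show ?thesis using IJ(1)[of H] has_integral_unique by blast
  qed
  have "((\<lambda>h. a h * (D * fourier_coeff g (k - h))) has_sum J) UNIV"
    unfolding has_sum_def
    by (rule Lim_transform_eventually[OF IJ(3)])
       (auto intro!: eventually_finite_subsets_at_top_weakI simp: I)
  then have "J = (\<Sum>\<^sub>\<infinity>h. D * (a h * fourier_coeff g (k - h)))"
    by (simp add: infsumI mult_ac)
  also have "\<dots> = D * (\<Sum>\<^sub>\<infinity>h. a h * fourier_coeff g (k - h))"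
    by (rule infsum_cmult_right')
  finally show ?thesis
    using IJ(2) D by (simp add: fc integral_unique)
qed

lemma fourier_coeff_fourier_series:
  assumes a: "(\<lambda>h. norm (a h)) summable_on UNIV"
  shows "fourier_coeff (fourier_series a) k = a k"
proof -
  have "fourier_coeff (\<lambda>x. 1) l = (if l = 0 then 1 else 0)" for l :: "int ^ 'a"
    using integral_cube_exp[of l] by (auto simp: fourier_coeff_def)
  then have "fourier_coeff (fourier_series a) k = (\<Sum>\<^sub>\<infinity>h. a h * (if k - h = 0 then 1 else 0))"
    using fourier_coeff_mult_series[OF a, of "\<lambda>x. 1" k] by simp
  also have "\<dots> = (\<Sum>\<^sub>\<infinity>h\<in>{k}. a h)"
    by (rule infsum_cong_neutral) auto
  finally show ?thesis by simp
qed

theorem fourier_coeff_product: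
  assumes a: "(\<lambda>h. norm (a h)) summable_on UNIV" and b: "(\<lambda>h. norm (b h)) summable_on UNIV"
  shows "fourier_coeff (\<lambda>x. fourier_series a x * fourier_series b x) k = (\<Sum>\<^sub>\<infinity>h. a h * b (k - h))"
  by (simp add: fourier_coeff_mult_series[OF a continuous_on_fourier_series[OF b]]
      fourier_coeff_fourier_series[OF b])

section \<open>The quadratic nonlinearity as a convolution\<close>

definition kdot :: "int ^ ('d::finite) \<Rightarrow> complex ^ 'd \<Rightarrow> complex" where
  "kdot k a = (\<Sum>s\<in>UNIV. of_int (k $ s) * a $ s)"

text \<open>The Leray projection at a single wave vector; for \<open>k = 0\<close> the division by zero makes it the identity.\<close>

definition leray_at :: "int ^ ('d::finite) \<Rightarrow> complex ^ 'd \<Rightarrow> complex ^ 'd" where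
  "leray_at k a = (\<chi> r. a $ r - kdot k a / of_real ((norm (wvec k))\<^sup>2) * of_int (k $ r))"

text \<open>The bilinear map by which the modes \<open>h\<close> and \<open>k - h\<close> contribute to the mode \<open>k\<close> of the nonlinearity.\<close>

definition symbol :: "int ^ ('d::finite) \<Rightarrow> complex ^ 'd \<Rightarrow> complex ^ 'd \<Rightarrow> complex ^ 'd" where
  "symbol k a b = - leray_at k (\<chi> r. \<i> * kdot k a * b $ r)"

lemma div_free_iff_kdot: "div_free v \<longleftrightarrow> (\<forall>k. kdot k (v k) = 0)"
  by (simp add: div_free_def kdot_def)

lemma kdot_add: "kdot k (a + b) = kdot k a + kdot k b"
  and kdot_diff: "kdot k (a - b) = kdot k a - kdot k b"
  and kdot_scaleR: "kdot k (c *\<^sub>R a) = c *\<^sub>R kdot k a"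
  and kdot_minus: "kdot k (- a) = - kdot k a"
  by (simp_all add: kdot_def algebra_simps sum.distrib sum_subtractf scaleR_sum_right sum_negf)

lemma kdot_diff_left: "kdot (k - h) a = kdot k a - kdot h a"
  by (simp add: kdot_def algebra_simps sum_subtractf)

lemma kdot_zero [simp]: "kdot 0 a = 0" "kdot k 0 = 0"
  by (simp_all add: kdot_def)

lemma norm_kdot_le: "norm (kdot k a) \<le> norm (wvec k) * norm a"
proof -
  have "norm (kdot k a) \<le> (\<Sum>s\<in>UNIV. norm (of_int (k $ s) * a $ s))"
    unfolding kdot_def by (rule norm_sum)
  also have "\<dots> = (\<Sum>s\<in>UNIV. \<bar>norm (wvec k $ s)\<bar> * \<bar>norm (a $ s)\<bar>)"
    by (simp add: norm_mult wvec_def)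
  also have "\<dots> \<le> norm (wvec k) * norm a"
    unfolding norm_vec_def by (rule L2_set_mult_ineq)
  finally show ?thesis .
qed

lemma norm_vec_cmult: "norm (\<chi> r. (c :: complex) * of_int (k $ r)) = norm c * norm (wvec k)"
proof -
  have "L2_set (\<lambda>r. norm c * \<bar>real_of_int (k $ r)\<bar>) UNIV = norm c * L2_set (\<lambda>r. \<bar>real_of_int (k $ r)\<bar>) UNIV"
    by (rule L2_set_right_distrib[symmetric]) simp
  then show ?thesis by (simp add: norm_vec_def norm_mult wvec_def)
qed

lemma norm_cmult_vec: "norm (\<chi> r. (c :: complex) * b $ r) = norm c * norm b"
proof -
  have "L2_set (\<lambda>r. norm c * norm (b $ r)) UNIV = norm c * L2_set (\<lambda>r. norm (b $ r)) UNIV"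
    by (rule L2_set_right_distrib[symmetric]) simp
  then show ?thesis by (simp add: norm_vec_def norm_mult)
qed

text \<open>A projection has norm one; the triangle inequality gives the factor \<open>2\<close> without orthogonality.\<close>

lemma norm_leray_at_le: "norm (leray_at k a) \<le> 2 * norm a"
proof (cases "k = 0")
  case True
  then have "leray_at k a = a" by (simp add: leray_at_def vec_eq_iff)
  then show ?thesis by simp
next
  case False
  define c where "c = kdot k a / of_real ((norm (wvec k))\<^sup>2)"
  have k: "norm (wvec k) > 0" using norm_wvec_ge_1[OF False] by linarith
  have "leray_at k a = a - (\<chi> r. c * of_int (k $ r))"
    by (simp add: leray_at_def vec_eq_iff c_def)
  then have "norm (leray_at k a) \<le> norm a + norm c * norm (wvec k)"
    using norm_triangle_ineq4[of a "\<chi> r. c * of_int (k $ r)"] by (simp add: norm_vec_cmult)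
  also have "norm c * norm (wvec k) = norm (kdot k a) / norm (wvec k)"
  proof -
    have "norm c = norm (kdot k a) / (norm (wvec k))\<^sup>2"
      by (simp add: c_def norm_divide norm_power)
    then show ?thesis using k by (simp add: power2_eq_square)
  qed
  also have "\<dots> \<le> norm a"
    using norm_kdot_le[of k a] k by (simp add: divide_simps mult.commute)
  finally show ?thesis by simp
qed

lemma bounded_linear_leray_at: "bounded_linear (leray_at k)"
proof (rule bounded_linear_intro[of _ 2])
  fix a b :: "complex ^ 'a" and c :: real
  show "leray_at k (a + b) = leray_at k a + leray_at k b"
    by (simp add: leray_at_def vec_eq_iff kdot_add add_divide_distrib algebra_simps)
  show "leray_at k (c *\<^sub>R a) = c *\<^sub>R leray_at k a"
    by (simp add: leray_at_def vec_eq_iff kdot_scaleR scaleR_conv_of_real[where 'a = complex] algebra_simps)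
  show "norm (leray_at k a) \<le> norm a * 2"
    using norm_leray_at_le[of k a] by simp
qed

lemma norm_symbol_le: "norm (symbol k a b) \<le> 2 * norm (wvec k) * norm a * norm b"
proof -
  have "norm (symbol k a b) \<le> 2 * (norm (kdot k a) * norm b)"
    using norm_leray_at_le[of k "\<chi> r. \<i> * kdot k a * b $ r"] norm_cmult_vec[of "\<i> * kdot k a" b]
    by (simp add: symbol_def norm_mult)
  also have "\<dots> \<le> 2 * (norm (wvec k) * norm a * norm b)"
    by (intro mult_left_mono mult_right_mono norm_kdot_le) auto
  finally show ?thesis by (simp add: mult_ac)
qed

lemma symbol_zero [simp]: "symbol 0 a b = 0"
  using norm_symbol_le[of 0 a b] by simp

lemma bounded_bilinear_symbol: "bounded_bilinear (symbol k)"
proof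
  interpret L: bounded_linear "leray_at k" by (rule bounded_linear_leray_at)
  fix a a' b b' :: "complex ^ 'a" and c :: real
  show "symbol k (a + a') b = symbol k a b + symbol k a' b"
    unfolding symbol_def by (simp add: L.add[symmetric] kdot_add algebra_simps) (simp add: vec_eq_iff plus_vec_def algebra_simps)
  show "symbol k a (b + b') = symbol k a b + symbol k a b'"
    unfolding symbol_def by (simp add: L.add[symmetric] algebra_simps) (simp add: vec_eq_iff plus_vec_def algebra_simps)
  show "symbol k (c *\<^sub>R a) b = c *\<^sub>R symbol k a b"
    unfolding symbol_def by (simp add: L.scaleR[symmetric] kdot_scaleR) (simp add: vec_eq_iff scaleR_vec_def)
  show "symbol k a (c *\<^sub>R b) = c *\<^sub>R symbol k a b"
    unfolding symbol_def by (simp add: L.scaleR[symmetric]) (simp add: vec_eq_iff scaleR_vec_def)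
  show "\<exists>K. \<forall>a b. norm (symbol k a b) \<le> norm a * norm b * K"
    using norm_symbol_le[of k] by (intro exI[of _ "2 * norm (wvec k)"]) (simp add: mult_ac)
qed

lemmas symbol_add_left = bounded_bilinear.add_left[OF bounded_bilinear_symbol]
  and symbol_add_right = bounded_bilinear.add_right[OF bounded_bilinear_symbol]
  and symbol_scaleR_left = bounded_bilinear.scaleR_left[OF bounded_bilinear_symbol]
  and symbol_scaleR_right = bounded_bilinear.scaleR_right[OF bounded_bilinear_symbol]
  and tendsto_symbol = bounded_bilinear.tendsto[OF bounded_bilinear_symbol]

lemma kdot_symbol [simp]: "kdot k (symbol k a b) = 0"
proof (cases "k = 0")
  case False
  define z where "z = (\<chi> r. \<i> * kdot k a * b $ r)"
  define c where "c = kdot k z / of_real ((norm (wvec k))\<^sup>2)"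
  have "(norm (wvec k))\<^sup>2 = (\<Sum>s\<in>UNIV. (real_of_int (k $ s))\<^sup>2)"
    by (simp add: norm_vec_def L2_set_def wvec_def sum_nonneg)
  then have nk: "complex_of_real ((norm (wvec k))\<^sup>2) = (\<Sum>s\<in>UNIV. of_int (k $ s) * of_int (k $ s))"
    by (simp add: power2_eq_square)
  have "kdot k (leray_at k z) = kdot k z - c * (\<Sum>s\<in>UNIV. of_int (k $ s) * of_int (k $ s))"
  proof -
    have "leray_at k z $ s = z $ s - c * of_int (k $ s)" for s
      by (simp add: leray_at_def c_def)
    then show ?thesis
      unfolding kdot_def[of k "leray_at k z"] kdot_def[of k z]
      by (simp only:) (simp add: algebra_simps sum_subtractf sum_distrib_left)
  qed
  also have "\<dots> = 0"
    using False unfolding nk[symmetric] c_def by simp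
  finally show ?thesis by (simp add: symbol_def kdot_minus z_def)
qed simp

text \<open>Componentwise conjugation, in terms of which a field is real valued iff \<open>cnjv (v k) = v (- k)\<close>.\<close>

definition cnjv :: "complex ^ ('d::finite) \<Rightarrow> complex ^ 'd" where
  "cnjv a = (\<chi> r. cnj (a $ r))"

lemma cnjv_symbol: "cnjv (symbol k a b) = symbol (- k) (cnjv a) (cnjv b)"
  by (simp add: symbol_def leray_at_def vec_eq_iff cnjv_def wvec_minus kdot_def sum_negf)

lemma bounded_linear_cnjv: "bounded_linear cnjv"
  by (rule bounded_linear_intro[of _ 1]) (simp_all add: cnjv_def vec_eq_iff norm_vec_def)

subsection \<open>Fields with absolutely summable coefficients\<close>

lemma has_sum_sum_finite:
  fixes f :: "'b \<Rightarrow> 'a \<Rightarrow> 'c :: topological_comm_monoid_add"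
  assumes "\<And>i. (f i has_sum S i) A"
  shows "((\<lambda>x. \<Sum>i\<in>I. f i x) has_sum (\<Sum>i\<in>I. S i)) A"
  using assms by (induction I rule: infinite_finite_induct) (auto intro: has_sum_add)

text \<open>Divergence freedom lets the derivative be moved in front of the product:
  \<open>v \<cdot> \<partial> w\<close> has symbol \<open>\<i> (v\<^sub>h \<cdot> (k - h)) w\<^sub>k\<^sub>-\<^sub>h = \<i> (v\<^sub>h \<cdot> k) w\<^sub>k\<^sub>-\<^sub>h\<close>, so the loss of one derivative
  appears as a factor \<open>|k|\<close> in front of a convolution.\<close>

lemma has_sum_NSP:
  fixes v w :: "('d::finite) field"
  assumes dv: "div_free v"
    and v: "(\<lambda>h. norm (v h)) summable_on UNIV"
    and w: "(\<lambda>h. wt h * norm (w h)) summable_on UNIV"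
  shows "((\<lambda>h. symbol k (v h) (w (k - h))) has_sum NSP v w k) UNIV"
proof -
  have v': "(\<lambda>h. norm (v h $ s)) summable_on UNIV" for s
    by (rule summable_on_comparison_test[OF v]) (auto simp: Finite_Cartesian_Product.norm_nth_le)
  have w': "(\<lambda>h. norm (partial_coeff s r w h)) summable_on UNIV" for s r
  proof (rule summable_on_comparison_test[OF w])
    fix h
    have "\<bar>real_of_int (h $ s)\<bar> \<le> norm (wvec h)"
      using component_le_norm_cart[of "wvec h" s] by (simp add: wvec_def)
    then show "norm (partial_coeff s r w h) \<le> wt h * norm (w h)"
      using Finite_Cartesian_Product.norm_nth_le[of "w h" r] norm_wvec_le_wt[of h]
      by (auto simp: partial_coeff_def norm_mult intro!: mult_mono)
  qed simp
  define C where "C = cbox (0 :: real ^ 'd) (\<chi> i. 2 * pi)"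
  let ?a = "\<lambda>s. \<lambda>h. v h $ s"
  define term1 where "term1 = (\<lambda>h. \<chi> r. \<i> * kdot k (v h) * w (k - h) $ r)"
  have wk: "(\<lambda>h. wt (k - h) * norm (w (k - h))) summable_on UNIV"
    by (rule summable_on_reindex_bij_betw[THEN iffD2, OF _ w, of "\<lambda>h. k - h", simplified o_def])
      (auto intro!: bij_betwI[of _ _ _ "\<lambda>h. k - h"])
  have bdd: "\<exists>B. \<forall>h. norm (v h) \<le> B"
  proof -
    have "norm (v h) \<le> (\<Sum>\<^sub>\<infinity>h. norm (v h))" for h
      using finite_sum_le_infsum[OF v, of "{h}"] by simp
    then show ?thesis by blast
  qed
  then obtain B where B: "\<And>h. norm (v h) \<le> B" by blast
  have B0: "0 \<le> B" using B[of 0] norm_ge_zero[of "v 0"] by linarith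
  have "norm (term1 h) \<le> norm (wvec k) * B * (wt (k - h) * norm (w (k - h)))" for h
  proof -
    have "norm (term1 h) = norm (kdot k (v h)) * norm (w (k - h))"
      unfolding term1_def using norm_cmult_vec[of "\<i> * kdot k (v h)" "w (k - h)"] by (simp add: norm_mult)
    also have "\<dots> \<le> (norm (wvec k) * B) * (1 * norm (w (k - h)))"
      using B[of h] B0 by (auto intro!: mult_mono order_trans[OF norm_kdot_le] mult_left_mono)
    also have "\<dots> \<le> (norm (wvec k) * B) * (wt (k - h) * norm (w (k - h)))"
      using B0 by (intro mult_left_mono mult_right_mono wt_ge_1 mult_nonneg_nonneg norm_ge_zero)
    finally show ?thesis .
  qed
  then have sum1: "term1 summable_on UNIV"
    by (rule dominated_summable(2)) (intro summable_on_cmult_right wk)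
  have "advect v w k $ r = infsum term1 UNIV $ r" for r
  proof -
    have cont: "continuous_on C (fourier_series (?a s))" "continuous_on C (fourier_series (partial_coeff s r w))" for s
      by (intro continuous_on_fourier_series v' w')+
    have int: "(\<lambda>x. fourier_series (?a s) x * fourier_series (partial_coeff s r w) x
        * exp (- \<i> * of_real (wvec k \<bullet> x))) integrable_on C" for s
      unfolding C_def by (intro integrable_continuous continuous_intros cont[unfolded C_def])
    have "advect v w k $ r = (\<Sum>s\<in>UNIV. fourier_coeff (\<lambda>x. fourier_series (?a s) x * fourier_series (partial_coeff s r w) x) k)"
      unfolding advect_def fourier_coeff_def
      using int by (simp add: C_def sum_distrib_right integral_sum sum_divide_distrib)
    also have "\<dots> = (\<Sum>s\<in>UNIV. \<Sum>\<^sub>\<infinity>h. v h $ s * partial_coeff s r w (k - h))"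
      by (simp add: fourier_coeff_product[OF v' w'])
    also have "\<dots> = (\<Sum>\<^sub>\<infinity>h. \<Sum>s\<in>UNIV. v h $ s * partial_coeff s r w (k - h))"
    proof (rule infsumI[symmetric, OF has_sum_sum_finite])
      fix s
      have "(\<lambda>h. norm (partial_coeff s r w (k - h))) summable_on UNIV"
        by (rule summable_on_reindex_bij_betw[THEN iffD2, OF _ w', of "\<lambda>h. k - h", simplified o_def])
          (auto intro!: bij_betwI[of _ _ _ "\<lambda>h. k - h"])
      then have "(\<lambda>h. B * norm (partial_coeff s r w (k - h))) summable_on UNIV"
        by (rule summable_on_cmult_right)
      then have "(\<lambda>h. v h $ s * partial_coeff s r w (k - h)) summable_on UNIV"
        by (rule dominated_summable(2)[rotated])
          (auto simp: norm_mult intro!: mult_right_mono order_trans[OF Finite_Cartesian_Product.norm_nth_le B])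
      then show "((\<lambda>h. v h $ s * partial_coeff s r w (k - h)) has_sum (\<Sum>\<^sub>\<infinity>h. v h $ s * partial_coeff s r w (k - h))) UNIV"
        by simp
    qed
    also have "\<dots> = (\<Sum>\<^sub>\<infinity>h. term1 h $ r)"
    proof (rule infsum_cong)
      fix h
      have "(\<Sum>s\<in>UNIV. v h $ s * partial_coeff s r w (k - h)) = \<i> * kdot (k - h) (v h) * w (k - h) $ r"
        by (simp add: partial_coeff_def kdot_def sum_distrib_left sum_distrib_right mult_ac)
      then show "(\<Sum>s\<in>UNIV. v h $ s * partial_coeff s r w (k - h)) = term1 h $ r"
        using dv by (simp add: kdot_diff_left div_free_iff_kdot term1_def)
    qed
    also have "\<dots> = infsum term1 UNIV $ r"
      using has_sum_bounded_linear[OF bounded_linear_vec_nth has_sum_infsum[OF sum1]] by (simp add: infsumI)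
    finally show ?thesis .
  qed
  then have adv: "advect v w k = infsum term1 UNIV"
    by (simp add: vec_eq_iff)
  have "((\<lambda>h. - leray_at k (term1 h)) has_sum - leray_at k (advect v w k)) UNIV"
    unfolding adv
    by (rule has_sum_bounded_linear[OF bounded_linear_minus[OF bounded_linear_leray_at] has_sum_infsum[OF sum1]])
  moreover have "- leray_at k (advect v w k) = NSP v w k"
    by (simp add: NSP_def leray_def leray_at_def kdot_def)
  ultimately show ?thesis
    by (simp add: symbol_def term1_def)
qed

lemma NSP_zero_mode:
  assumes "div_free v" "(\<lambda>h. norm (v h)) summable_on UNIV" "(\<lambda>h. wt h * norm (w h)) summable_on UNIV"
  shows "NSP v w 0 = 0"
  using has_sum_NSP[OF assms, of 0] by (simp add: has_sum_unique[OF _ has_sum_0_simp])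

text \<open>The coefficients of the field and of its gradient are absolutely summable; this is the natural
  domain of the convolution formula for the nonlinearity.\<close>

definition wiener :: "('d::finite) field \<Rightarrow> bool" where
  "wiener v \<longleftrightarrow> (\<lambda>h. wt h * norm (v h)) summable_on UNIV"

definition l1 :: "('d::finite) field \<Rightarrow> real" where
  "l1 v = (\<Sum>\<^sub>\<infinity>h. norm (v h))"

lemma wiener_abs_summable: "wiener v \<Longrightarrow> (\<lambda>h. norm (v h)) summable_on UNIV"
  unfolding wiener_def
  by (erule summable_on_comparison_test) (use mult_right_mono[OF wt_ge_1 norm_ge_zero] in auto)

lemma l1_nonneg: "0 \<le> l1 v"
  by (simp add: l1_def infsum_nonneg)

lemma norm_le_l1: "wiener v \<Longrightarrow> norm (v k) \<le> l1 v"
  using finite_sum_le_infsum[OF wiener_abs_summable, of v "{k}"] by (simp add: l1_def)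

lemma abs_summable_reflect:
  fixes f :: "int ^ ('d::finite) \<Rightarrow> real"
  shows "(\<lambda>h. f (k - h)) summable_on UNIV \<longleftrightarrow> f summable_on UNIV"
    and "(\<Sum>\<^sub>\<infinity>h. f (k - h)) = (\<Sum>\<^sub>\<infinity>h. f h)"
proof -
  have bij: "bij_betw (\<lambda>h. k - h) UNIV UNIV"
    by (auto intro!: bij_betwI[of _ _ _ "\<lambda>h. k - h"])
  show "(\<lambda>h. f (k - h)) summable_on UNIV \<longleftrightarrow> f summable_on UNIV"
    by (rule summable_on_reindex_bij_betw[OF bij])
  show "(\<Sum>\<^sub>\<infinity>h. f (k - h)) = (\<Sum>\<^sub>\<infinity>h. f h)"
    by (rule infsum_reindex_bij_betw[OF bij])
qed

lemma wiener_add: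
  assumes "wiener v" "wiener w"
  shows "wiener (\<lambda>k. v k + w k)"
proof -
  have "(\<lambda>k. wt k * norm (v k) + wt k * norm (w k)) summable_on UNIV"
    using assms unfolding wiener_def by (rule summable_on_add)
  then show ?thesis
    unfolding wiener_def
    by (rule summable_on_comparison_test) (auto simp: norm_triangle_ineq simp flip: distrib_left intro!: mult_left_mono)
qed

lemma wiener_scaleR: "wiener v \<Longrightarrow> wiener (\<lambda>k. c *\<^sub>R v k)"
  unfolding wiener_def
  by (drule summable_on_cmult_right[of _ _ "\<bar>c\<bar>"]) (simp add: mult_ac)

lemma div_free_add: "div_free v \<Longrightarrow> div_free w \<Longrightarrow> div_free (\<lambda>k. v k + w k)"
  and div_free_diff: "div_free v \<Longrightarrow> div_free w \<Longrightarrow> div_free (\<lambda>k. v k - w k)"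
  and div_free_scaleR: "div_free v \<Longrightarrow> div_free (\<lambda>k. c *\<^sub>R v k)"
  by (simp_all add: div_free_iff_kdot kdot_add kdot_diff kdot_scaleR)

lemma wiener_diff: "wiener v \<Longrightarrow> wiener w \<Longrightarrow> wiener (\<lambda>k. v k - w k)"
  using wiener_add[of v "\<lambda>k. (- 1) *\<^sub>R w k"] wiener_scaleR[of w "- 1"] by simp

lemma has_sum_NSP_wiener:
  "div_free v \<Longrightarrow> wiener v \<Longrightarrow> wiener w \<Longrightarrow> ((\<lambda>h. symbol k (v h) (w (k - h))) has_sum NSP v w k) UNIV"
  by (rule has_sum_NSP[OF _ wiener_abs_summable]) (simp_all add: wiener_def)

lemma NSP_eq_infsum:
  "div_free v \<Longrightarrow> wiener v \<Longrightarrow> wiener w \<Longrightarrow> NSP v w k = (\<Sum>\<^sub>\<infinity>h. symbol k (v h) (w (k - h)))"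
  by (rule infsumI[symmetric, OF has_sum_NSP_wiener])

lemma NSP_add_left:
  assumes "div_free v" "div_free v'" "wiener v" "wiener v'" "wiener w"
  shows "NSP (\<lambda>k. v k + v' k) w k = NSP v w k + NSP v' w k"
proof (rule has_sum_unique)
  show "((\<lambda>h. symbol k (v h + v' h) (w (k - h))) has_sum NSP (\<lambda>k. v k + v' k) w k) UNIV"
    by (rule has_sum_NSP_wiener) (intro assms div_free_add wiener_add)+
  show "((\<lambda>h. symbol k (v h + v' h) (w (k - h))) has_sum NSP v w k + NSP v' w k) UNIV"
    unfolding symbol_add_left by (intro has_sum_add has_sum_NSP_wiener assms)
qed

lemma NSP_add_right:
  assumes "div_free v" "wiener v" "wiener w" "wiener w'"
  shows "NSP v (\<lambda>k. w k + w' k) k = NSP v w k + NSP v w' k"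
proof (rule has_sum_unique)
  show "((\<lambda>h. symbol k (v h) (w (k - h) + w' (k - h))) has_sum NSP v (\<lambda>k. w k + w' k) k) UNIV"
    by (rule has_sum_NSP_wiener) (intro assms div_free_add wiener_add)+
  show "((\<lambda>h. symbol k (v h) (w (k - h) + w' (k - h))) has_sum NSP v w k + NSP v w' k) UNIV"
    unfolding symbol_add_right by (intro has_sum_add has_sum_NSP_wiener assms)
qed

lemma NSP_diff_left:
  assumes "div_free v" "div_free v'" "wiener v" "wiener v'" "wiener w"
  shows "NSP (\<lambda>k. v k - v' k) w k = NSP v w k - NSP v' w k"
  using NSP_add_left[of "\<lambda>k. v k - v' k" v' w k] assms by (simp add: div_free_diff wiener_diff)

lemma NSP_diff_right:
  assumes "div_free v" "wiener v" "wiener w" "wiener w'"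
  shows "NSP v (\<lambda>k. w k - w' k) k = NSP v w k - NSP v w' k"
  using NSP_add_right[of v "\<lambda>k. w k - w' k" w' k] assms by (simp add: wiener_diff)

lemma NSP_scaleR_left:
  assumes "div_free v" "wiener v" "wiener w"
  shows "NSP (\<lambda>k. c *\<^sub>R v k) w k = c *\<^sub>R NSP v w k"
proof (rule has_sum_unique)
  show "((\<lambda>h. symbol k (c *\<^sub>R v h) (w (k - h))) has_sum NSP (\<lambda>k. c *\<^sub>R v k) w k) UNIV"
    by (rule has_sum_NSP_wiener) (intro assms div_free_scaleR wiener_scaleR)+
  show "((\<lambda>h. symbol k (c *\<^sub>R v h) (w (k - h))) has_sum c *\<^sub>R NSP v w k) UNIV"
    unfolding symbol_scaleR_left by (intro has_sum_scaleR has_sum_NSP_wiener assms)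
qed

lemma NSP_scaleR_right:
  assumes "div_free v" "wiener v" "wiener w"
  shows "NSP v (\<lambda>k. c *\<^sub>R w k) k = c *\<^sub>R NSP v w k"
proof (rule has_sum_unique)
  show "((\<lambda>h. symbol k (v h) (c *\<^sub>R w (k - h))) has_sum NSP v (\<lambda>k. c *\<^sub>R w k) k) UNIV"
    by (rule has_sum_NSP_wiener) (intro assms div_free_scaleR wiener_scaleR)+
  show "((\<lambda>h. symbol k (v h) (c *\<^sub>R w (k - h))) has_sum c *\<^sub>R NSP v w k) UNIV"
    unfolding symbol_scaleR_right by (intro has_sum_scaleR has_sum_NSP_wiener assms)
qed

subsection \<open>Weighted bounds\<close>

definition decay :: "nat \<Rightarrow> real \<Rightarrow> ('d::finite) field \<Rightarrow> bool" where
  "decay q C v \<longleftrightarrow> (\<forall>k. wt k ^ q * norm (v k) \<le> C)"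

lemma decay_nonneg: "decay q C v \<Longrightarrow> 0 \<le> C"
  unfolding decay_def by (erule allE[of _ 0]) (auto intro: order_trans[rotated])

lemma decayD: "decay q C v \<Longrightarrow> wt k ^ q * norm (v k) \<le> C"
  by (simp add: decay_def)

lemma decay_mono: "decay q C v \<Longrightarrow> C \<le> C' \<Longrightarrow> decay q C' v"
  unfolding decay_def by (auto intro: order_trans)

lemma decay_less:
  assumes "decay q C v" "p \<le> q"
  shows "decay p C v"
  unfolding decay_def
proof
  fix k
  have "wt k ^ p * norm (v k) \<le> wt k ^ q * norm (v k)"
    by (intro mult_right_mono power_increasing assms wt_ge_1 norm_ge_zero)
  also have "\<dots> \<le> C" by (rule decayD[OF assms(1)])
  finally show "wt k ^ p * norm (v k) \<le> C" .
qed

lemma decay_triangle: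
  assumes "decay q A v" "decay q B w" "\<And>k. norm (u k) \<le> norm (v k) + norm (w k)"
  shows "decay q (A + B) u"
  unfolding decay_def
proof
  fix k
  have "wt k ^ q * norm (u k) \<le> wt k ^ q * (norm (v k) + norm (w k))"
    by (intro mult_left_mono assms) simp
  also have "\<dots> \<le> A + B"
    using decayD[OF assms(1), of k] decayD[OF assms(2), of k] by (simp add: distrib_left)
  finally show "wt k ^ q * norm (u k) \<le> A + B" .
qed

lemma decay_add: "decay q A v \<Longrightarrow> decay q B w \<Longrightarrow> decay q (A + B) (\<lambda>k. v k + w k)"
  by (erule (1) decay_triangle) (rule norm_triangle_ineq)

lemma decay_diff: "decay q A v \<Longrightarrow> decay q B w \<Longrightarrow> decay q (A + B) (\<lambda>k. v k - w k)"
  by (erule (1) decay_triangle) (rule norm_triangle_ineq4)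

lemma decay_scaleR: "decay q A v \<Longrightarrow> decay q (\<bar>c\<bar> * A) (\<lambda>k. c *\<^sub>R v k)"
  unfolding decay_def by (auto simp: mult.left_commute intro!: mult_left_mono)

definition lattice_sum :: "('d::finite) itself \<Rightarrow> real" where
  "lattice_sum _ = (\<Sum>\<^sub>\<infinity>k :: int ^ 'd. 1 / wt k ^ (CARD('d) + 1))"

lemma decay_summable:
  fixes v :: "('d::finite) field"
  assumes "decay (CARD('d) + 2) C v"
  shows "wiener v" and "l1 v \<le> C * lattice_sum TYPE('d)"
proof -
  have le: "wt k * norm (v k) \<le> C * (1 / wt k ^ (CARD('d) + 1))" for k
    using assms by (simp add: decay_def divide_simps mult_ac)
  have S: "(\<lambda>k :: int ^ 'd. C * (1 / wt k ^ (CARD('d) + 1))) summable_on UNIV"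
    by (intro summable_on_cmult_right summable_inverse_wt_pow) simp
  show w: "wiener v"
    unfolding wiener_def by (rule summable_on_comparison_test[OF S]) (use le in auto)
  have le': "norm (v k) \<le> C * (1 / wt k ^ (CARD('d) + 1))" for k
    using le[of k] mult_right_mono[OF wt_ge_1[of k] norm_ge_zero[of "v k"]] by linarith
  show "l1 v \<le> C * lattice_sum TYPE('d)"
    unfolding l1_def lattice_sum_def infsum_cmult_right'[symmetric]
    by (rule infsum_mono[OF wiener_abs_summable[OF w] S le'])
qed

text \<open>The product estimate on which everything rests: since \<open>|k|\<close> is at most twice the larger
  of \<open>|h|\<close>, \<open>|k - h|\<close>, the weight can be moved to one factor while the other one is measured in
  \<open>\<ell>\<^sup>1\<close>.\<close>

lemma weighted_norm_NSP_le:
  assumes "div_free v" "wiener v" "wiener w" and A: "decay q A v" and B: "decay q B w"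
  shows "wt k ^ q * norm (NSP v w k) \<le> 2 * norm (wvec k) * 2 ^ q * (A * l1 w + l1 v * B)"
proof -
  define M where "M = (\<lambda>h. 2 * norm (wvec k) * 2 ^ q * (A * norm (w (k - h)) + norm (v h) * B))"
  have sw: "((\<lambda>h. norm (w (k - h))) has_sum l1 w) UNIV"
    using wiener_abs_summable[OF assms(3)] abs_summable_reflect[of "\<lambda>h. norm (w h)" k]
    by (simp add: l1_def has_sum_iff)
  have sv: "((\<lambda>h. norm (v h)) has_sum l1 v) UNIV"
    using wiener_abs_summable[OF assms(2)] by (simp add: l1_def)
  have M: "(M has_sum 2 * norm (wvec k) * 2 ^ q * (A * l1 w + l1 v * B)) UNIV"
    unfolding M_def by (intro has_sum_cmult_right has_sum_cmult_left has_sum_add sv sw)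
  have bound: "norm (wt k ^ q *\<^sub>R symbol k (v h) (w (k - h))) \<le> M h" for h
  proof -
    have "norm (wt k ^ q *\<^sub>R symbol k (v h) (w (k - h))) \<le>
        wt k ^ q * (2 * norm (wvec k) * norm (v h) * norm (w (k - h)))"
      using norm_symbol_le[of k "v h" "w (k - h)"] by (auto intro!: mult_left_mono)
    also have "\<dots> \<le> (2 ^ q * (wt h ^ q + wt (k - h) ^ q)) * (2 * norm (wvec k) * norm (v h) * norm (w (k - h)))"
      by (intro mult_right_mono wt_pow_le) auto
    also have "\<dots> = 2 * norm (wvec k) * 2 ^ q * ((wt h ^ q * norm (v h)) * norm (w (k - h))
        + norm (v h) * (wt (k - h) ^ q * norm (w (k - h))))"
      by (simp add: algebra_simps)
    also have "\<dots> \<le> M h"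
      unfolding M_def using A B
      by (intro mult_left_mono add_mono mult_right_mono) (auto simp: decay_def)
    finally show ?thesis .
  qed
  have "((\<lambda>h. wt k ^ q *\<^sub>R symbol k (v h) (w (k - h))) has_sum wt k ^ q *\<^sub>R NSP v w k) UNIV"
    by (intro has_sum_scaleR has_sum_NSP_wiener assms)
  then have "norm (wt k ^ q *\<^sub>R NSP v w k) \<le> infsum M UNIV"
    using dominated_summable(3)[OF bound has_sum_imp_summable[OF M]] by (simp add: infsumI)
  then show ?thesis using M by (simp add: infsumI)
qed

section \<open>The space of smooth fields\<close>

text \<open>The algebraic conditions on the coefficients of an element of a Sobolev space, apart from growth.\<close>

definition adm :: "('d::finite) field \<Rightarrow> bool" where
  "adm v \<longleftrightarrow> (\<forall>k. cnjv (v k) = v (- k)) \<and> div_free v \<and> v 0 = 0"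

lemma adm_add: "adm v \<Longrightarrow> adm w \<Longrightarrow> adm (\<lambda>k. v k + w k)"
  and adm_diff: "adm v \<Longrightarrow> adm w \<Longrightarrow> adm (\<lambda>k. v k - w k)"
  and adm_scaleR: "adm v \<Longrightarrow> adm (\<lambda>k. c *\<^sub>R v k)"
  by (auto simp: adm_def div_free_add div_free_diff div_free_scaleR
      bounded_linear.linear[OF bounded_linear_cnjv, THEN linear_add]
      bounded_linear.linear[OF bounded_linear_cnjv, THEN linear_diff]
      bounded_linear.linear[OF bounded_linear_cnjv, THEN linear_scale])

lemma adm_mult: "adm v \<Longrightarrow> (\<And>k. c (- k) = c k) \<Longrightarrow> adm (\<lambda>k. c k *\<^sub>R v k)"
  by (auto simp: adm_def div_free_iff_kdot kdot_scaleR
      bounded_linear.linear[OF bounded_linear_cnjv, THEN linear_scale])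

lemma adm_laplace: "adm v \<Longrightarrow> adm (laplace v)"
  using adm_mult[of v "\<lambda>k. - (norm (wvec k))\<^sup>2"] by (simp add: laplace_def wvec_minus)

lemma adm_heat: "adm v \<Longrightarrow> adm (heat t v)"
  using adm_mult[of v "\<lambda>k. exp (- t * (norm (wvec k))\<^sup>2)"] by (simp add: heat_def wvec_minus)

lemma bounded_linear_kdot: "bounded_linear (kdot k)"
  by (rule bounded_linear_intro[of _ "norm (wvec k)"])
    (simp_all add: kdot_add kdot_scaleR norm_kdot_le mult.commute[of "norm _" "norm (wvec k)"])

lemma adm_NSP:
  fixes v w :: "('d::finite) field"
  assumes v: "adm v" "wiener v" and w: "adm w" "wiener w"
  shows "adm (NSP v w)"
proof -
  have dv: "div_free v" using v by (simp add: adm_def)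
  have hs: "((\<lambda>h. symbol k (v h) (w (k - h))) has_sum NSP v w k) UNIV" for k
    by (intro has_sum_NSP_wiener dv v w)
  have "cnjv (NSP v w k) = NSP v w (- k)" for k
  proof -
    have "((\<lambda>h. cnjv (symbol k (v h) (w (k - h)))) has_sum cnjv (NSP v w k)) UNIV"
      by (rule has_sum_bounded_linear[OF bounded_linear_cnjv hs])
    also have "(\<lambda>h. cnjv (symbol k (v h) (w (k - h)))) = (\<lambda>h. symbol (- k) (v (- h)) (w (- k - (- h))))"
      using v w by (auto simp: cnjv_symbol adm_def)
    finally have "((\<lambda>h. symbol (- k) (v h) (w (- k - h))) has_sum cnjv (NSP v w k)) UNIV"
      using has_sum_reindex_bij_betw[of uminus UNIV UNIV "\<lambda>h. symbol (- k) (v h) (w (- k - h))"]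
      by (simp add: bij_uminus)
    then show ?thesis using hs by (rule has_sum_unique)
  qed
  moreover have "kdot k (NSP v w k) = 0" for k
  proof -
    from has_sum_bounded_linear[OF bounded_linear_kdot[of k] hs[of k]]
    have "((\<lambda>h :: int ^ 'd. 0) has_sum kdot k (NSP v w k)) UNIV" by simp
    then show ?thesis by (rule has_sum_unique[OF _ has_sum_0_simp])
  qed
  moreover have "NSP v w 0 = 0"
    by (rule NSP_zero_mode[OF dv wiener_abs_summable[OF v(2)] w(2)[unfolded wiener_def]])
  ultimately show ?thesis by (simp add: adm_def div_free_iff_kdot)
qed

lemma real_distribution_cnjv:
  "real_distribution v \<longleftrightarrow> (\<exists>C m. \<forall>k. norm (v k) \<le> C * (1 + norm (wvec k)) ^ m) \<and> (\<forall>k. cnjv (v k) = v (- k))"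
  unfolding real_distribution_def cnjv_def by (simp add: vec_eq_iff)

text \<open>A majorant of the terms of the Sobolev norm that does not depend on the field; it serves
  both for summability and for dominated convergence.\<close>

lemma sobolev_weight_le:
  fixes v :: "('d::finite) field"
  assumes C: "decay (N + (CARD('d) + 1)) C v" and N: "n \<le> real N"
  shows "norm (wvec k) powr (2 * n) * (norm (v k))\<^sup>2 \<le> C\<^sup>2 * (1 / wt k ^ (CARD('d) + 1))"
proof (cases "k = 0")
  case False
  then have k: "1 \<le> norm (wvec k)" by (simp add: norm_wvec_ge_1)
  have "norm (wvec k) powr (2 * n) \<le> norm (wvec k) powr (2 * real N)"
    using k N by (intro powr_mono) auto
  also have "\<dots> = norm (wvec k) ^ (2 * N)"
    using powr_realpow[of "norm (wvec k)" "2 * N"] False by simp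
  also have "\<dots> \<le> wt k ^ (2 * N)"
    by (intro power_mono norm_wvec_le_wt) auto
  finally have "norm (wvec k) powr (2 * n) * (norm (v k))\<^sup>2 \<le> wt k ^ (2 * N) * (norm (v k))\<^sup>2"
    by (rule mult_right_mono) simp
  also have "\<dots> = (wt k ^ (N + (CARD('d) + 1)) * norm (v k))\<^sup>2 / (wt k ^ (CARD('d) + 1))\<^sup>2"
    by (simp add: power_mult_distrib power_add power_mult[symmetric] mult.commute field_simps)
  also have "\<dots> \<le> C\<^sup>2 / (wt k ^ (CARD('d) + 1))\<^sup>2"
    using C by (intro divide_right_mono power_mono) (auto simp: decay_def)
  also have "\<dots> \<le> C\<^sup>2 / wt k ^ (CARD('d) + 1)"
    by (intro divide_left_mono self_le_power one_le_power wt_ge_1) auto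
  finally show ?thesis by simp
qed simp

text \<open>A square summable weighted family is bounded; conversely, a bound with \<open>d + 1\<close> further powers of
  the weight makes the family square summable.  So the Frechet topology may be described by weighted
  supremum norms.\<close>

lemma Sob_inf_iff: "v \<in> Sob_inf \<longleftrightarrow> adm v \<and> (\<forall>q. \<exists>C. decay q C v)"
proof (intro iffI conjI allI)
  assume v: "v \<in> Sob_inf"
  then have S: "v \<in> Sob n" for n by (simp add: Sob_inf_def)
  show "adm v"
    using S[of 0] by (auto simp: Sob_def adm_def real_distribution_cnjv)
  fix q
  let ?f = "\<lambda>k. norm (wvec k) powr (2 * real q) * (norm (v k))\<^sup>2"
  define s where "s = infsum ?f (UNIV - {0})"
  have f: "?f summable_on (UNIV - {0})" using S[of q] by (simp add: Sob_def)
  have "wt k ^ q * norm (v k) \<le> 2 ^ q * sqrt s" for k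
  proof (cases "k = 0")
    case True
    have "0 \<le> s" unfolding s_def by (rule infsum_nonneg) simp
    then show ?thesis using True S[of 0] by (simp add: Sob_def)
  next
    case False
    have pos: "norm (wvec k) > 0" using norm_wvec_ge_1[OF False] by linarith
    have "?f k \<le> s"
      using finite_sum_le_infsum[OF f, of "{k}"] False by (simp add: s_def)
    also have "norm (wvec k) powr (2 * real q) = norm (wvec k) ^ (2 * q)"
      using powr_realpow[OF pos, of "2 * q"] by (simp only: of_nat_mult of_nat_numeral)
    also have "norm (wvec k) ^ (2 * q) * (norm (v k))\<^sup>2 = (norm (wvec k) ^ q * norm (v k))\<^sup>2"
      by (simp add: power_mult_distrib power_mult[symmetric] mult.commute)
    finally have "norm (wvec k) ^ q * norm (v k) \<le> sqrt s"
      by (rule real_le_rsqrt)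
    then have "2 ^ q * (norm (wvec k) ^ q * norm (v k)) \<le> 2 ^ q * sqrt s"
      by (rule mult_left_mono) simp
    moreover have "wt k ^ q \<le> 2 ^ q * norm (wvec k) ^ q"
      using power_mono[OF wt_le_twice_norm[OF False], of q] by (simp add: power_mult_distrib)
    then have "wt k ^ q * norm (v k) \<le> 2 ^ q * norm (wvec k) ^ q * norm (v k)"
      by (rule mult_right_mono) simp
    ultimately show ?thesis by (simp only: mult.assoc)
  qed
  then show "\<exists>C. decay q C v" unfolding decay_def by blast
next
  assume v: "adm v \<and> (\<forall>q. \<exists>C. decay q C v)"
  show "v \<in> Sob_inf"
    unfolding Sob_inf_def
  proof
    fix n :: real
    obtain N :: nat where N: "n \<le> real N" using real_arch_simple by blast
    obtain C where C: "decay (N + (CARD('a) + 1)) C v" using v by blast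
    obtain C0 where C0: "decay 0 C0 v" using v by blast
    have "(\<lambda>k :: int ^ 'a. C\<^sup>2 * (1 / wt k ^ (CARD('a) + 1))) summable_on (UNIV - {0})"
      by (intro summable_on_cmult_right summable_on_subset_banach[OF summable_inverse_wt_pow]) auto
    then have "(\<lambda>k. norm (wvec k) powr (2 * n) * (norm (v k))\<^sup>2) summable_on (UNIV - {0})"
    proof (rule summable_on_comparison_test)
      show "norm (wvec k) powr (2 * n) * (norm (v k))\<^sup>2 \<le> C\<^sup>2 * (1 / wt k ^ (CARD('a) + 1))" for k
        by (rule sobolev_weight_le[OF C N])
    qed simp
    moreover have "norm (v k) \<le> C0 * (1 + norm (wvec k)) ^ 0" for k
      using C0 by (simp add: decay_def)
    ultimately show "v \<in> Sob n"
      using v unfolding Sob_def real_distribution_cnjv adm_def by blast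
  qed
qed

lemma Sob_inf_adm: "v \<in> Sob_inf \<Longrightarrow> adm v"
  and Sob_inf_div_free: "v \<in> Sob_inf \<Longrightarrow> div_free v"
  and Sob_inf_zero: "v \<in> Sob_inf \<Longrightarrow> v 0 = 0"
  by (auto simp: Sob_inf_iff adm_def)

lemma Sob_inf_Sob: "v \<in> Sob_inf \<Longrightarrow> v \<in> Sob n"
  by (simp add: Sob_inf_def)

lemma Sob_inf_wiener: "v \<in> Sob_inf \<Longrightarrow> wiener v"
  unfolding Sob_inf_iff using decay_summable(1) by blast

lemma Sob_inf_add: "v \<in> Sob_inf \<Longrightarrow> w \<in> Sob_inf \<Longrightarrow> (\<lambda>k. v k + w k) \<in> Sob_inf"
  and Sob_inf_diff: "v \<in> Sob_inf \<Longrightarrow> w \<in> Sob_inf \<Longrightarrow> (\<lambda>k. v k - w k) \<in> Sob_inf"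
  and Sob_inf_scaleR: "v \<in> Sob_inf \<Longrightarrow> (\<lambda>k. c *\<^sub>R v k) \<in> Sob_inf"
  unfolding Sob_inf_iff
  by (blast intro: adm_add adm_diff adm_scaleR decay_add decay_diff decay_scaleR)+

lemma decay_laplace:
  assumes "decay (q + 2) C v"
  shows "decay q C (laplace v)"
  unfolding decay_def
proof
  fix k
  have "wt k ^ q * ((norm (wvec k))\<^sup>2 * norm (v k)) \<le> wt k ^ q * ((wt k)\<^sup>2 * norm (v k))"
    by (intro mult_left_mono mult_right_mono power_mono norm_wvec_le_wt) auto
  also have "\<dots> \<le> C"
    using decayD[OF assms, of k] by (simp add: power_add mult_ac power2_eq_square)
  finally show "wt k ^ q * norm (laplace v k) \<le> C"
    by (simp add: laplace_def)
qed

lemma Sob_inf_laplace: "v \<in> Sob_inf \<Longrightarrow> laplace v \<in> Sob_inf"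
  unfolding Sob_inf_iff using adm_laplace decay_laplace by blast

lemma decay_NSP:
  fixes v w :: "('d::finite) field"
  assumes "div_free v" "decay (q + CARD('d) + 2) A v" "decay (q + CARD('d) + 2) B w"
  shows "decay q (2 * 2 ^ (q + 1) * (2 * A * B * lattice_sum TYPE('d))) (NSP v w)"
  unfolding decay_def
proof
  fix k
  have v: "decay (CARD('d) + 2) A v" "decay (q + 1) A v" and w: "decay (CARD('d) + 2) B w" "decay (q + 1) B w"
    by (rule decay_less[OF assms(2)] decay_less[OF assms(3)]; simp)+
  have AB: "0 \<le> A" "0 \<le> B" using v(1) w(1) by (simp_all add: decay_nonneg)
  have "wt k ^ (q + 1) * norm (NSP v w k) \<le> 2 * norm (wvec k) * 2 ^ (q + 1) * (A * l1 w + l1 v * B)"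
    by (intro weighted_norm_NSP_le assms decay_summable(1)[OF v(1)] decay_summable(1)[OF w(1)] v w)
  also have "\<dots> \<le> 2 * wt k * 2 ^ (q + 1) * (A * (B * lattice_sum TYPE('d)) + (A * lattice_sum TYPE('d)) * B)"
    using AB
    by (intro mult_mono add_mono decay_summable(2)[OF v(1)] decay_summable(2)[OF w(1)] norm_wvec_le_wt
        mult_nonneg_nonneg add_nonneg_nonneg l1_nonneg mult_left_mono mult_right_mono) auto
  also have "\<dots> = wt k * (2 * 2 ^ (q + 1) * (2 * A * B * lattice_sum TYPE('d)))"
    by (simp add: algebra_simps)
  finally show "wt k ^ q * norm (NSP v w k) \<le> 2 * 2 ^ (q + 1) * (2 * A * B * lattice_sum TYPE('d))"
    by (simp add: mult.assoc)
qed

lemma Sob_inf_NSP: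
  fixes v w :: "('d::finite) field"
  assumes "v \<in> Sob_inf" "w \<in> Sob_inf"
  shows "NSP v w \<in> Sob_inf"
  unfolding Sob_inf_iff
proof (intro conjI allI)
  show "adm (NSP v w)"
    by (intro adm_NSP Sob_inf_adm Sob_inf_wiener assms)
  fix q
  obtain A B where "decay (q + CARD('d) + 2) A v" "decay (q + CARD('d) + 2) B w"
    using assms unfolding Sob_inf_iff by blast
  from decay_NSP[OF Sob_inf_div_free[OF assms(1)] this] show "\<exists>C. decay q C (NSP v w)" by blast
qed

subsection \<open>The Sobolev inner products\<close>

text \<open>The weight of the Sobolev inner product with the normalisation absorbed, so that
  \<open>\<langle>v|w\<rangle>\<^sub>n\<close> is the sum of \<open>sweight n k * (v k \<bullet> w k)\<close> with the real inner product of the coefficients.\<close>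

definition sweight :: "real \<Rightarrow> int ^ ('d::finite) \<Rightarrow> real" where
  "sweight n k = (2 * pi) ^ CARD('d) * norm (wvec k) powr (2 * n)"

lemma sweight_nonneg [simp]: "0 \<le> sweight n k"
  by (simp add: sweight_def)

lemma mult_le_sum_squares: "0 \<le> x \<Longrightarrow> 0 \<le> y \<Longrightarrow> x * y \<le> x\<^sup>2 + (y :: real)\<^sup>2"
  using sum_squares_bound[of x y] mult_nonneg_nonneg[of x y] by linarith

lemma Re_complex_of_real_mult: "Re (of_real c * z) = c * Re z"
  by simp

lemma Re_cnj_sum: "Re (\<Sum>r\<in>UNIV. cnj (a $ r) * b $ r) = a \<bullet> b"
  by (simp add: inner_vec_def inner_complex_def)

lemma norm_cnj_sum_le: "norm (\<Sum>r\<in>(UNIV :: 'd::finite set). cnj (a $ r) * b $ r) \<le> norm a * norm b"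
proof -
  have "norm (\<Sum>r\<in>(UNIV :: 'd set). cnj (a $ r) * b $ r) \<le> (\<Sum>r\<in>UNIV. norm (cnj (a $ r) * b $ r))"
    by (rule norm_sum)
  also have "\<dots> = (\<Sum>r\<in>UNIV. \<bar>norm (a $ r)\<bar> * \<bar>norm (b $ r)\<bar>)"
    by (simp add: norm_mult)
  also have "\<dots> \<le> norm a * norm b"
    unfolding norm_vec_def by (rule L2_set_mult_ineq)
  finally show ?thesis .
qed

lemma has_sum_sob_inner:
  fixes v w :: "('d::finite) field"
  assumes v: "v \<in> Sob_inf" and w: "w \<in> Sob_inf"
  shows "((\<lambda>k. sweight n k * (v k \<bullet> w k)) has_sum sob_inner n v w) (UNIV - {0})"
proof -
  let ?N = "\<lambda>v k. norm (wvec k) powr (2 * n) * (norm (v k :: complex ^ 'd))\<^sup>2"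
  let ?g = "\<lambda>k. of_real (norm (wvec k) powr (2 * n)) * (\<Sum>r\<in>UNIV. cnj (v k $ r) * w k $ r)"
  have "(\<lambda>k. ?N v k + ?N w k) summable_on (UNIV - {0})"
    using Sob_inf_Sob[OF v, of n] Sob_inf_Sob[OF w, of n] by (intro summable_on_add) (auto simp: Sob_def)
  then have "?g summable_on (UNIV - {0})"
  proof (rule dominated_summable(2)[rotated])
    fix k
    have "norm (?g k) \<le> norm (wvec k) powr (2 * n) * (norm (v k) * norm (w k))"
      by (simp add: norm_mult mult_left_mono norm_cnj_sum_le)
    also have "\<dots> \<le> norm (wvec k) powr (2 * n) * ((norm (v k))\<^sup>2 + (norm (w k))\<^sup>2)"
      by (intro mult_left_mono mult_le_sum_squares) auto
    finally show "norm (?g k) \<le> ?N v k + ?N w k" by (simp add: distrib_left)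
  qed
  then have "((\<lambda>k. (2 * pi) ^ CARD('d) * Re (?g k)) has_sum sob_inner n v w) (UNIV - {0})"
    unfolding sob_inner_def by (intro has_sum_cmult_right has_sum_Re has_sum_infsum)
  moreover have "Re (?g k) = norm (wvec k) powr (2 * n) * (v k \<bullet> w k)" for k
    unfolding Re_cnj_sum[symmetric] by (rule Re_complex_of_real_mult)
  ultimately show ?thesis
    by (simp only: sweight_def mult.assoc)
qed

lemma sob_inner_commute: "v \<in> Sob_inf \<Longrightarrow> w \<in> Sob_inf \<Longrightarrow> sob_inner n v w = sob_inner n w v"
  using has_sum_unique[OF has_sum_sob_inner[of v w n]] has_sum_sob_inner[of w v n]
  by (simp add: inner_commute)

lemma sob_inner_add_left:
  assumes "v \<in> Sob_inf" "v' \<in> Sob_inf" "w \<in> Sob_inf"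
  shows "sob_inner n (\<lambda>k. v k + v' k) w = sob_inner n v w + sob_inner n v' w"
  using has_sum_unique[OF has_sum_sob_inner[OF Sob_inf_add[OF assms(1,2)] assms(3), of n]]
    has_sum_add[OF has_sum_sob_inner[OF assms(1,3)] has_sum_sob_inner[OF assms(2,3)], of n n]
  by (simp add: inner_add_left distrib_left)

lemma sob_inner_diff_left:
  assumes "v \<in> Sob_inf" "v' \<in> Sob_inf" "w \<in> Sob_inf"
  shows "sob_inner n (\<lambda>k. v k - v' k) w = sob_inner n v w - sob_inner n v' w"
  using sob_inner_add_left[of "\<lambda>k. v k - v' k" v' w n] assms by (simp add: Sob_inf_diff)

lemma sob_inner_scaleR_left:
  assumes "v \<in> Sob_inf" "w \<in> Sob_inf"
  shows "sob_inner n (\<lambda>k. c *\<^sub>R v k) w = c * sob_inner n v w"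
  using has_sum_unique[OF has_sum_sob_inner[OF Sob_inf_scaleR[OF assms(1)] assms(2), of n c]]
    has_sum_cmult_right[OF has_sum_sob_inner[OF assms, of n], of c]
  by (simp add: mult.left_commute)

lemma sob_inner_add_right:
  assumes "v \<in> Sob_inf" "v' \<in> Sob_inf" "w \<in> Sob_inf"
  shows "sob_inner n w (\<lambda>k. v k + v' k) = sob_inner n w v + sob_inner n w v'"
  using sob_inner_add_left[OF assms, of n] assms by (simp add: sob_inner_commute Sob_inf_add)

lemma sob_inner_diff_right:
  assumes "v \<in> Sob_inf" "v' \<in> Sob_inf" "w \<in> Sob_inf"
  shows "sob_inner n w (\<lambda>k. v k - v' k) = sob_inner n w v - sob_inner n w v'"
  using sob_inner_diff_left[OF assms, of n] assms by (simp add: sob_inner_commute Sob_inf_diff)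

lemma sob_inner_scaleR_right:
  assumes "v \<in> Sob_inf" "w \<in> Sob_inf"
  shows "sob_inner n w (\<lambda>k. c *\<^sub>R v k) = c * sob_inner n w v"
  using sob_inner_scaleR_left[OF assms, of n c] assms by (simp add: sob_inner_commute Sob_inf_scaleR)

lemma sob_inner_nonneg: "v \<in> Sob_inf \<Longrightarrow> 0 \<le> sob_inner n v v"
  by (rule has_sum_nonneg[OF has_sum_sob_inner]) auto

lemma sob_norm_nonneg: "v \<in> Sob_inf \<Longrightarrow> 0 \<le> sob_norm n v"
  by (simp add: sob_norm_def sob_inner_nonneg)

lemma sob_norm_square: "v \<in> Sob_inf \<Longrightarrow> (sob_norm n v)\<^sup>2 = sob_inner n v v"
  by (simp add: sob_norm_def sob_inner_nonneg)

lemma sob_inner_diff_square: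
  assumes "v \<in> Sob_inf" "w \<in> Sob_inf"
  shows "sob_inner n (\<lambda>k. v k - c *\<^sub>R w k) (\<lambda>k. v k - c *\<^sub>R w k) =
    sob_inner n v v - 2 * c * sob_inner n v w + c\<^sup>2 * sob_inner n w w"
  using assms
  by (simp add: sob_inner_diff_left sob_inner_diff_right sob_inner_scaleR_left sob_inner_scaleR_right
      Sob_inf_diff Sob_inf_scaleR sob_inner_commute[of w v] algebra_simps power2_eq_square)

text \<open>The quadratic polynomial \<open>|v - c w|\<^sup>2\<close> in \<open>c\<close> is nonnegative.\<close>

lemma sob_Cauchy_Schwarz:
  assumes v: "v \<in> Sob_inf" and w: "w \<in> Sob_inf"
  shows "\<bar>sob_inner n v w\<bar> \<le> sob_norm n v * sob_norm n w"
proof -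
  define x y z where "x = sob_inner n v v" and "y = sob_inner n v w" and "z = sob_inner n w w"
  have nonneg: "0 \<le> x - 2 * c * y + c\<^sup>2 * z" for c
    using sob_inner_nonneg[OF Sob_inf_diff[OF v Sob_inf_scaleR[OF w, of c]], of n]
    by (simp add: sob_inner_diff_square[OF v w] x_def y_def z_def)
  have xz: "0 \<le> x" "0 \<le> z" by (simp_all add: x_def z_def sob_inner_nonneg v w)
  have "y\<^sup>2 \<le> x * z"
  proof (cases "z = 0")
    case True
    have "y = 0"
    proof (rule ccontr)
      assume "y \<noteq> 0"
      then show False using nonneg[of "(x + 1) / (2 * y)"] True by (simp add: field_simps)
    qed
    then show ?thesis using xz by simp
  next
    case False
    then have z: "z > 0" using xz by simp
    have "0 \<le> x - y\<^sup>2 / z"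
      using nonneg[of "y / z"] z by (simp add: power2_eq_square field_simps)
    then show ?thesis using z by (simp add: field_simps)
  qed
  then have "\<bar>y\<bar> \<le> sqrt (x * z)"
    using real_sqrt_le_mono[of "y\<^sup>2" "x * z"] by simp
  then show ?thesis by (simp add: sob_norm_def x_def y_def z_def real_sqrt_mult)
qed

lemma sob_norm_triangle:
  assumes v: "v \<in> Sob_inf" and w: "w \<in> Sob_inf"
  shows "sob_norm n (\<lambda>k. v k + w k) \<le> sob_norm n v + sob_norm n w"
proof (rule power2_le_imp_le)
  have "(sob_norm n (\<lambda>k. v k + w k))\<^sup>2 = (sob_norm n v)\<^sup>2 + 2 * sob_inner n v w + (sob_norm n w)\<^sup>2"
    using v w by (simp add: sob_norm_square Sob_inf_add sob_inner_add_left sob_inner_add_right sob_inner_commute[of w v])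
  also have "\<dots> \<le> (sob_norm n v)\<^sup>2 + 2 * (sob_norm n v * sob_norm n w) + (sob_norm n w)\<^sup>2"
    using sob_Cauchy_Schwarz[OF v w, of n] by simp
  finally show "(sob_norm n (\<lambda>k. v k + w k))\<^sup>2 \<le> (sob_norm n v + sob_norm n w)\<^sup>2"
    by (simp add: power2_sum)
qed (simp add: sob_norm_nonneg v w)

text \<open>The spectrum of the Laplacian on zero mean fields lies below \<open>-1\<close>.\<close>

lemma sob_inner_laplace_le:
  assumes w: "w \<in> Sob_inf"
  shows "sob_inner n (laplace w) w \<le> - (sob_norm n w)\<^sup>2"
proof -
  have "sob_inner n (laplace w) w \<le> - sob_inner n w w"
  proof (rule has_sum_mono[OF has_sum_sob_inner[OF Sob_inf_laplace[OF w] w]])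
    show "((\<lambda>k. - (sweight n k * (w k \<bullet> w k))) has_sum - sob_inner n w w) (UNIV - {0})"
      using has_sum_cmult_right[OF has_sum_sob_inner[OF w w, of n], of "- 1"] by simp
    fix k :: "int ^ 'a" assume "k \<in> UNIV - {0}"
    then have "1 \<le> (norm (wvec k))\<^sup>2" using norm_wvec_ge_1[of k] by (simp add: one_le_power)
    then have "1 * (w k \<bullet> w k) \<le> (norm (wvec k))\<^sup>2 * (w k \<bullet> w k)"
      by (rule mult_right_mono) simp
    then have "sweight n k * (w k \<bullet> w k) \<le> sweight n k * ((norm (wvec k))\<^sup>2 * (w k \<bullet> w k))"
      by (intro mult_left_mono) auto
    then show "sweight n k * (laplace w k \<bullet> w k) \<le> - (sweight n k * (w k \<bullet> w k))"
      by (simp add: laplace_def)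
  qed
  then show ?thesis by (simp add: sob_norm_square w)
qed

lemma norm_le_sob_norm:
  assumes "v \<in> Sob_inf"
  shows "norm (v k) \<le> sob_norm 0 v"
proof (cases "k = 0")
  case False
  have "(norm (v k))\<^sup>2 \<le> sweight 0 k * (v k \<bullet> v k)"
  proof -
    have "1 \<le> (2 * pi) ^ CARD('a)" using pi_gt3 by (intro one_le_power) simp
    then have "1 * (norm (v k))\<^sup>2 \<le> (2 * pi) ^ CARD('a) * (norm (v k))\<^sup>2"
      by (rule mult_right_mono) simp
    then show ?thesis using False by (simp add: sweight_def power2_norm_eq_inner)
  qed
  also have "\<dots> \<le> sob_inner 0 v v"
    using finite_sum_le_has_sum[OF has_sum_sob_inner[OF assms assms, of 0], of "{k}"] False by simp
  finally show ?thesis by (simp add: sob_norm_def real_le_rsqrt)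
qed (simp add: Sob_inf_zero assms sob_norm_nonneg)

text \<open>From \<open>|v\<^sub>k| = |k|\<^sup>-\<^sup>n (|k|\<^sup>n |v\<^sub>k|)\<close> and \<open>2 x y \<le> x\<^sup>2 + y\<^sup>2\<close>.  The inhomogeneous form is enough to
  bound the \<open>\<ell>\<^sup>1\<close> norm on bounded sets.\<close>

lemma l1_le_sob_norm:
  assumes "n > real CARD('d::finite) / 2"
  shows "\<exists>c. \<forall>v :: 'd field. v \<in> Sob_inf \<longrightarrow> l1 v \<le> c + (sob_norm n v)\<^sup>2"
proof -
  define g where "g = (\<lambda>k :: int ^ 'd. 2 powr (2 * n) * wt k powr (- (2 * n)))"
  have g: "g summable_on UNIV"
    unfolding g_def by (intro summable_on_cmult_right summable_wt_powr) (use assms in simp)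
  have "l1 v \<le> infsum g UNIV + (sob_norm n v)\<^sup>2" if v: "v \<in> Sob_inf" for v :: "'d field"
  proof -
    let ?h = "\<lambda>k. g k + (if k = 0 then 0 else sweight n k * (v k \<bullet> v k))"
    have "((\<lambda>k. if k = 0 then 0 else sweight n k * (v k \<bullet> v k)) has_sum sob_inner n v v) UNIV"
      using has_sum_sob_inner[OF v v, of n] by (rule has_sum_cong_neutral[THEN iffD1, rotated -1]) auto
    then have h: "(?h has_sum (infsum g UNIV + sob_inner n v v)) UNIV"
      by (intro has_sum_add has_sum_infsum g)
    have "norm (v k) \<le> ?h k" for k
    proof (cases "k = 0")
      case True
      then show ?thesis by (simp add: Sob_inf_zero v g_def)
    next
      case False
      define a where "a = norm (wvec k) powr n"
      have k: "0 < norm (wvec k)" using norm_wvec_ge_1[OF False] by linarith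
      then have a: "a > 0" by (simp add: a_def)
      have "norm (v k) = (1 / a) * (a * norm (v k))" using a by simp
      also have "\<dots> \<le> (1 / a)\<^sup>2 + (a * norm (v k))\<^sup>2"
        using a by (intro mult_le_sum_squares) auto
      also have "(1 / a)\<^sup>2 \<le> g k"
      proof -
        have "wt k powr (2 * n) \<le> (2 * norm (wvec k)) powr (2 * n)"
          using assms by (intro powr_mono2 wt_le_twice_norm False) auto
        also have "\<dots> = 2 powr (2 * n) * a\<^sup>2"
          using k by (simp add: powr_mult a_def powr_powr power2_eq_square flip: powr_add)
        finally show ?thesis
          using a by (simp add: g_def powr_minus field_simps)
      qed
      also have "(a * norm (v k))\<^sup>2 \<le> sweight n k * (v k \<bullet> v k)"
      proof -
        have "1 \<le> (2 * pi) ^ CARD('d)" using pi_gt3 by (intro one_le_power) simp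
        then have "1 * (a * norm (v k))\<^sup>2 \<le> (2 * pi) ^ CARD('d) * (a * norm (v k))\<^sup>2"
          by (rule mult_right_mono) simp
        moreover have "a\<^sup>2 = norm (wvec k) powr (2 * n)"
          using k by (simp add: a_def power2_eq_square flip: powr_add)
        ultimately show ?thesis
          by (simp add: sweight_def power_mult_distrib mult.assoc power2_norm_eq_inner)
      qed
      finally show ?thesis using False by simp
    qed
    then have "l1 v \<le> infsum ?h UNIV"
      unfolding l1_def
      by (intro infsum_mono wiener_abs_summable Sob_inf_wiener v has_sum_imp_summable[OF h])
    also have "\<dots> = infsum g UNIV + (sob_norm n v)\<^sup>2"
      using infsumI[OF h] by (simp add: sob_norm_square v)
    finally show ?thesis .
  qed
  then show ?thesis by blast
qed

section \<open>Curves of smooth fields\<close>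

lemma time_ivl_infinity: "time_ivl \<infinity> = {0..}"
  by (auto simp: time_ivl_def)

lemma zero_in_time_ivl: "0 < T \<Longrightarrow> 0 \<in> time_ivl T"
  by (simp add: time_ivl_def zero_ereal_def[symmetric])

lemma time_ivl_nonneg: "t \<in> time_ivl T \<Longrightarrow> 0 \<le> t"
  by (simp add: time_ivl_def)

lemma time_ivl_downward: "t \<in> time_ivl T \<Longrightarrow> 0 \<le> s \<Longrightarrow> s \<le> t \<Longrightarrow> s \<in> time_ivl T"
  unfolding time_ivl_def by (simp, meson ereal_less_eq(3) le_less_trans)

lemma atLeastAtMost_subset_time_ivl: "t \<in> time_ivl T \<Longrightarrow> {0..t} \<subseteq> time_ivl T"
  using time_ivl_downward by auto

lemma time_ivl_mono: "T \<le> T' \<Longrightarrow> time_ivl T \<subseteq> time_ivl T'"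
  by (auto simp: time_ivl_def intro: less_le_trans)

lemma time_ivl_later:
  assumes "t \<in> time_ivl T"
  obtains b where "t < b" "b \<in> time_ivl T"
proof -
  have "ereal t < T" "0 \<le> t" using assms by (auto simp: time_ivl_def)
  then obtain x where "ereal t < x" "x < T" using dense by blast
  then obtain b where "x = ereal b" by (cases x) auto
  then show ?thesis using that[of b] \<open>ereal t < x\<close> \<open>x < T\<close> \<open>0 \<le> t\<close> by (auto simp: time_ivl_def)
qed

lemma at_within_time_ivl_neq_bot:
  assumes "t \<in> time_ivl T"
  shows "at t within time_ivl T \<noteq> bot"
proof -
  obtain b where b: "t < b" "b \<in> time_ivl T" using time_ivl_later[OF assms] .
  have "{t..b} \<subseteq> time_ivl T"
    using time_ivl_downward[OF b(2)] time_ivl_nonneg[OF assms] by auto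
  then have "at t within {t..b} \<le> at t within time_ivl T" by (rule at_le)
  moreover have "at t within {t..b} \<noteq> bot"
    using b(1) by (simp add: at_within_Icc_at_right)
  ultimately show ?thesis by (metis bot.extremum_uniqueI)
qed

lemma eventually_le_time_ivl: "t < (b :: real) \<Longrightarrow> eventually (\<lambda>s. s \<in> I \<and> s \<le> b) (at t within I)"
  unfolding eventually_at_filter
  by (rule eventually_mono[OF eventually_nhds_in_open[of "{..<b}"]]) auto

subsection \<open>Derivatives in the Frechet space and of coefficients\<close>

lemma has_vector_derivative_iff_quotient:
  "(f has_vector_derivative D) (at t within I) \<longleftrightarrow> ((\<lambda>s. (f s - f t) /\<^sub>R (s - t)) \<longlongrightarrow> D) (at t within I)"
proof -
  have "norm (f s - f t - (s - t) *\<^sub>R D) / norm (s - t) = norm ((f s - f t) /\<^sub>R (s - t) - D)" if "s \<noteq> t" for s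
  proof -
    have "f s - f t - (s - t) *\<^sub>R D = (s - t) *\<^sub>R ((f s - f t) /\<^sub>R (s - t) - D)"
      using that by (simp add: scaleR_diff_right)
    then show ?thesis using that by simp
  qed
  then have "((\<lambda>s. norm (f s - f t - (s - t) *\<^sub>R D) / norm (s - t)) \<longlongrightarrow> 0) (at t within I) \<longleftrightarrow>
      ((\<lambda>s. norm ((f s - f t) /\<^sub>R (s - t) - D)) \<longlongrightarrow> 0) (at t within I)"
    by (intro tendsto_cong) (auto simp: eventually_at_filter intro!: always_eventually)
  then show ?thesis
    by (simp add: has_vector_derivative_def has_derivative_iff_norm bounded_linear_scaleR_left
        tendsto_norm_zero_iff LIM_zero_iff)
qed

text \<open>Single coefficients are continuous linear functionals on the Sobolev space of order \<open>0\<close>.\<close>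

lemma has_time_derivative_coeff:
  assumes f: "has_time_derivative f D t I" and t: "t \<in> I"
  shows "((\<lambda>s. f s k) has_vector_derivative D k) (at t within I)"
proof -
  let ?q = "\<lambda>s k. (f s k - f t k) /\<^sub>R (s - t) - D k"
  have fD: "\<And>s. s \<in> I \<Longrightarrow> f s \<in> Sob_inf" "D \<in> Sob_inf"
    and lim: "((\<lambda>s. sob_norm 0 (?q s)) \<longlongrightarrow> 0) (at t within I)"
    using f by (auto simp: has_time_derivative_def)
  have le: "norm (?q s k) \<le> sob_norm 0 (?q s)" if "s \<in> I" for s
    by (intro norm_le_sob_norm Sob_inf_diff Sob_inf_scaleR fD that t)
  have "((\<lambda>s. norm (?q s k)) \<longlongrightarrow> 0) (at t within I)"
    by (rule tendsto_sandwich[OF _ _ tendsto_const lim])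
      (auto simp: eventually_at_filter intro!: always_eventually le)
  then show ?thesis
    by (simp add: has_vector_derivative_iff_quotient tendsto_norm_zero_iff LIM_zero_iff)
qed

lemma has_time_derivative_subset:
  "has_time_derivative f D t I \<Longrightarrow> J \<subseteq> I \<Longrightarrow> has_time_derivative f D t J"
  unfolding has_time_derivative_def using tendsto_within_subset by blast

lemma has_time_derivative_diff:
  assumes f: "has_time_derivative f D t I" and g: "has_time_derivative g E t I" and t: "t \<in> I"
  shows "has_time_derivative (\<lambda>s k. f s k - g s k) (\<lambda>k. D k - E k) t I"
proof -
  have in_f: "\<And>s. s \<in> I \<Longrightarrow> f s \<in> Sob_inf" "D \<in> Sob_inf" and in_g: "\<And>s. s \<in> I \<Longrightarrow> g s \<in> Sob_inf" "E \<in> Sob_inf"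
    using f g by (auto simp: has_time_derivative_def)
  let ?q = "\<lambda>f D s k. (f s k - f t k) /\<^sub>R (s - t) - D k :: complex ^ 'a"
  let ?h = "\<lambda>s k. f s k - g s k"
  have "((\<lambda>s. sob_norm n (?q ?h (\<lambda>k. D k - E k) s)) \<longlongrightarrow> 0) (at t within I)" for n
  proof (rule tendsto_sandwich)
    have qf: "?q f D s \<in> Sob_inf" and qg: "?q g E s \<in> Sob_inf" if "s \<in> I" for s
      by (intro Sob_inf_diff Sob_inf_scaleR in_f in_g that t)+
    have eq: "?q ?h (\<lambda>k. D k - E k) s = (\<lambda>k. ?q f D s k + (- 1) *\<^sub>R ?q g E s k)" for s
      by (auto simp: algebra_simps)
    have "sob_norm n (?q ?h (\<lambda>k. D k - E k) s) \<le> sob_norm n (?q f D s) + sob_norm n (?q g E s)" if "s \<in> I" for s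
    proof -
      have "sob_norm n (\<lambda>k. (- 1) *\<^sub>R ?q g E s k) = sob_norm n (?q g E s)"
        unfolding sob_norm_def
        by (simp only: sob_inner_scaleR_left[OF qg[OF that] Sob_inf_scaleR[OF qg[OF that]]]
            sob_inner_scaleR_right[OF qg[OF that] qg[OF that]]) simp
      then show ?thesis
        unfolding eq using sob_norm_triangle[OF qf[OF that] Sob_inf_scaleR[OF qg[OF that], of "- 1"], of n] by simp
    qed
    then show "eventually (\<lambda>s. sob_norm n (?q ?h (\<lambda>k. D k - E k) s) \<le> sob_norm n (?q f D s) + sob_norm n (?q g E s)) (at t within I)"
      by (auto simp: eventually_at_filter intro!: always_eventually)
    show "eventually (\<lambda>s. 0 \<le> sob_norm n (?q ?h (\<lambda>k. D k - E k) s)) (at t within I)"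
      unfolding eventually_at_filter
      by (intro always_eventually allI impI sob_norm_nonneg Sob_inf_diff Sob_inf_scaleR in_f in_g t)
    have "((\<lambda>s. sob_norm n (?q f D s) + sob_norm n (?q g E s)) \<longlongrightarrow> 0 + 0) (at t within I)"
      using f g by (intro tendsto_add) (auto simp: has_time_derivative_def)
    then show "((\<lambda>s. sob_norm n (?q f D s) + sob_norm n (?q g E s)) \<longlongrightarrow> 0) (at t within I)" by simp
  qed simp
  then show ?thesis
    unfolding has_time_derivative_def using in_f in_g by (auto intro: Sob_inf_diff)
qed

text \<open>Writing \<open>q\<close> for the difference quotient at \<open>t\<close>,
  \<open>(|f(s)|\<^sup>2 - |f(t)|\<^sup>2) / (s - t) = (s - t) |q|\<^sup>2 + 2 \<langle>q | f(t)\<rangle>\<close>.\<close>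

lemma has_derivative_sob_inner:
  assumes f: "has_time_derivative f D t I" and t: "t \<in> I"
  shows "((\<lambda>s. sob_inner n (f s) (f s)) has_real_derivative 2 * sob_inner n D (f t)) (at t within I)"
  unfolding has_field_derivative_iff
proof -
  let ?F = "at t within I"
  define q where "q = (\<lambda>s k. (f s k - f t k) /\<^sub>R (s - t))"
  define r where "r = (\<lambda>s k. q s k - D k)"
  have fD: "\<And>s. s \<in> I \<Longrightarrow> f s \<in> Sob_inf" "D \<in> Sob_inf"
    and lim: "((\<lambda>s. sob_norm n (r s)) \<longlongrightarrow> 0) ?F"
    using f by (auto simp: has_time_derivative_def r_def q_def)
  have q: "q s \<in> Sob_inf" and r: "r s \<in> Sob_inf" if "s \<in> I" for s
    unfolding q_def r_def by (intro Sob_inf_diff Sob_inf_scaleR fD that t)+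
  have pair: "((\<lambda>s. sob_inner n (r s) w) \<longlongrightarrow> 0) ?F" if w: "w \<in> Sob_inf" for w
  proof (rule Lim_null_comparison)
    show "((\<lambda>s. sob_norm n (r s) * sob_norm n w) \<longlongrightarrow> 0) ?F"
      using tendsto_mult[OF lim tendsto_const] by simp
    show "eventually (\<lambda>s. norm (sob_inner n (r s) w) \<le> sob_norm n (r s) * sob_norm n w) ?F"
      unfolding eventually_at_filter by (auto intro!: always_eventually sob_Cauchy_Schwarz r w)
  qed
  have limq: "((\<lambda>s. sob_inner n D w + sob_inner n (r s) w) \<longlongrightarrow> sob_inner n D w) ?F" if w: "w \<in> Sob_inf" for w
    using tendsto_add[OF tendsto_const pair[OF w]] by simp
  have limr: "((\<lambda>s. (sob_norm n (r s))\<^sup>2 + 2 * sob_inner n (r s) D + sob_inner n D D) \<longlongrightarrow> sob_inner n D D) ?F"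
    using tendsto_add[OF tendsto_add[OF tendsto_power[OF lim, of 2] tendsto_mult[OF tendsto_const[of 2] pair[OF fD(2)]]] tendsto_const]
    by simp
  have lims: "((\<lambda>s. s - t) \<longlongrightarrow> 0) ?F"
    using tendsto_diff[OF tendsto_ident_at[of t I] tendsto_const[of t]] by simp
  have "((\<lambda>s. (s - t) * ((sob_norm n (r s))\<^sup>2 + 2 * sob_inner n (r s) D + sob_inner n D D)
      + 2 * (sob_inner n D (f t) + sob_inner n (r s) (f t))) \<longlongrightarrow> 2 * sob_inner n D (f t)) ?F"
    using tendsto_add[OF tendsto_mult[OF lims limr] tendsto_mult[OF tendsto_const[of 2] limq[OF fD(1)[OF t]]]]
    by simp
  then show "((\<lambda>s. (sob_inner n (f s) (f s) - sob_inner n (f t) (f t)) / (s - t)) \<longlongrightarrow> 2 * sob_inner n D (f t)) ?F"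
  proof (rule Lim_transform_eventually)
    have "(s - t) * ((sob_norm n (r s))\<^sup>2 + 2 * sob_inner n (r s) D + sob_inner n D D)
      + 2 * (sob_inner n D (f t) + sob_inner n (r s) (f t)) =
      (sob_inner n (f s) (f s) - sob_inner n (f t) (f t)) / (s - t)" if s: "s \<in> I" "s \<noteq> t" for s
    proof -
      define c where "c = s - t"
      have fs: "f s = (\<lambda>k. f t k + c *\<^sub>R q s k)" and qs: "q s = (\<lambda>k. r s k + D k)"
        using s(2) by (auto simp: q_def r_def c_def)
      have "sob_inner n (f s) (f s) = sob_inner n (f t) (f t) + 2 * c * sob_inner n (q s) (f t)
          + c\<^sup>2 * sob_inner n (q s) (q s)"
        unfolding fs using q[OF s(1)] fD(1)[OF t]
        by (simp add: sob_inner_add_left sob_inner_add_right sob_inner_scaleR_left sob_inner_scaleR_right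
            Sob_inf_add Sob_inf_scaleR sob_inner_commute[of "f t" "q s"] power2_eq_square algebra_simps)
      moreover have "c \<noteq> 0" using s(2) by (simp add: c_def)
      ultimately have "(sob_inner n (f s) (f s) - sob_inner n (f t) (f t)) / c =
          2 * sob_inner n (q s) (f t) + c * sob_inner n (q s) (q s)"
        by (simp add: power2_eq_square add_divide_distrib)
      also have "sob_inner n (q s) (f t) = sob_inner n D (f t) + sob_inner n (r s) (f t)"
        unfolding qs using r[OF s(1)] fD(1)[OF t] fD(2) by (simp add: sob_inner_add_left)
      also have "sob_inner n (q s) (q s) = (sob_norm n (r s))\<^sup>2 + 2 * sob_inner n (r s) D + sob_inner n D D"
        unfolding qs using r[OF s(1)] fD(2)
        by (simp add: sob_inner_add_left sob_inner_add_right Sob_inf_add sob_norm_square sob_inner_commute[of D "r s"])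
      finally show ?thesis by (simp add: c_def)
    qed
    then show "eventually (\<lambda>s. (s - t) * ((sob_norm n (r s))\<^sup>2 + 2 * sob_inner n (r s) D + sob_inner n D D)
      + 2 * (sob_inner n D (f t) + sob_inner n (r s) (f t)) =
      (sob_inner n (f s) (f s) - sob_inner n (f t) (f t)) / (s - t)) ?F"
      by (auto simp: eventually_at_filter intro!: always_eventually)
  qed
qed

subsection \<open>Tame curves\<close>

text \<open>In place of continuity for all norms it is enough to control the coefficients one by one,
  with decay bounds that hold locally uniformly in time; dominated convergence does the rest.\<close>

definition tame :: "real set \<Rightarrow> (real \<Rightarrow> ('d::finite) field) \<Rightarrow> bool" where
  "tame I f \<longleftrightarrow> (\<forall>t\<in>I. adm (f t)) \<and> (\<forall>k. continuous_on I (\<lambda>t. f t k)) \<and>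
     (\<forall>b\<in>I. \<forall>q. \<exists>C. \<forall>t\<in>I. t \<le> b \<longrightarrow> decay q C (f t))"

lemma tame_adm: "tame I f \<Longrightarrow> t \<in> I \<Longrightarrow> adm (f t)"
  and tame_cont: "tame I f \<Longrightarrow> continuous_on I (\<lambda>t. f t k)"
  by (auto simp: tame_def)

lemma tame_Sob_inf: "tame I f \<Longrightarrow> t \<in> I \<Longrightarrow> f t \<in> Sob_inf"
  unfolding tame_def Sob_inf_iff by blast

lemma tame_decay:
  assumes "tame I f" "b \<in> I"
  obtains C where "\<And>t. t \<in> I \<Longrightarrow> t \<le> b \<Longrightarrow> decay q C (f t)"
  using assms unfolding tame_def by blast

definition coeff_deriv :: "real set \<Rightarrow> (real \<Rightarrow> ('d::finite) field) \<Rightarrow> (real \<Rightarrow> 'd field) \<Rightarrow> bool" where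
  "coeff_deriv I f g \<longleftrightarrow> (\<forall>t\<in>I. \<forall>k. ((\<lambda>s. f s k) has_vector_derivative g t k) (at t within I))"

lemma norm_diff_le_vector_derivative:
  fixes f :: "real \<Rightarrow> 'b::real_normed_vector"
  assumes "convex S" "\<And>x. x \<in> S \<Longrightarrow> (f has_vector_derivative f' x) (at x within S)"
    "\<And>x. x \<in> S \<Longrightarrow> norm (f' x) \<le> B" "x \<in> S" "y \<in> S"
  shows "norm (f x - f y) \<le> B * \<bar>x - y\<bar>"
proof -
  have "norm (f x - f y) \<le> B * norm (x - y)"
  proof (rule differentiable_bound[OF assms(1)])
    show "(f has_derivative (\<lambda>h. h *\<^sub>R f' x)) (at x within S)" if "x \<in> S" for x
      using assms(2)[OF that] by (simp add: has_vector_derivative_def)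
    show "onorm (\<lambda>h. h *\<^sub>R f' x) \<le> B" if "x \<in> S" for x
      using assms(3)[OF that] by (simp add: onorm_scaleR_left[OF bounded_linear_ident] onorm_id)
  qed (use assms in auto)
  then show ?thesis by simp
qed

text \<open>By the mean value inequality, the difference quotients inherit the decay of the derivative.\<close>

lemma decay_difference_quotient:
  fixes f g :: "real \<Rightarrow> ('d::finite) field"
  assumes g: "tame (time_ivl T) g" and fg: "coeff_deriv (time_ivl T) f g"
    and b: "b \<in> time_ivl T" and t: "t \<in> time_ivl T" "t \<le> b"
  obtains C where "\<And>s. s \<in> time_ivl T \<Longrightarrow> s \<le> b \<Longrightarrow> decay q C (\<lambda>k. (f s k - f t k) /\<^sub>R (s - t))"
    and "\<And>s. s \<in> time_ivl T \<Longrightarrow> s \<le> b \<Longrightarrow> decay q C (g s)"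
proof -
  let ?I = "time_ivl T"
  obtain C where C: "\<And>s. s \<in> ?I \<Longrightarrow> s \<le> b \<Longrightarrow> decay q C (g s)"
    by (rule tame_decay[OF g b, of q]) blast
  have C0: "0 \<le> C" using C[OF b] by (auto intro: decay_nonneg)
  have sub: "{0..b} \<subseteq> ?I" by (rule atLeastAtMost_subset_time_ivl[OF b])
  have "decay q C (\<lambda>k. (f s k - f t k) /\<^sub>R (s - t))" if s: "s \<in> ?I" "s \<le> b" for s
    unfolding decay_def
  proof
    fix k
    have "norm (f s k - f t k) \<le> C / wt k ^ q * \<bar>s - t\<bar>"
    proof (rule norm_diff_le_vector_derivative[where S = "{0..b}"])
      fix x assume x: "x \<in> {0..b}"
      then have xI: "x \<in> ?I" using sub by auto
      show "((\<lambda>s. f s k) has_vector_derivative g x k) (at x within {0..b})"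
        using fg xI sub unfolding coeff_deriv_def by (blast intro: has_vector_derivative_within_subset)
      show "norm (g x k) \<le> C / wt k ^ q"
        using decayD[OF C[OF xI], of k] x by (simp add: field_simps)
    qed (use s b t in \<open>auto simp: time_ivl_def\<close>)
    then have "wt k ^ q * norm (f s k - f t k) \<le> C * \<bar>s - t\<bar>"
      by (simp add: field_simps)
    then show "wt k ^ q * norm ((f s k - f t k) /\<^sub>R (s - t)) \<le> C"
      using C0 by (cases "s = t") (simp_all add: divide_inverse[symmetric] pos_divide_le_eq mult.left_commute[of _ "inverse _"] mult.commute[of "inverse _"])
  qed
  then show ?thesis using that C by blast
qed

text \<open>Each term of the squared Sobolev norm of the difference between quotient and derivative tends to
  zero, and the decay bounds dominate the terms by a summable family.\<close>

lemma has_time_derivative_tame: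
  fixes f g :: "real \<Rightarrow> ('d::finite) field"
  assumes f: "tame (time_ivl T) f" and g: "tame (time_ivl T) g"
    and fg: "coeff_deriv (time_ivl T) f g" and t: "t \<in> time_ivl T"
  shows "has_time_derivative f (g t) t (time_ivl T)"
proof -
  let ?I = "time_ivl T"
  define z where "z = (\<lambda>s k. (f s k - f t k) /\<^sub>R (s - t) - g t k)"
  have zS: "z s \<in> Sob_inf" if "s \<in> ?I" for s
    unfolding z_def by (intro Sob_inf_diff Sob_inf_scaleR tame_Sob_inf[OF f] tame_Sob_inf[OF g] that t)
  obtain b where b: "t < b" "b \<in> ?I" using time_ivl_later[OF t] .
  have "((\<lambda>s. sob_norm n (z s)) \<longlongrightarrow> 0) (at t within ?I)" for n
  proof -
    obtain N :: nat where N: "n \<le> real N" using real_arch_simple by blast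
    define q where "q = N + (CARD('d) + 1)"
    obtain C where quot: "\<And>s. s \<in> ?I \<Longrightarrow> s \<le> b \<Longrightarrow> decay q C (\<lambda>k. (f s k - f t k) /\<^sub>R (s - t))"
      and C: "\<And>s. s \<in> ?I \<Longrightarrow> s \<le> b \<Longrightarrow> decay q C (g s)"
      by (rule decay_difference_quotient[OF g fg b(2) t less_imp_le[OF b(1)], of q]) blast
    have zdec: "decay q (C + C) (z s)" if "s \<in> ?I" "s \<le> b" for s
      unfolding z_def using quot[OF that] C[OF t] b(1) by (intro decay_diff) auto
    define M where "M = (\<lambda>k :: int ^ 'd. (2 * pi) ^ CARD('d) * ((C + C)\<^sup>2 * (1 / wt k ^ (CARD('d) + 1))))"
    have "((\<lambda>s. \<Sum>\<^sub>\<infinity>k. sweight n k * (z s k \<bullet> z s k)) \<longlongrightarrow> (\<Sum>\<^sub>\<infinity>k :: int ^ 'd. 0)) (at t within ?I)"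
    proof (rule tannery_infsum)
      fix k
      have "((\<lambda>s. z s k) \<longlongrightarrow> 0) (at t within ?I)"
        using fg t unfolding coeff_deriv_def has_vector_derivative_iff_quotient z_def LIM_zero_iff by blast
      then show "((\<lambda>s. sweight n k * (z s k \<bullet> z s k)) \<longlongrightarrow> 0) (at t within ?I)"
        using tendsto_mult[OF tendsto_const tendsto_inner, of _ 0 _ _ 0] by fastforce
    next
      show "eventually (\<lambda>s. \<forall>k. norm (sweight n k * (z s k \<bullet> z s k)) \<le> M k) (at t within ?I)"
      proof (rule eventually_mono[OF eventually_le_time_ivl[OF b(1)]], intro allI)
        fix s k assume "s \<in> ?I \<and> s \<le> b"
        then have "decay (N + (CARD('d) + 1)) (C + C) (z s)" using zdec unfolding q_def by blast
        from mult_left_mono[OF sobolev_weight_le[OF this N, of k], of "(2 * pi) ^ CARD('d)"]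
        show "norm (sweight n k * (z s k \<bullet> z s k)) \<le> M k"
          by (simp add: sweight_def M_def mult.assoc power2_norm_eq_inner abs_mult)
      qed
      show "M summable_on UNIV"
        unfolding M_def by (intro summable_on_cmult_right summable_inverse_wt_pow) simp
    qed
    then have "((\<lambda>s. sqrt (\<Sum>\<^sub>\<infinity>k. sweight n k * (z s k \<bullet> z s k))) \<longlongrightarrow> 0) (at t within ?I)"
      using tendsto_real_sqrt by fastforce
    moreover have "sqrt (\<Sum>\<^sub>\<infinity>k. sweight n k * (z s k \<bullet> z s k)) = sob_norm n (z s)" if "s \<in> ?I" for s
    proof -
      have "(\<Sum>\<^sub>\<infinity>k. sweight n k * (z s k \<bullet> z s k)) = (\<Sum>\<^sub>\<infinity>k\<in>UNIV - {0}. sweight n k * (z s k \<bullet> z s k))"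
        by (rule infsum_cong_neutral) (auto simp: Sob_inf_zero[OF zS[OF that]])
      also have "\<dots> = sob_inner n (z s) (z s)"
        using has_sum_sob_inner[OF zS[OF that] zS[OF that]] by (rule infsumI)
      finally show ?thesis by (simp add: sob_norm_def)
    qed
    then have "eventually (\<lambda>s. sqrt (\<Sum>\<^sub>\<infinity>k. sweight n k * (z s k \<bullet> z s k)) = sob_norm n (z s)) (at t within ?I)"
      by (auto simp: eventually_at_filter intro!: always_eventually)
    ultimately show ?thesis by (rule Lim_transform_eventually)
  qed
  then show ?thesis
    unfolding has_time_derivative_def z_def using tame_Sob_inf[OF f] tame_Sob_inf[OF g] t by blast
qed

subsection \<open>Operations on tame curves\<close>

text \<open>Convergence of the coefficients with a uniform decay bound is enough for convergence of the
  convolution.  Continuity and differentiability in time and the limit of the Picard iteration are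
  instances, for different filters.\<close>

lemma tendsto_NSP:
  fixes v w :: "'b \<Rightarrow> ('d::finite) field"
  assumes lim: "\<And>h. ((\<lambda>y. v y h) \<longlongrightarrow> v0 h) F" "\<And>h. ((\<lambda>y. w y h) \<longlongrightarrow> w0 h) F"
    and v: "eventually (\<lambda>y. div_free (v y) \<and> decay (CARD('d) + 2) A (v y)) F"
    and w: "eventually (\<lambda>y. decay (CARD('d) + 2) B (w y)) F"
    and "div_free v0" "wiener v0" "wiener w0"
  shows "((\<lambda>y. NSP (v y) (w y) k) \<longlongrightarrow> NSP v0 w0 k) F"
proof (rule Lim_transform_eventually)
  define M where "M = (\<lambda>h :: int ^ 'd. 2 * norm (wvec k) * \<bar>A\<bar> * \<bar>B\<bar> * (1 / wt h ^ (CARD('d) + 1)))"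
  have "((\<lambda>y. \<Sum>\<^sub>\<infinity>h. symbol k (v y h) (w y (k - h))) \<longlongrightarrow> (\<Sum>\<^sub>\<infinity>h. symbol k (v0 h) (w0 (k - h)))) F"
  proof (rule tannery_infsum)
    show "((\<lambda>y. symbol k (v y h) (w y (k - h))) \<longlongrightarrow> symbol k (v0 h) (w0 (k - h))) F" for h
      by (intro tendsto_symbol lim)
    show "eventually (\<lambda>y. \<forall>h. norm (symbol k (v y h) (w y (k - h))) \<le> M h) F"
      using v w
    proof eventually_elim
      case (elim y)
      show ?case
      proof
        fix h
        have "wt h ^ (CARD('d) + 1) * norm (v y h) \<le> \<bar>A\<bar>"
          using decayD[OF decay_less[of "CARD('d) + 2" A "v y" "CARD('d) + 1"], of h] elim(1) by simp
        then have 1: "norm (v y h) \<le> \<bar>A\<bar> * (1 / wt h ^ (CARD('d) + 1))"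
          by (simp add: field_simps)
        have 2: "norm (w y (k - h)) \<le> \<bar>B\<bar>"
          using decayD[OF decay_less[of "CARD('d) + 2" B "w y" 0], of "k - h"] elim(2) by simp
        have "norm (symbol k (v y h) (w y (k - h))) \<le> 2 * norm (wvec k) * norm (v y h) * norm (w y (k - h))"
          by (rule norm_symbol_le)
        also have "\<dots> \<le> 2 * norm (wvec k) * (\<bar>A\<bar> * (1 / wt h ^ (CARD('d) + 1))) * \<bar>B\<bar>"
          by (intro mult_mono 1 2 mult_nonneg_nonneg order_refl) auto
        also have "\<dots> = M h" by (simp add: M_def)
        finally show "norm (symbol k (v y h) (w y (k - h))) \<le> M h" .
      qed
    qed
    show "M summable_on UNIV"
      unfolding M_def by (intro summable_on_cmult_right summable_inverse_wt_pow) simp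
  qed
  then show "((\<lambda>y. \<Sum>\<^sub>\<infinity>h. symbol k (v y h) (w y (k - h))) \<longlongrightarrow> NSP v0 w0 k) F"
    using assms by (simp add: NSP_eq_infsum)
  show "eventually (\<lambda>y. (\<Sum>\<^sub>\<infinity>h. symbol k (v y h) (w y (k - h))) = NSP (v y) (w y) k) F"
    using v w by eventually_elim (auto simp: NSP_eq_infsum decay_summable(1))
qed

lemma tame_wiener: "tame I f \<Longrightarrow> t \<in> I \<Longrightarrow> wiener (f t)"
  and tame_div_free: "tame I f \<Longrightarrow> t \<in> I \<Longrightarrow> div_free (f t)"
  using tame_Sob_inf Sob_inf_wiener Sob_inf_div_free by blast+

lemma tame_add:
  assumes f: "tame I f" and g: "tame I g"
  shows "tame I (\<lambda>t k. f t k + g t k)"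
  unfolding tame_def
proof (intro conjI ballI allI)
  fix b q assume b: "b \<in> I"
  obtain A where A: "\<And>t. t \<in> I \<Longrightarrow> t \<le> b \<Longrightarrow> decay q A (f t)" by (rule tame_decay[OF f b, of q]) blast
  obtain B where B: "\<And>t. t \<in> I \<Longrightarrow> t \<le> b \<Longrightarrow> decay q B (g t)" by (rule tame_decay[OF g b, of q]) blast
  show "\<exists>C. \<forall>t\<in>I. t \<le> b \<longrightarrow> decay q C (\<lambda>k. f t k + g t k)"
    using decay_add[OF A B] by blast
next
  show "adm (\<lambda>k. f t k + g t k)" if "t \<in> I" for t
    by (intro adm_add tame_adm[OF f that] tame_adm[OF g that])
  show "continuous_on I (\<lambda>t. f t k + g t k)" for k
    by (intro continuous_on_add tame_cont[OF f] tame_cont[OF g])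
qed

lemma tame_scaleR:
  assumes f: "tame I f"
  shows "tame I (\<lambda>t k. c *\<^sub>R f t k)"
  unfolding tame_def
proof (intro conjI ballI allI)
  fix b q assume b: "b \<in> I"
  obtain A where A: "\<And>t. t \<in> I \<Longrightarrow> t \<le> b \<Longrightarrow> decay q A (f t)" by (rule tame_decay[OF f b, of q]) blast
  show "\<exists>C. \<forall>t\<in>I. t \<le> b \<longrightarrow> decay q C (\<lambda>k. c *\<^sub>R f t k)"
    using decay_scaleR[OF A] by blast
next
  show "adm (\<lambda>k. c *\<^sub>R f t k)" if "t \<in> I" for t
    by (intro adm_scaleR tame_adm[OF f that])
  show "continuous_on I (\<lambda>t. c *\<^sub>R f t k)" for k
    by (intro continuous_on_scaleR continuous_on_const tame_cont[OF f])
qed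

lemma tame_laplace:
  assumes f: "tame I f"
  shows "tame I (\<lambda>t. laplace (f t))"
  unfolding tame_def
proof (intro conjI ballI allI)
  fix b q assume b: "b \<in> I"
  obtain A where A: "\<And>t. t \<in> I \<Longrightarrow> t \<le> b \<Longrightarrow> decay (q + 2) A (f t)" by (rule tame_decay[OF f b, of "q + 2"]) blast
  show "\<exists>C. \<forall>t\<in>I. t \<le> b \<longrightarrow> decay q C (laplace (f t))"
    using decay_laplace[OF A] by blast
next
  show "continuous_on I (\<lambda>t. laplace (f t) k)" for k
    unfolding laplace_def by (intro continuous_intros tame_cont[OF f])
  show "adm (laplace (f t))" if "t \<in> I" for t
    by (intro adm_laplace tame_adm[OF f that])
qed

lemma tame_NSP:
  fixes f g :: "real \<Rightarrow> ('d::finite) field"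
  assumes f: "tame (time_ivl T) f" and g: "tame (time_ivl T) g"
  shows "tame (time_ivl T) (\<lambda>t. NSP (f t) (g t))"
  unfolding tame_def
proof (intro conjI ballI allI)
  let ?I = "time_ivl T"
  show "adm (NSP (f t) (g t))" if "t \<in> ?I" for t
    by (intro adm_NSP tame_adm[OF f that] tame_adm[OF g that] tame_wiener[OF f that] tame_wiener[OF g that])
  show "\<exists>C. \<forall>t\<in>?I. t \<le> b \<longrightarrow> decay q C (NSP (f t) (g t))" if b: "b \<in> ?I" for b q
  proof -
    obtain A where A: "\<And>t. t \<in> ?I \<Longrightarrow> t \<le> b \<Longrightarrow> decay (q + CARD('d) + 2) A (f t)"
      by (rule tame_decay[OF f b, of "q + CARD('d) + 2"]) blast
    obtain B where B: "\<And>t. t \<in> ?I \<Longrightarrow> t \<le> b \<Longrightarrow> decay (q + CARD('d) + 2) B (g t)"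
      by (rule tame_decay[OF g b, of "q + CARD('d) + 2"]) blast
    show ?thesis
      using decay_NSP[OF tame_div_free[OF f] A B] by blast
  qed
  show "continuous_on ?I (\<lambda>t. NSP (f t) (g t) k)" for k
    unfolding continuous_on_def
  proof
    fix t assume t: "t \<in> ?I"
    obtain b where b: "t < b" "b \<in> ?I" using time_ivl_later[OF t] .
    obtain A where A: "\<And>t. t \<in> ?I \<Longrightarrow> t \<le> b \<Longrightarrow> decay (CARD('d) + 2) A (f t)"
      by (rule tame_decay[OF f b(2), of "CARD('d) + 2"]) blast
    obtain B where B: "\<And>t. t \<in> ?I \<Longrightarrow> t \<le> b \<Longrightarrow> decay (CARD('d) + 2) B (g t)"
      by (rule tame_decay[OF g b(2), of "CARD('d) + 2"]) blast
    show "((\<lambda>s. NSP (f s) (g s) k) \<longlongrightarrow> NSP (f t) (g t) k) (at t within ?I)"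
    proof (rule tendsto_NSP)
      show "((\<lambda>s. f s h) \<longlongrightarrow> f t h) (at t within ?I)" "((\<lambda>s. g s h) \<longlongrightarrow> g t h) (at t within ?I)" for h
        using tame_cont[OF f] tame_cont[OF g] t by (auto simp: continuous_on_def)
      show "eventually (\<lambda>s. div_free (f s) \<and> decay (CARD('d) + 2) A (f s)) (at t within ?I)"
        by (rule eventually_mono[OF eventually_le_time_ivl[OF b(1)]]) (use tame_div_free[OF f] A in blast)
      show "eventually (\<lambda>s. decay (CARD('d) + 2) B (g s)) (at t within ?I)"
        by (rule eventually_mono[OF eventually_le_time_ivl[OF b(1)]]) (use B in blast)
    qed (intro tame_div_free[OF f t] tame_wiener[OF f t] tame_wiener[OF g t])+
  qed
qed

lemma coeff_deriv_add:
  "coeff_deriv I f f' \<Longrightarrow> coeff_deriv I g g' \<Longrightarrow> coeff_deriv I (\<lambda>t k. f t k + g t k) (\<lambda>t k. f' t k + g' t k)"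
  unfolding coeff_deriv_def by (simp add: has_vector_derivative_add)

lemma coeff_deriv_scaleR:
  "coeff_deriv I f f' \<Longrightarrow> coeff_deriv I (\<lambda>t k. c *\<^sub>R f t k) (\<lambda>t k. c *\<^sub>R f' t k)"
  unfolding coeff_deriv_def
  by (simp add: bounded_linear.has_vector_derivative[OF bounded_linear_scaleR_right])

lemma coeff_deriv_laplace:
  assumes "coeff_deriv I f f'"
  shows "coeff_deriv I (\<lambda>t. laplace (f t)) (\<lambda>t. laplace (f' t))"
  unfolding coeff_deriv_def
proof (intro ballI allI)
  fix t k assume "t \<in> I"
  then have "((\<lambda>s. f s k) has_vector_derivative f' t k) (at t within I)"
    using assms by (simp add: coeff_deriv_def)
  from bounded_linear.has_vector_derivative[OF bounded_linear_scaleR_right this, of "- (norm (wvec k))\<^sup>2"]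
  show "((\<lambda>s. laplace (f s) k) has_vector_derivative laplace (f' t) k) (at t within I)"
    by (simp add: laplace_def)
qed

text \<open>The product rule, from the splitting
  \<open>P(f(s), g(s)) - P(f(t), g(t)) = P(f(s) - f(t), g(s)) + P(f(t), g(s) - g(t))\<close>.\<close>

lemma coeff_deriv_NSP:
  fixes f g :: "real \<Rightarrow> ('d::finite) field"
  assumes f: "tame (time_ivl T) f" and f': "tame (time_ivl T) f'" and ff': "coeff_deriv (time_ivl T) f f'"
    and g: "tame (time_ivl T) g" and g': "tame (time_ivl T) g'" and gg': "coeff_deriv (time_ivl T) g g'"
  shows "coeff_deriv (time_ivl T) (\<lambda>t. NSP (f t) (g t)) (\<lambda>t k. NSP (f' t) (g t) k + NSP (f t) (g' t) k)"
  unfolding coeff_deriv_def has_vector_derivative_iff_quotient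
proof (intro ballI allI)
  let ?I = "time_ivl T"
  fix t k assume t: "t \<in> ?I"
  let ?F = "at t within ?I"
  obtain b where b: "t < b" "b \<in> ?I" using time_ivl_later[OF t] .
  define qf where "qf = (\<lambda>s k. (f s k - f t k) /\<^sub>R (s - t))"
  define qg where "qg = (\<lambda>s k. (g s k - g t k) /\<^sub>R (s - t))"
  obtain A where A: "\<And>s. s \<in> ?I \<Longrightarrow> s \<le> b \<Longrightarrow> decay (CARD('d) + 2) A (qf s)"
    unfolding qf_def by (rule decay_difference_quotient[OF f' ff' b(2) t less_imp_le[OF b(1)], of "CARD('d) + 2"]) blast
  obtain B where B: "\<And>s. s \<in> ?I \<Longrightarrow> s \<le> b \<Longrightarrow> decay (CARD('d) + 2) B (qg s)"
    unfolding qg_def by (rule decay_difference_quotient[OF g' gg' b(2) t less_imp_le[OF b(1)], of "CARD('d) + 2"]) blast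
  obtain G where G: "\<And>s. s \<in> ?I \<Longrightarrow> s \<le> b \<Longrightarrow> decay (CARD('d) + 2) G (g s)"
    by (rule tame_decay[OF g b(2), of "CARD('d) + 2"]) blast
  obtain C where C: "\<And>s. s \<in> ?I \<Longrightarrow> s \<le> b \<Longrightarrow> decay (CARD('d) + 2) C (f s)"
    by (rule tame_decay[OF f b(2), of "CARD('d) + 2"]) blast
  have ev: "eventually P ?F" if "\<And>s. s \<in> ?I \<Longrightarrow> s \<le> b \<Longrightarrow> P s" for P
    by (rule eventually_mono[OF eventually_le_time_ivl[OF b(1)]]) (use that in auto)
  have qf: "div_free (qf s)" "wiener (qf s)" if "s \<in> ?I" for s
    unfolding qf_def
    by (intro div_free_scaleR div_free_diff wiener_scaleR wiener_diff tame_div_free[OF f] tame_wiener[OF f] that t)+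
  have qg: "wiener (qg s)" if "s \<in> ?I" for s
    unfolding qg_def by (intro wiener_scaleR wiener_diff tame_wiener[OF g] that t)+
  have 1: "((\<lambda>s. NSP (qf s) (g s) k) \<longlongrightarrow> NSP (f' t) (g t) k) ?F"
  proof (rule tendsto_NSP)
    show "((\<lambda>s. qf s h) \<longlongrightarrow> f' t h) ?F" for h
      using ff' t unfolding coeff_deriv_def has_vector_derivative_iff_quotient qf_def by blast
    show "((\<lambda>s. g s h) \<longlongrightarrow> g t h) ?F" for h
      using tame_cont[OF g] t by (auto simp: continuous_on_def)
    show "eventually (\<lambda>s. div_free (qf s) \<and> decay (CARD('d) + 2) A (qf s)) ?F"
      by (rule ev) (use qf A in blast)
    show "eventually (\<lambda>s. decay (CARD('d) + 2) G (g s)) ?F"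
      by (rule ev) (use G in blast)
  qed (intro tame_div_free[OF f' t] tame_wiener[OF f' t] tame_wiener[OF g t])+
  have 2: "((\<lambda>s. NSP (f t) (qg s) k) \<longlongrightarrow> NSP (f t) (g' t) k) ?F"
  proof (rule tendsto_NSP)
    show "((\<lambda>s. qg s h) \<longlongrightarrow> g' t h) ?F" for h
      using gg' t unfolding coeff_deriv_def has_vector_derivative_iff_quotient qg_def by blast
    show "eventually (\<lambda>s. div_free (f t) \<and> decay (CARD('d) + 2) C (f t)) ?F"
      using C[OF t less_imp_le[OF b(1)]] tame_div_free[OF f t] by (intro always_eventually) blast
    show "eventually (\<lambda>s. decay (CARD('d) + 2) B (qg s)) ?F"
      by (rule ev) (use B in blast)
  qed (intro tendsto_const tame_div_free[OF f t] tame_wiener[OF f t] tame_wiener[OF g' t])+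
  from tendsto_add[OF 1 2]
  show "((\<lambda>s. (NSP (f s) (g s) k - NSP (f t) (g t) k) /\<^sub>R (s - t)) \<longlongrightarrow> NSP (f' t) (g t) k + NSP (f t) (g' t) k) ?F"
  proof (rule Lim_transform_eventually, intro ev)
    fix s assume s: "s \<in> ?I"
    have "NSP (qf s) (g s) k = (NSP (f s) (g s) k - NSP (f t) (g s) k) /\<^sub>R (s - t)"
      unfolding qf_def
      by (simp only: NSP_scaleR_left NSP_diff_left div_free_diff wiener_diff
          tame_div_free[OF f] tame_wiener[OF f] tame_wiener[OF g] s t)
    moreover have "NSP (f t) (qg s) k = (NSP (f t) (g s) k - NSP (f t) (g t) k) /\<^sub>R (s - t)"
      unfolding qg_def
      by (simp only: NSP_scaleR_right NSP_diff_right wiener_diff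
          tame_div_free[OF f] tame_wiener[OF f] tame_wiener[OF g] s t)
    ultimately show "NSP (qf s) (g s) k + NSP (f t) (qg s) k = (NSP (f s) (g s) k - NSP (f t) (g t) k) /\<^sub>R (s - t)"
      by (simp flip: scaleR_add_right)
  qed
qed

subsection \<open>Curves of class \<open>C\<^sup>j\<close>\<close>

text \<open>A derivative is asked for by an existential quantifier, not computed, so that the closure properties
  below are plain inductions; uniqueness of derivatives is used only to pass to one
  sequence of derivatives for all orders.\<close>

primrec smooth_upto :: "real set \<Rightarrow> nat \<Rightarrow> (real \<Rightarrow> ('d::finite) field) \<Rightarrow> bool" where
  "smooth_upto I 0 f \<longleftrightarrow> tame I f"
| "smooth_upto I (Suc j) f \<longleftrightarrow> tame I f \<and> (\<exists>g. coeff_deriv I f g \<and> smooth_upto I j g)"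

lemma smooth_upto_tame: "smooth_upto I j f \<Longrightarrow> tame I f"
  by (cases j) auto

lemma smooth_upto_Suc_D: "smooth_upto I (Suc j) f \<Longrightarrow> smooth_upto I j f"
  by (induction j arbitrary: f) (auto dest: smooth_upto_tame)

lemma tame_cong:
  assumes "\<And>t. t \<in> I \<Longrightarrow> f t = g t"
  shows "tame I f \<longleftrightarrow> tame I g"
proof -
  have "continuous_on I (\<lambda>t. f t k) \<longleftrightarrow> continuous_on I (\<lambda>t. g t k)" for k
    by (rule continuous_on_cong) (simp_all add: assms)
  then show ?thesis using assms unfolding tame_def by simp
qed

lemma coeff_deriv_cong_left:
  assumes "\<And>t. t \<in> I \<Longrightarrow> f t = g t"
  shows "coeff_deriv I f h \<longleftrightarrow> coeff_deriv I g h"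
  unfolding coeff_deriv_def
  by (intro ball_cong refl all_cong1 has_vector_derivative_cong_ev always_eventually) (simp_all add: assms)

lemma smooth_upto_cong:
  assumes "\<And>t. t \<in> I \<Longrightarrow> f t = g t"
  shows "smooth_upto I j f \<longleftrightarrow> smooth_upto I j g"
  using tame_cong[of I f g] coeff_deriv_cong_left[of I f g] assms by (cases j) auto

lemma smooth_upto_add: "smooth_upto I j f \<Longrightarrow> smooth_upto I j g \<Longrightarrow> smooth_upto I j (\<lambda>t k. f t k + g t k)"
  by (induction j arbitrary: f g) (auto intro: tame_add coeff_deriv_add)

lemma smooth_upto_scaleR: "smooth_upto I j f \<Longrightarrow> smooth_upto I j (\<lambda>t k. c *\<^sub>R f t k)"
  by (induction j arbitrary: f) (auto intro: tame_scaleR coeff_deriv_scaleR)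

lemma smooth_upto_laplace: "smooth_upto I j f \<Longrightarrow> smooth_upto I j (\<lambda>t. laplace (f t))"
  by (induction j arbitrary: f) (auto intro: tame_laplace coeff_deriv_laplace)

lemma smooth_upto_NSP:
  "smooth_upto (time_ivl T) j f \<Longrightarrow> smooth_upto (time_ivl T) j g \<Longrightarrow> smooth_upto (time_ivl T) j (\<lambda>t. NSP (f t) (g t))"
proof (induction j arbitrary: f g)
  case (Suc j)
  obtain f' g' where f': "coeff_deriv (time_ivl T) f f'" "smooth_upto (time_ivl T) j f'"
    and g': "coeff_deriv (time_ivl T) g g'" "smooth_upto (time_ivl T) j g'"
    using Suc.prems by auto
  have f: "tame (time_ivl T) f" "smooth_upto (time_ivl T) j f" and g: "tame (time_ivl T) g" "smooth_upto (time_ivl T) j g"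
    using Suc.prems smooth_upto_tame smooth_upto_Suc_D by blast+
  have "smooth_upto (time_ivl T) j (\<lambda>t k. NSP (f' t) (g t) k + NSP (f t) (g' t) k)"
    by (intro smooth_upto_add Suc.IH f' g' f g)
  then show ?case
    using coeff_deriv_NSP[OF f(1) smooth_upto_tame[OF f'(2)] f'(1) g(1) smooth_upto_tame[OF g'(2)] g'(1)]
      tame_NSP[OF f(1) g(1)] by auto
qed (simp add: tame_NSP)

lemma smooth_curve_time_ivl:
  assumes "\<And>j. smooth_upto (time_ivl T) j f"
  shows "smooth_curve (time_ivl T) f"
proof -
  let ?I = "time_ivl T"
  define D where "D = (\<lambda>g :: real \<Rightarrow> 'a field. \<lambda>t k. vector_derivative (\<lambda>s. g s k) (at t within ?I))"
  have D: "coeff_deriv ?I g (D g) \<and> (\<forall>j. smooth_upto ?I j (D g))" if g: "\<And>j. smooth_upto ?I j g" for g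
  proof -
    have unique: "h t = D g t" if "coeff_deriv ?I g h" "t \<in> ?I" for h t
    proof
      fix k
      have "((\<lambda>s. g s k) has_vector_derivative h t k) (at t within ?I)"
        using that by (simp add: coeff_deriv_def)
      then show "h t k = D g t k"
        unfolding D_def by (rule vector_derivative_within[OF at_within_time_ivl_neq_bot[OF that(2)], symmetric])
    qed
    have "smooth_upto ?I j (D g)" for j
    proof -
      obtain h where "coeff_deriv ?I g h" "smooth_upto ?I j h" using g[of "Suc j"] by auto
      then show ?thesis using smooth_upto_cong[of ?I h "D g" j] unique by blast
    qed
    moreover have "coeff_deriv ?I g (D g)"
    proof -
      obtain h where "coeff_deriv ?I g h" using g[of "Suc 0"] by auto
      then show ?thesis using unique unfolding coeff_deriv_def by metis
    qed
    ultimately show ?thesis by blast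
  qed
  define F where "F = (\<lambda>j. (D ^^ j) f)"
  have F: "\<forall>i. smooth_upto ?I i (F j)" for j
    by (induction j) (use assms D in \<open>auto simp: F_def\<close>)
  have "has_time_derivative (F j) (F (Suc j) t) t ?I" if "t \<in> ?I" for j t
  proof (rule has_time_derivative_tame[OF _ _ _ that])
    show "tame ?I (F j)" "tame ?I (F (Suc j))"
      using F smooth_upto_tame by blast+
    show "coeff_deriv ?I (F j) (F (Suc j))"
      using D[of "F j"] F by (simp add: F_def)
  qed
  then show ?thesis
    unfolding smooth_curve_def by (intro exI[of _ F]) (auto simp: F_def)
qed

lemma tame_NS_rhs: "tame (time_ivl T) v \<Longrightarrow> tame (time_ivl T) (\<lambda>t. NS_rhs R (v t))"
  unfolding NS_rhs_def by (intro tame_add tame_laplace tame_scaleR tame_NSP)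

text \<open>The equation expresses the derivative by the curve itself, so that each order of
  differentiability yields the next one.\<close>

theorem NS_solutionI:
  assumes "0 < T" and v: "tame (time_ivl T) v"
    and deriv: "coeff_deriv (time_ivl T) v (\<lambda>t. NS_rhs R (v t))" and "v 0 = us"
  shows "NS_solution R us T v"
proof -
  have "smooth_upto (time_ivl T) j v" for j
  proof (induction j)
    case (Suc j)
    then have "smooth_upto (time_ivl T) j (\<lambda>t. NS_rhs R (v t))"
      unfolding NS_rhs_def by (intro smooth_upto_add smooth_upto_laplace smooth_upto_scaleR smooth_upto_NSP)
    then show ?case using v deriv by auto
  qed (simp add: v)
  then show ?thesis
    using assms has_time_derivative_tame[OF v tame_NS_rhs[OF v] deriv]
    by (simp add: NS_solution_def smooth_curve_time_ivl)
qed

section \<open>Duhamel integrals and the expansion in powers of the Reynolds number\<close>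

definition duhamel :: "(real \<Rightarrow> ('d::finite) field) \<Rightarrow> real \<Rightarrow> 'd field" where
  "duhamel f t = field_integral 0 t (\<lambda>s. heat (t - s) (f s))"

lemma duhamel_eq:
  "duhamel f t k = exp (- t * (norm (wvec k))\<^sup>2) *\<^sub>R integral {0..t} (\<lambda>s. exp (s * (norm (wvec k))\<^sup>2) *\<^sub>R f s k)"
proof -
  have "duhamel f t k = integral {0..t} (\<lambda>s. exp (- t * (norm (wvec k))\<^sup>2) *\<^sub>R exp (s * (norm (wvec k))\<^sup>2) *\<^sub>R f s k)"
    by (simp add: duhamel_def field_integral_def heat_def algebra_simps flip: exp_add)
  then show ?thesis by (simp only: integral_cmul)
qed

lemma at_within_time_ivl_Icc:
  assumes "b \<in> time_ivl T" "0 \<le> t" "t < b"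
  shows "at t within time_ivl T = at t within {0..b}"
  by (rule at_within_nhd[of t "{..<b}"])
    (use assms time_ivl_downward[OF assms(1)] in \<open>auto simp: time_ivl_def\<close>)

lemma coeff_deriv_continuous: "coeff_deriv I f g \<Longrightarrow> continuous_on I (\<lambda>t. f t k)"
  unfolding coeff_deriv_def continuous_on_eq_continuous_within
  using has_vector_derivative_continuous by blast

text \<open>With the factor \<open>exp (- t |k|\<^sup>2)\<close> taken out of the integral, this is the product rule and the
  fundamental theorem of calculus.\<close>

lemma coeff_deriv_duhamel:
  fixes f :: "real \<Rightarrow> ('d::finite) field"
  assumes cont: "\<And>k. continuous_on (time_ivl T) (\<lambda>t. f t k)"
  shows "coeff_deriv (time_ivl T) (duhamel f) (\<lambda>t k. laplace (duhamel f t) k + f t k)"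
  unfolding coeff_deriv_def
proof (intro ballI allI)
  fix t and k :: "int ^ 'd" assume t: "t \<in> time_ivl T"
  obtain b where b: "t < b" "b \<in> time_ivl T" using time_ivl_later[OF t] .
  have t0: "0 \<le> t" using t by (rule time_ivl_nonneg)
  define c where "c = (norm (wvec k))\<^sup>2"
  define g where "g = (\<lambda>s. exp (s * c) *\<^sub>R f s k)"
  have g: "continuous_on {0..b} g"
    unfolding g_def
    by (intro continuous_intros continuous_on_subset[OF cont] atLeastAtMost_subset_time_ivl b)
  have "((\<lambda>t. exp (- t * c) *\<^sub>R integral {0..t} g) has_vector_derivative
      exp (- t * c) *\<^sub>R g t + (- c * exp (- t * c)) *\<^sub>R integral {0..t} g) (at t within {0..b})"
    by (rule has_vector_derivative_scaleR[OF _ integral_has_vector_derivative[OF g]])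
      (use t0 b in \<open>auto intro!: derivative_eq_intros\<close>)
  moreover have "exp (- t * c) *\<^sub>R g t = f t k"
    by (simp add: g_def flip: exp_add)
  ultimately show "((\<lambda>s. duhamel f s k) has_vector_derivative laplace (duhamel f t) k + f t k) (at t within time_ivl T)"
    unfolding at_within_time_ivl_Icc[OF b(2) t0 b(1)] duhamel_eq c_def[symmetric] g_def[symmetric]
    by (simp add: laplace_def duhamel_eq add.commute g_def c_def)
qed

lemma adm_duhamel:
  assumes f: "\<And>s. s \<in> {0..t} \<Longrightarrow> adm (f s)" and cont: "\<And>k. continuous_on {0..t} (\<lambda>t. f t k)"
  shows "adm (duhamel f t)"
proof -
  define g where "g = (\<lambda>k s. exp (s * (norm (wvec k))\<^sup>2) *\<^sub>R f s k)"
  have int: "g k integrable_on {0..t}" for k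
    unfolding g_def by (intro integrable_continuous_interval continuous_intros cont)
  have lin: "h (integral {0..t} (g k)) = integral {0..t} (\<lambda>s. h (g k s))" if "bounded_linear h" for h :: "_ \<Rightarrow> 'b::euclidean_space" and k
    using integral_linear[OF int that] by (simp add: o_def)
  have adm: "adm (\<lambda>k. integral {0..t} (g k))"
    unfolding adm_def div_free_iff_kdot
  proof (intro conjI allI)
    fix k
    show "cnjv (integral {0..t} (g k)) = integral {0..t} (g (- k))"
      unfolding lin[OF bounded_linear_cnjv]
      by (rule integral_cong)
        (use f in \<open>auto simp: g_def wvec_minus adm_def linear_scale[OF bounded_linear.linear[OF bounded_linear_cnjv]]\<close>)
    have "integral {0..t} (\<lambda>s. kdot k (g k s)) = integral {0..t} (\<lambda>s. 0)"
      by (rule integral_cong) (use f in \<open>auto simp: g_def kdot_scaleR adm_def div_free_iff_kdot\<close>)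
    then show "kdot k (integral {0..t} (g k)) = 0"
      using lin[OF bounded_linear_kdot[of k]] by simp
    have "integral {0..t} (g 0) = integral {0..t} (\<lambda>s. 0)"
      by (rule integral_cong) (use f in \<open>auto simp: g_def adm_def\<close>)
    then show "integral {0..t} (g 0) = 0" by simp
  qed
  have "duhamel f t = (\<lambda>k. exp (- t * (norm (wvec k))\<^sup>2) *\<^sub>R integral {0..t} (g k))"
    by (auto simp: duhamel_eq g_def)
  then show ?thesis
    using adm_mult[OF adm, of "\<lambda>k. exp (- t * (norm (wvec k))\<^sup>2)"] by (simp add: wvec_minus)
qed

lemma norm_duhamel_le:
  assumes cont: "continuous_on {0..t} (\<lambda>t. f t k)" and B: "\<And>s. s \<in> {0..t} \<Longrightarrow> norm (f s k) \<le> B" and "0 \<le> t"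
  shows "norm (duhamel f t k) \<le> t * B"
proof -
  have "norm (duhamel f t k) \<le> integral {0..t} (\<lambda>s. B)"
    unfolding duhamel_def field_integral_def heat_def
  proof (rule integral_norm_bound_integral)
    show "(\<lambda>s. exp (- (t - s) * (norm (wvec k))\<^sup>2) *\<^sub>R f s k) integrable_on {0..t}"
      by (intro integrable_continuous_interval continuous_intros cont)
    fix s assume s: "s \<in> {0..t}"
    have "exp (- (t - s) * (norm (wvec k))\<^sup>2) \<le> 1"
      using s by (auto intro: mult_nonpos_nonneg)
    then have "exp (- (t - s) * (norm (wvec k))\<^sup>2) * norm (f s k) \<le> 1 * B"
      by (intro mult_mono B s) auto
    then show "norm (exp (- (t - s) * (norm (wvec k))\<^sup>2) *\<^sub>R f s k) \<le> B" by simp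
  qed auto
  then show ?thesis using assms(3) by simp
qed

lemma tame_duhamel:
  assumes f: "tame (time_ivl T) f"
  shows "tame (time_ivl T) (duhamel f)"
  unfolding tame_def
proof (intro conjI ballI allI)
  let ?I = "time_ivl T"
  have cont: "continuous_on {0..t} (\<lambda>t. f t k)" if "t \<in> ?I" for t k
    by (rule continuous_on_subset[OF tame_cont[OF f] atLeastAtMost_subset_time_ivl[OF that]])
  show "adm (duhamel f t)" if "t \<in> ?I" for t
    using time_ivl_downward[OF that] by (intro adm_duhamel cont that tame_adm[OF f]) auto
  show "continuous_on ?I (\<lambda>t. duhamel f t k)" for k
    by (rule coeff_deriv_continuous[OF coeff_deriv_duhamel[OF tame_cont[OF f]]])
  show "\<exists>C. \<forall>t\<in>?I. t \<le> b \<longrightarrow> decay q C (duhamel f t)" if b: "b \<in> ?I" for b q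
  proof -
    obtain C where C: "\<And>t. t \<in> ?I \<Longrightarrow> t \<le> b \<Longrightarrow> decay q C (f t)" by (rule tame_decay[OF f b, of q]) blast
    have C0: "0 \<le> C" using C[OF b] by (auto intro: decay_nonneg)
    have "decay q (b * C) (duhamel f t)" if t: "t \<in> ?I" "t \<le> b" for t
      unfolding decay_def
    proof
      fix k
      have "norm (duhamel f t k) \<le> t * (C / wt k ^ q)"
      proof (rule norm_duhamel_le)
        fix s assume s: "s \<in> {0..t}"
        then have "s \<in> ?I" using time_ivl_downward[OF t(1)] by auto
        then show "norm (f s k) \<le> C / wt k ^ q"
          using decayD[OF C[of s], of k] s t(2) by (simp add: field_simps)
      qed (use cont t in \<open>auto simp: time_ivl_def\<close>)
      also have "\<dots> \<le> b * (C / wt k ^ q)"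
        using t C0 by (intro mult_right_mono) auto
      finally show "wt k ^ q * norm (duhamel f t k) \<le> b * C"
        by (simp add: field_simps)
    qed
    then show ?thesis by blast
  qed
qed

lemma coeff_deriv_heat:
  fixes v :: "('d::finite) field"
  shows "coeff_deriv I (\<lambda>t. heat t v) (\<lambda>t. laplace (heat t v))"
  unfolding coeff_deriv_def
proof (intro ballI allI)
  fix t and k :: "int ^ 'd"
  have "((\<lambda>s. exp (- s * (norm (wvec k))\<^sup>2) *\<^sub>R v k) has_vector_derivative
      exp (- t * (norm (wvec k))\<^sup>2) *\<^sub>R 0 + (- (norm (wvec k))\<^sup>2 * exp (- t * (norm (wvec k))\<^sup>2)) *\<^sub>R v k) (at t within I)"
    by (rule has_vector_derivative_scaleR) (auto intro!: derivative_eq_intros)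
  then show "((\<lambda>s. heat s v k) has_vector_derivative laplace (heat t v) k) (at t within I)"
    by (simp add: heat_def laplace_def)
qed

lemma decay_heat:
  fixes v :: "('d::finite) field"
  assumes "decay q C v" "0 \<le> t"
  shows "decay q C (heat t v)"
  unfolding decay_def
proof
  fix k :: "int ^ 'd"
  have "exp (- t * (norm (wvec k))\<^sup>2) \<le> 1"
    using assms(2) by simp
  then have "exp (- t * (norm (wvec k))\<^sup>2) * (wt k ^ q * norm (v k)) \<le> 1 * C"
    by (intro mult_mono decayD[OF assms(1)]) (use decay_nonneg[OF assms(1)] in auto)
  then show "wt k ^ q * norm (heat t v k) \<le> C"
    by (simp add: heat_def mult_ac)
qed

lemma tame_heat:
  assumes "v \<in> Sob_inf"
  shows "tame (time_ivl T) (\<lambda>t. heat t v)"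
  unfolding tame_def
proof (intro conjI ballI allI)
  show "adm (heat t v)" for t by (intro adm_heat Sob_inf_adm assms)
  show "continuous_on (time_ivl T) (\<lambda>t. heat t v k)" for k
    by (rule coeff_deriv_continuous[OF coeff_deriv_heat])
  show "\<exists>C. \<forall>t\<in>time_ivl T. t \<le> b \<longrightarrow> decay q C (heat t v)" for b q
  proof -
    obtain C where "decay q C v" using assms by (auto simp: Sob_inf_iff)
    then show ?thesis using decay_heat time_ivl_nonneg by blast
  qed
qed

lemma tame_zero: "tame I (\<lambda>t k. 0)"
  by (auto simp: tame_def adm_def decay_def div_free_iff_kdot cnjv_def vec_eq_iff intro!: exI[of _ 0])

lemma smooth_upto_zero: "smooth_upto I j (\<lambda>t k. 0)"
proof (induction j)
  case (Suc j)
  have "coeff_deriv I (\<lambda>t k. 0) (\<lambda>t k. 0)" by (simp add: coeff_deriv_def)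
  then show ?case using Suc by (auto simp: tame_zero)
qed (simp add: tame_zero)

lemma smooth_upto_sum:
  "(\<And>i. i \<in> A \<Longrightarrow> smooth_upto I j (f i)) \<Longrightarrow> smooth_upto I j (\<lambda>t k. \<Sum>i\<in>A. f i t k)"
  by (induction A rule: infinite_finite_induct) (auto simp: smooth_upto_zero intro!: smooth_upto_add)

lemma smooth_upto_duhamel:
  assumes f: "tame (time_ivl T) f"
  shows "smooth_upto (time_ivl T) 1 (duhamel f)"
proof -
  show ?thesis
    using coeff_deriv_duhamel[of T f, OF tame_cont[OF f]] tame_duhamel[OF f]
      tame_add[OF tame_laplace[OF tame_duhamel[OF f]] f] by auto
qed

text \<open>Each term is a sum of Duhamel integrals of products of earlier ones.\<close>

lemma smooth_upto_expansion:
  assumes us: "us \<in> Sob_inf"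
  shows "smooth_upto (time_ivl T) 1 (expansion us j)"
proof (induction j rule: less_induct)
  case (less j)
  show ?case
  proof (cases j)
    case 0
    then have eq: "expansion us j = (\<lambda>t. heat t us)" by auto
    have "smooth_upto (time_ivl T) (Suc 0) (\<lambda>t. heat t us)"
      unfolding smooth_upto.simps
      by (intro conjI exI[of _ "\<lambda>t. laplace (heat t us)"] coeff_deriv_heat tame_laplace tame_heat us)
    then show ?thesis by (simp only: eq One_nat_def)
  next
    case (Suc i)
    have tame: "tame (time_ivl T) (expansion us l)" if "l < Suc i" for l
      by (rule smooth_upto_tame[OF less.IH[of l]]) (use Suc that in simp)
    have "tame (time_ivl T) (\<lambda>s. NSP (expansion us l s) (expansion us (Suc i - l - 1) s))" if "l < Suc i" for l
      by (intro tame_NSP tame) (use that in simp_all)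
    then have "smooth_upto (time_ivl T) 1 (\<lambda>t k. \<Sum>l<Suc i.
        duhamel (\<lambda>s. NSP (expansion us l s) (expansion us (Suc i - l - 1) s)) t k)"
      by (intro smooth_upto_sum smooth_upto_duhamel) (simp only: lessThan_iff)
    moreover have "expansion us j = (\<lambda>t k. \<Sum>l<Suc i.
        duhamel (\<lambda>s. NSP (expansion us l s) (expansion us (Suc i - l - 1) s)) t k)"
      by (intro ext) (simp only: Suc duhamel_def expansion.simps)
    ultimately show ?thesis by (simp only:)
  qed
qed

lemma smooth_upto_partial_expansion:
  assumes "us \<in> Sob_inf"
  shows "smooth_upto (time_ivl T) 1 (partial_expansion R us N)"
  unfolding partial_expansion_def [abs_def]
  by (intro smooth_upto_sum smooth_upto_scaleR smooth_upto_expansion assms)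

lemma partial_expansion_zero: "partial_expansion R us N 0 = us"
proof
  fix k
  have "expansion us j 0 k = (if j = 0 then us k else 0)" for j
    by (cases j) (simp_all add: heat_def field_integral_def del: sum.lessThan_Suc)
  then have "partial_expansion R us N 0 k = (\<Sum>j\<le>N. if j = 0 then us k else 0)"
    unfolding partial_expansion_def by (intro sum.cong) auto
  then show "partial_expansion R us N 0 k = us k" by simp
qed

text \<open>The choice operator in the definition of the time derivative finds a witness.\<close>

lemma has_time_derivative_partial_expansion:
  assumes "us \<in> Sob_inf" "0 \<le> t"
  shows "has_time_derivative (partial_expansion R us N)
    (time_derivative {0..} (partial_expansion R us N) t) t {0..}"
proof -
  obtain g where "coeff_deriv (time_ivl \<infinity>) (partial_expansion R us N) g" "tame (time_ivl \<infinity>) g"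
    "tame (time_ivl \<infinity>) (partial_expansion R us N)"
    using smooth_upto_partial_expansion[OF assms(1), of \<infinity>] by auto
  then have "has_time_derivative (partial_expansion R us N) (g t) t {0..}"
    using has_time_derivative_tame[of \<infinity>] assms(2) by (simp add: time_ivl_infinity)
  then show ?thesis unfolding time_derivative_def
    by (rule someI[of "\<lambda>D. has_time_derivative (partial_expansion R us N) D t {0..}"])
qed

section \<open>The control inequality\<close>

text \<open>It suffices that the differential inequality holds where \<open>z\<close> is positive: going back from a
  point with \<open>z > 0\<close> to the last zero, \<open>z\<close> times the integrating factor cannot have increased.\<close>

lemma Gronwall_nonpos:
  fixes z b :: "real \<Rightarrow> real"
  assumes z: "continuous_on (time_ivl T) z" and b: "continuous_on (time_ivl T) b" and z0: "z 0 \<le> 0"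
    and deriv: "\<And>t. t \<in> time_ivl T \<Longrightarrow> z t > 0 \<Longrightarrow>
      \<exists>z'. (z has_real_derivative z') (at t within time_ivl T) \<and> z' \<le> b t * z t"
    and t: "t \<in> time_ivl T"
  shows "z t \<le> 0"
proof (rule ccontr)
  assume "\<not> z t \<le> 0"
  then have zt: "z t > 0" by simp
  let ?I = "time_ivl T"
  have sub: "{0..t} \<subseteq> ?I" by (rule atLeastAtMost_subset_time_ivl[OF t])
  have zc: "continuous_on {0..t} z" and bc: "continuous_on {0..t} b"
    using continuous_on_subset[OF z sub] continuous_on_subset[OF b sub] .
  define S where "S = {s \<in> {0..t}. z s \<le> 0}"
  have S: "compact S" "S \<noteq> {}"
  proof -
    have "S = {0..t} \<inter> z -` {..0}" by (auto simp: S_def)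
    then have "closed S"
      using continuous_closed_preimage[OF zc closed_atLeastAtMost closed_atMost] by (simp only:)
    moreover have "bounded S"
      by (rule bounded_subset[OF bounded_closed_interval[of 0 t]]) (auto simp: S_def)
    ultimately show "compact S" by (simp add: compact_eq_bounded_closed)
    show "S \<noteq> {}" using z0 time_ivl_nonneg[OF t] unfolding S_def by auto
  qed
  obtain t0 where t0: "t0 \<in> S" "\<And>s. s \<in> S \<Longrightarrow> s \<le> t0"
    using compact_attains_sup[OF S] by blast
  have t0t: "0 \<le> t0" "t0 < t" "z t0 \<le> 0"
    using t0(1) zt by (auto simp: S_def order.order_iff_strict)
  have pos: "z s > 0" if "t0 < s" "s \<le> t" for s
    using t0(2)[of s] that t0t(1) by (fastforce simp: S_def)
  \<comment> \<open>The integrating factor turns the inequality into monotonicity.\<close>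
  define y where "y = (\<lambda>s. z s * exp (- integral {0..s} b))"
  have yc: "continuous_on {t0..t} y"
    unfolding y_def using t0t
    by (intro continuous_intros continuous_on_subset[OF zc]
        continuous_on_subset[OF indefinite_integral_continuous_1[OF integrable_continuous_interval[OF bc]]]) auto
  have "y t \<le> y t0"
  proof (rule DERIV_nonpos_imp_decreasing_open[OF less_imp_le[OF t0t(2)] _ yc])
    fix s assume s: "t0 < s" "s < t"
    have sI: "s \<in> ?I" using s t0t sub by auto
    have at: "at s within {0..t} = at s"
      using s t0t by (intro at_within_interior) auto
    have at': "at s within ?I = at s"
    proof -
      have "s \<in> interior ?I" using interior_mono[OF sub] s t0t by auto
      then show ?thesis by (rule at_within_interior)
    qed
    obtain z' where z': "(z has_real_derivative z') (at s)" "z' \<le> b s * z s"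
      using deriv[OF sI pos] s at' by auto
    have B: "((\<lambda>s. integral {0..s} b) has_real_derivative b s) (at s)"
      using integral_has_real_derivative[OF bc, of s] s t0t at by auto
    have "(y has_real_derivative (z' - b s * z s) * exp (- integral {0..s} b)) (at s)"
      unfolding y_def
      by (rule derivative_eq_intros z'(1) B refl)+ (simp add: algebra_simps)
    moreover have "(z' - b s * z s) * exp (- integral {0..s} b) \<le> 0"
      using z'(2) by (intro mult_nonpos_nonneg) auto
    ultimately show "\<exists>y'. (y has_real_derivative y') (at s) \<and> y' \<le> 0" by blast
  qed
  moreover have "y t0 \<le> 0" unfolding y_def using t0t by (intro mult_nonpos_nonneg) auto
  moreover have "y t > 0" unfolding y_def using zt by simp
  ultimately show False by linarith
qed

lemma continuous_on_sob_norm: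
  assumes w: "\<And>t. t \<in> I \<Longrightarrow> has_time_derivative w (D t) t I"
  shows "continuous_on I (\<lambda>t. sob_norm n (w t))"
  unfolding sob_norm_def
  by (rule continuous_on_real_sqrt[OF DERIV_continuous_on[OF has_derivative_sob_inner[OF w]]])

text \<open>Where the norm exceeds \<open>r \<ge> 0\<close> it is positive, hence differentiable as the square root of the squared
  norm.  Divided by \<open>N\<close>, the last hypothesis becomes \<open>(N - r)' \<le> b (N - r)\<close> there.\<close>

lemma norm_control:
  fixes w :: "real \<Rightarrow> ('d::finite) field" and r :: "real \<Rightarrow> real"
  assumes w: "\<And>t. t \<in> time_ivl T \<Longrightarrow> has_time_derivative w (D t) t (time_ivl T)"
    and w0: "sob_norm n (w 0) \<le> r 0"
    and r: "\<And>t. t \<in> time_ivl T \<Longrightarrow> (r has_real_derivative r' t) (at t within time_ivl T)"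
    and r_nonneg: "\<And>t. t \<in> time_ivl T \<Longrightarrow> 0 \<le> r t"
    and b: "continuous_on (time_ivl T) b"
    and ineq: "\<And>t N. t \<in> time_ivl T \<Longrightarrow> N = sob_norm n (w t) \<Longrightarrow> r t < N \<Longrightarrow>
      sob_inner n (D t) (w t) \<le> N * (r' t + b t * (N - r t))"
    and t: "t \<in> time_ivl T"
  shows "sob_norm n (w t) \<le> r t"
proof -
  let ?I = "time_ivl T"
  let ?N = "\<lambda>t. sob_norm n (w t)"
  have wS: "w t \<in> Sob_inf" if "t \<in> ?I" for t
    using w[OF that] that by (simp add: has_time_derivative_def)
  have der: "((\<lambda>s. sob_inner n (w s) (w s)) has_real_derivative 2 * sob_inner n (D t) (w t)) (at t within ?I)" if "t \<in> ?I" for t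
    by (rule has_derivative_sob_inner[OF w[OF that] that])
  have contN: "continuous_on ?I ?N" by (rule continuous_on_sob_norm[OF w])
  have contr: "continuous_on ?I r"
    by (rule DERIV_continuous_on[OF r])
  have "?N t - r t \<le> 0"
  proof (rule Gronwall_nonpos[where z = "\<lambda>t. ?N t - r t", OF _ b _ _ t])
    show "continuous_on ?I (\<lambda>t. ?N t - r t)" by (intro continuous_on_diff contN contr)
    show "?N 0 - r 0 \<le> 0" using w0 by simp
    fix t assume t: "t \<in> ?I" and pos: "?N t - r t > 0"
    then have N: "?N t > 0" "r t < ?N t" using r_nonneg[OF t] by auto
    have N2: "sob_inner n (w t) (w t) > 0"
      using N(1) unfolding sob_norm_def by simp
    have "(?N has_real_derivative (2 * sob_inner n (D t) (w t)) * (inverse (?N t) / 2)) (at t within ?I)"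
      unfolding sob_norm_def
      by (rule DERIV_chain2[OF DERIV_real_sqrt[OF N2] der[OF t], unfolded mult.commute[of "inverse _ / 2"]])
    then have dN: "(?N has_real_derivative sob_inner n (D t) (w t) / ?N t) (at t within ?I)"
      using N(1) by (simp add: field_simps)
    have "sob_inner n (D t) (w t) / ?N t \<le> r' t + b t * (?N t - r t)"
      using ineq[OF t refl N(2)] N(1) by (simp add: divide_le_eq mult.commute)
    then have "sob_inner n (D t) (w t) / ?N t - r' t \<le> b t * (?N t - r t)" by linarith
    then show "\<exists>z'. ((\<lambda>t. ?N t - r t) has_real_derivative z') (at t within ?I) \<and> z' \<le> b t * (?N t - r t)"
      using DERIV_diff[OF dN r[OF t]] by blast
  qed
  then show ?thesis by simp
qed

lemma time_ivl_linear_nonneg: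
  fixes r a e :: "real \<Rightarrow> real"
  assumes r: "\<And>t. t \<in> time_ivl T \<Longrightarrow> (r has_real_derivative a t * r t + e t) (at t within time_ivl T)"
    and a: "continuous_on (time_ivl T) a" and e: "\<And>t. t \<in> time_ivl T \<Longrightarrow> 0 \<le> e t" and r0: "0 \<le> r 0"
    and t: "t \<in> time_ivl T"
  shows "0 \<le> r t"
proof -
  have cont: "continuous_on (time_ivl T) r" by (rule DERIV_continuous_on[OF r])
  have "- r t \<le> 0"
  proof (rule Gronwall_nonpos[where z = "\<lambda>t. - r t", OF _ a _ _ t])
    show "continuous_on (time_ivl T) (\<lambda>t. - r t)"
      by (rule continuous_on_minus[OF cont])
    fix t assume t: "t \<in> time_ivl T"
    have "((\<lambda>t. - r t) has_real_derivative - (a t * r t + e t)) (at t within time_ivl T)"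
      by (rule DERIV_minus[OF r[OF t]])
    moreover have "- (a t * r t + e t) \<le> a t * - r t" using e[OF t] by simp
    ultimately show "\<exists>z'. ((\<lambda>t. - r t) has_real_derivative z') (at t within time_ivl T) \<and> z' \<le> a t * - r t"
      by blast
  next
    show "- r 0 \<le> 0" using r0 by simp
  qed
  then show ?thesis by simp
qed

subsection \<open>Signs of the constants\<close>

text \<open>The basic inequalities force their constants to be nonnegative once some field has positive norms;
  nonnegativity is what allows norms of the approximate solution to be replaced by their bounds.  The field is a pair of
  modes with wave vectors \<open>\<plusminus>e\<close>, polarised orthogonally to \<open>e\<close>, for which at least two dimensions are needed.\<close>

lemma exists_nonzero_field:
  assumes "CARD('d::finite) \<ge> 2"
  shows "\<exists>v :: 'd field. v \<in> Sob_inf \<and> (\<forall>n. 0 < sob_norm n v)"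
proof -
  obtain r s :: 'd where rs: "r \<noteq> s"
    using assms card_le_Suc0_iff_eq[of "UNIV :: 'd set"] by force
  define e where "e = (axis r 1 :: int ^ 'd)"
  define v where "v = (\<lambda>k. if k = e \<or> k = - e then axis s 1 else 0 :: complex ^ 'd)"
  have e: "e \<noteq> 0" by (auto simp: e_def vec_eq_iff axis_def)
  have "adm v"
    unfolding adm_def div_free_iff_kdot
  proof (intro conjI allI)
    fix k
    show "cnjv (v k) = v (- k)"
      by (auto simp: v_def cnjv_def vec_eq_iff axis_def minus_equation_iff)
    have "kdot k (v k) = of_int (k $ s) * v k $ s"
      unfolding kdot_def using rs
      by (subst sum.remove[of _ s]) (auto simp: v_def axis_def intro!: sum.neutral)
    also have "\<dots> = 0" using rs by (auto simp: v_def e_def axis_def)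
    finally show "kdot k (v k) = 0" .
    show "v 0 = 0" using e by (simp add: v_def)
  qed
  moreover have "decay q (wt e ^ q) v" for q
    by (auto simp: decay_def v_def)
  ultimately have vS: "v \<in> Sob_inf" unfolding Sob_inf_iff by blast
  have "0 < sob_norm n v" for n
  proof -
    have "0 < sweight n e * (v e \<bullet> v e)"
      using e by (simp add: sweight_def v_def inner_axis_axis)
    also have "\<dots> \<le> sob_inner n v v"
      using finite_sum_le_has_sum[OF has_sum_sob_inner[OF vS vS, of n], of "{e}"] e by simp
    finally show ?thesis by (simp add: sob_norm_def)
  qed
  then show ?thesis using vS by blast
qed

lemma K_const_nonneg:
  assumes "CARD('d::finite) \<ge> 2" "K_const TYPE('d) n K"
  shows "0 \<le> K"
proof -
  obtain v :: "'d field" where v: "v \<in> Sob_inf" "\<And>n. 0 < sob_norm n v"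
    using exists_nonzero_field[OF assms(1)] by blast
  have "0 \<le> sob_norm n (NSP v v)" by (intro sob_norm_nonneg Sob_inf_NSP v)
  also have "\<dots> \<le> K * (sob_norm n v * sob_norm (n + 1) v)"
    using assms(2) Sob_inf_Sob[OF v(1)] by (simp add: K_const_def mult.assoc)
  finally show ?thesis using mult_pos_pos[OF v(2) v(2), of n "n + 1"] by (simp add: zero_le_mult_iff)
qed

lemma G_const_nonneg:
  assumes "CARD('d::finite) \<ge> 2" "G_const TYPE('d) n G"
  shows "0 \<le> G"
proof -
  obtain v :: "'d field" where v: "v \<in> Sob_inf" "\<And>n. 0 < sob_norm n v"
    using exists_nonzero_field[OF assms(1)] by blast
  have "0 \<le> \<bar>sob_inner n (NSP v v) v\<bar>" by simp
  also have "\<dots> \<le> G * (sob_norm n v * (sob_norm n v)\<^sup>2)"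
    using assms(2) Sob_inf_Sob[OF v(1)] unfolding G_const_def mult.assoc by blast
  finally show ?thesis using mult_pos_pos[OF v(2)[of n] zero_less_power[OF v(2)[of n], of 2]]
    by (simp only: zero_le_mult_iff) linarith
qed

subsection \<open>The energy inequality for the difference from an approximate solution\<close>

text \<open>With \<open>w = u - f\<close>, the equation for \<open>u\<close> reads
  \<open>w' = \<Delta> w + R (P(f, w) + P(w, f) + P(w, w)) - e\<close>, \<open>e\<close> being the residual of \<open>f\<close>.  In the second
  term the derivative falls on \<open>f\<close>, which is why one more order of regularity of \<open>f\<close> enters.\<close>

lemma energy_inequality:
  fixes u f :: "('d::finite) field"
  assumes card: "CARD('d) \<ge> 2" and K: "K_const TYPE('d) n K" and G: "G_const TYPE('d) n G" and R: "R > 0"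
    and u: "u \<in> Sob_inf" and f: "f \<in> Sob_inf" and f': "f' \<in> Sob_inf"
    and D: "sob_norm n f \<le> D" and D1: "sob_norm (n + 1) f \<le> D1"
    and e: "sob_norm n (\<lambda>k. f' k - laplace f k - R *\<^sub>R NSP f f k) \<le> e"
    and N: "N = sob_norm n (\<lambda>k. u k - f k)"
    and self: "sob_inner n (NSP (\<lambda>k. u k - f k) (\<lambda>k. u k - f k)) (\<lambda>k. u k - f k) \<le> c * N\<^sup>2"
  shows "sob_inner n (\<lambda>k. NS_rhs R u k - f' k) (\<lambda>k. u k - f k) \<le>
    N * (- N + R * (G * D + K * D1 + c) * N + e)"
proof -
  define w where "w = (\<lambda>k. u k - f k)"
  define err where "err = (\<lambda>k. f' k - laplace f k - R *\<^sub>R NSP f f k)"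
  have w: "w \<in> Sob_inf" unfolding w_def by (intro Sob_inf_diff u f)
  have err: "err \<in> Sob_inf"
    unfolding err_def by (intro Sob_inf_diff Sob_inf_scaleR Sob_inf_NSP Sob_inf_laplace f f')
  have N0: "0 \<le> N" using w by (simp add: N w_def[symmetric] sob_norm_nonneg)
  define Q where "Q = (\<lambda>k. NSP f w k + NSP w f k + NSP w w k)"
  have Q: "Q \<in> Sob_inf" unfolding Q_def by (intro Sob_inf_add Sob_inf_NSP f w)
  have NSPu: "NSP u u k = NSP f f k + Q k" for k
  proof -
    have "u = (\<lambda>k. f k + w k)" by (auto simp: w_def)
    then have "NSP u u k = NSP (\<lambda>k. f k + w k) (\<lambda>k. f k + w k) k" by simp
    then show ?thesis
      using Sob_inf_div_free[OF f] Sob_inf_div_free[OF w] Sob_inf_wiener[OF f] Sob_inf_wiener[OF w]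
      by (simp add: NSP_add_left NSP_add_right wiener_add Q_def)
  qed
  have rhs: "(\<lambda>k. NS_rhs R u k - f' k) = (\<lambda>k. (laplace w k + R *\<^sub>R Q k) - err k)"
    by (auto simp: NS_rhs_def NSPu err_def w_def laplace_def algebra_simps)
  have "sob_inner n (\<lambda>k. NS_rhs R u k - f' k) w =
      sob_inner n (laplace w) w + R * (sob_inner n (NSP f w) w + sob_inner n (NSP w f) w + sob_inner n (NSP w w) w)
        - sob_inner n err w"
    unfolding rhs
    by (simp only: sob_inner_diff_left sob_inner_add_left sob_inner_scaleR_left Sob_inf_add Sob_inf_scaleR
        Sob_inf_laplace w Q err) (simp add: Q_def sob_inner_add_left Sob_inf_add Sob_inf_NSP f w)
  also have "\<dots> \<le> - N\<^sup>2 + R * (G * D * N\<^sup>2 + K * D1 * N\<^sup>2 + c * N\<^sup>2) + e * N"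
  proof -
    have 1: "sob_inner n (laplace w) w \<le> - N\<^sup>2"
      using sob_inner_laplace_le[OF w, of n] by (simp add: N w_def[symmetric])
    have "\<bar>sob_inner n (NSP f w) w\<bar> \<le> G * sob_norm n f * N\<^sup>2"
      using G Sob_inf_Sob[OF f] Sob_inf_Sob[OF w] unfolding G_const_def N w_def[symmetric] by blast
    also have "\<dots> \<le> G * D * N\<^sup>2"
      using G_const_nonneg[OF card G] D by (intro mult_right_mono mult_left_mono) auto
    finally have 2: "sob_inner n (NSP f w) w \<le> G * D * N\<^sup>2" by simp
    have "sob_inner n (NSP w f) w \<le> sob_norm n (NSP w f) * N"
      using sob_Cauchy_Schwarz[OF Sob_inf_NSP[OF w f] w, of n] by (simp add: N w_def[symmetric])
    also have "\<dots> \<le> (K * N * sob_norm (n + 1) f) * N"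
      using K Sob_inf_Sob[OF f] Sob_inf_Sob[OF w] N0 unfolding K_const_def N w_def[symmetric]
      by (intro mult_right_mono) auto
    also have "\<dots> \<le> (K * N * D1) * N"
      using K_const_nonneg[OF card K] N0 D1 by (intro mult_right_mono mult_left_mono mult_nonneg_nonneg) auto
    finally have 3: "sob_inner n (NSP w f) w \<le> K * D1 * N\<^sup>2" by (simp add: power2_eq_square mult_ac)
    have "- sob_inner n err w \<le> sob_norm n err * N"
      using sob_Cauchy_Schwarz[OF err w, of n] by (simp add: N w_def[symmetric])
    also have "\<dots> \<le> e * N" using e N0 by (intro mult_right_mono) (simp_all add: err_def)
    finally have 4: "- sob_inner n err w \<le> e * N" .
    have "R * (sob_inner n (NSP f w) w + sob_inner n (NSP w f) w + sob_inner n (NSP w w) w) \<le>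
        R * (G * D * N\<^sup>2 + K * D1 * N\<^sup>2 + c * N\<^sup>2)"
      using 2 3 self R by (intro mult_left_mono) (auto simp: w_def)
    with 1 4 show ?thesis by linarith
  qed
  also have "\<dots> = N * (- N + R * (G * D + K * D1 + c) * N + e)"
    by (simp add: power2_eq_square algebra_simps)
  finally show ?thesis by (simp add: w_def)
qed

section \<open>Regularity of solutions with bounded \<open>\<ell>\<^sup>1\<close> norm\<close>

text \<open>The right hand side of Duhamel's formula for the Navier-Stokes equation.\<close>

definition mild :: "real \<Rightarrow> ('d::finite) field \<Rightarrow> (real \<Rightarrow> 'd field) \<Rightarrow> real \<Rightarrow> 'd field" where
  "mild R us v t = (\<lambda>k. heat t us k + R *\<^sub>R duhamel (\<lambda>s. NSP (v s) (v s)) t k)"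

text \<open>Integrability comes with the fundamental theorem of calculus; continuity of \<open>f\<close> in time is not known
  at the stage where this is applied to the nonlinearity.\<close>

lemma has_integral_integrating_factor:
  fixes u f :: "real \<Rightarrow> ('d::finite) field" and k :: "int ^ 'd"
  assumes deriv: "coeff_deriv (time_ivl T) u (\<lambda>t k. laplace (u t) k + f t k)" and t: "t \<in> time_ivl T"
  defines "c \<equiv> (norm (wvec k))\<^sup>2"
  shows "((\<lambda>s. exp (s * c) *\<^sub>R f s k) has_integral exp (t * c) *\<^sub>R u t k - u 0 k) {0..t}"
proof -
  have "((\<lambda>s. exp (s * c) *\<^sub>R f s k) has_integral exp (t * c) *\<^sub>R u t k - exp (0 * c) *\<^sub>R u 0 k) {0..t}"
  proof (rule fundamental_theorem_of_calculus)
    show "0 \<le> t" using t by (rule time_ivl_nonneg)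
    fix s assume s: "s \<in> {0..t}"
    have sub: "{0..t} \<subseteq> time_ivl T" by (rule atLeastAtMost_subset_time_ivl[OF t])
    have "((\<lambda>s. u s k) has_vector_derivative laplace (u s) k + f s k) (at s within {0..t})"
      using deriv s sub unfolding coeff_deriv_def by (blast intro: has_vector_derivative_within_subset)
    then have "((\<lambda>s. exp (s * c) *\<^sub>R u s k) has_vector_derivative
        exp (s * c) *\<^sub>R (laplace (u s) k + f s k) + (c * exp (s * c)) *\<^sub>R u s k) (at s within {0..t})"
      by (rule has_vector_derivative_scaleR[rotated]) (auto intro!: derivative_eq_intros)
    then show "((\<lambda>s. exp (s * c) *\<^sub>R u s k) has_vector_derivative exp (s * c) *\<^sub>R f s k) (at s within {0..t})"
      by (simp add: laplace_def c_def scaleR_add_right scaleR_diff_right mult.commute)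
  qed
  then show ?thesis by simp
qed

text \<open>The heat kernel with decay rate \<open>c\<close> integrates to at most \<open>1 / c\<close>.\<close>

lemma norm_integrating_factor_le:
  fixes g :: "real \<Rightarrow> 'a::euclidean_space"
  assumes g: "((\<lambda>s. exp (s * c) *\<^sub>R g s) has_integral J) {0..t}" and B: "\<And>s. s \<in> {0..t} \<Longrightarrow> norm (g s) \<le> B"
    and "0 < c" "0 \<le> t"
  shows "norm (exp (- t * c) *\<^sub>R J) \<le> B / c"
proof -
  have B0: "0 \<le> B" by (rule order_trans[OF norm_ge_zero B[of 0]]) (use assms(4) in simp)
  have h: "((\<lambda>s. exp (s * c) * B) has_integral exp (t * c) * B / c - exp (0 * c) * B / c) {0..t}"
  proof (rule fundamental_theorem_of_calculus)
    fix s
    show "((\<lambda>s. exp (s * c) * B / c) has_vector_derivative exp (s * c) * B) (at s within {0..t})"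
      using assms(3) unfolding has_real_derivative_iff_has_vector_derivative[symmetric]
      by (auto intro!: derivative_eq_intros)
  qed (use assms in auto)
  have "norm J \<le> exp (t * c) * B / c - exp (0 * c) * B / c"
  proof -
    have "norm (integral {0..t} (\<lambda>s. exp (s * c) *\<^sub>R g s)) \<le> integral {0..t} (\<lambda>s. exp (s * c) * B)"
      by (rule integral_norm_bound_integral[OF has_integral_integrable[OF g] has_integral_integrable[OF h]])
        (simp add: B)
    then show ?thesis unfolding integral_unique[OF g] integral_unique[OF h] .
  qed
  also have "\<dots> \<le> exp (t * c) * B / c" using B0 assms(3) by simp
  finally have "exp (- t * c) * norm J \<le> exp (- t * c) * (exp (t * c) * B / c)"
    by (rule mult_left_mono) simp
  also have "\<dots> = B / c" by (simp add: exp_minus)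
  finally show ?thesis by simp
qed

text \<open>If the \<open>\<ell>\<^sup>1\<close> norms stay bounded, each power of the weight costs one use of the equation: the
  nonlinearity loses a factor \<open>|k|\<close>, time integration of the heat kernel gains \<open>|k|\<^sup>-\<^sup>2\<close>.\<close>

lemma decay_bootstrap:
  fixes u :: "real \<Rightarrow> ('d::finite) field"
  assumes deriv: "coeff_deriv (time_ivl T) u (\<lambda>t. NS_rhs R (u t))" and u0: "u 0 \<in> Sob_inf"
    and J: "J \<subseteq> time_ivl T" "\<And>s t. t \<in> J \<Longrightarrow> 0 \<le> s \<Longrightarrow> s \<le> t \<Longrightarrow> s \<in> J"
    and u: "\<And>t. t \<in> J \<Longrightarrow> adm (u t)" "\<And>t. t \<in> J \<Longrightarrow> wiener (u t)" and A: "\<And>t. t \<in> J \<Longrightarrow> l1 (u t) \<le> A"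
    and R: "R > 0"
  shows "\<exists>C. \<forall>t\<in>J. decay q C (u t)"
proof (cases "J = {}")
  case False
  then have A0: "0 \<le> A" using A l1_nonneg order_trans by blast
  show ?thesis
  proof (induction q)
    case 0
    have "decay 0 A (u t)" if "t \<in> J" for t
      using norm_le_l1[OF u(2)[OF that]] A[OF that] by (auto simp: decay_def intro: order_trans)
    then show ?case by blast
  next
    case (Suc q)
    then obtain C where C: "\<And>t. t \<in> J \<Longrightarrow> decay q C (u t)" by blast
    have C0: "0 \<le> C" using C False decay_nonneg by blast
    obtain C1 where C1: "decay (Suc q) C1 (u 0)" using u0 by (auto simp: Sob_inf_iff)
    define E where "E = 2 * (R * (2 * 2 ^ q * (2 * C * A)))"
    have "decay (Suc q) (C1 + E) (u t)" if t: "t \<in> J" for t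
      unfolding decay_def
    proof
      fix k :: "int ^ 'd"
      show "wt k ^ Suc q * norm (u t k) \<le> C1 + E"
      proof (cases "k = 0")
        case True
        have "0 \<le> E" unfolding E_def using R C0 A0 by simp
        then show ?thesis using u(1)[OF t] decay_nonneg[OF C1] True by (simp add: adm_def)
      next
        case False
        define \<kappa> where "\<kappa> = norm (wvec k)"
        have \<kappa>: "1 \<le> \<kappa>" using norm_wvec_ge_1[OF False] by (simp add: \<kappa>_def)
        define B where "B = R * (2 * \<kappa> * 2 ^ q * (2 * C * A)) / wt k ^ q"
        have B: "norm (R *\<^sub>R NSP (u s) (u s) k) \<le> B" if "s \<in> {0..t}" for s
        proof -
          have s: "s \<in> J" using J(2)[OF t, of s] that by auto
          have "wt k ^ q * norm (NSP (u s) (u s) k) \<le> 2 * \<kappa> * 2 ^ q * (C * l1 (u s) + l1 (u s) * C)"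
            unfolding \<kappa>_def using u[OF s] C[OF s] by (intro weighted_norm_NSP_le) (auto simp: adm_def)
          also have "\<dots> \<le> 2 * \<kappa> * 2 ^ q * (C * A + A * C)"
            using \<kappa> C0 A[OF s] by (intro mult_left_mono add_mono mult_right_mono) auto
          finally have "wt k ^ q * norm (NSP (u s) (u s) k) \<le> 2 * \<kappa> * 2 ^ q * (2 * C * A)"
            by (simp add: mult_ac)
          then have "norm (NSP (u s) (u s) k) \<le> 2 * \<kappa> * 2 ^ q * (2 * C * A) / wt k ^ q"
            by (simp add: pos_le_divide_eq mult.commute)
          from mult_left_mono[OF this, of R] show ?thesis using R by (simp add: B_def)
        qed
        have tI: "t \<in> time_ivl T" using J(1) t by auto
        have "((\<lambda>s. exp (s * \<kappa>\<^sup>2) *\<^sub>R (R *\<^sub>R NSP (u s) (u s) k)) has_integral exp (t * \<kappa>\<^sup>2) *\<^sub>R u t k - u 0 k) {0..t}"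
          unfolding \<kappa>_def
          by (rule has_integral_integrating_factor[OF deriv[unfolded NS_rhs_def] tI])
        from norm_integrating_factor_le[OF this B] \<kappa> time_ivl_nonneg[OF tI]
        have "norm (exp (- t * \<kappa>\<^sup>2) *\<^sub>R (exp (t * \<kappa>\<^sup>2) *\<^sub>R u t k - u 0 k)) \<le> B / \<kappa>\<^sup>2"
          by simp
        then have "norm (u t k - heat t (u 0) k) \<le> B / \<kappa>\<^sup>2"
          by (simp add: scaleR_diff_right heat_def \<kappa>_def flip: exp_add)
        then have "norm (u t k) \<le> norm (heat t (u 0) k) + B / \<kappa>\<^sup>2"
          using norm_triangle_ineq[of "heat t (u 0) k" "u t k - heat t (u 0) k"] by simp
        then have "wt k ^ Suc q * norm (u t k) \<le> wt k ^ Suc q * norm (heat t (u 0) k) + wt k ^ Suc q * (B / \<kappa>\<^sup>2)"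
          unfolding distrib_left[symmetric] by (rule mult_left_mono) simp
        also have "wt k ^ Suc q * norm (heat t (u 0) k) \<le> C1"
          by (rule decayD[OF decay_heat[OF C1 time_ivl_nonneg[OF tI]]])
        also have "wt k ^ Suc q * (B / \<kappa>\<^sup>2) \<le> E"
        proof -
          have "wt k ^ Suc q * (B / \<kappa>\<^sup>2) = (wt k / \<kappa>) * (R * (2 * 2 ^ q * (2 * C * A)))"
            using \<kappa> by (simp add: B_def field_simps power2_eq_square)
          also have "\<dots> \<le> 2 * (R * (2 * 2 ^ q * (2 * C * A)))"
            using wt_le_twice_norm[OF False] \<kappa> R C0 A0
            by (intro mult_right_mono mult_nonneg_nonneg) (simp_all add: \<kappa>_def[symmetric] pos_divide_le_eq)
          finally show ?thesis by (simp add: E_def)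
        qed
        finally show ?thesis by simp
      qed
    qed
    then show ?case by blast
  qed
qed simp

lemma NS_solution_coeff_deriv:
  assumes "NS_solution R us T u"
  shows "coeff_deriv (time_ivl T) u (\<lambda>t. NS_rhs R (u t))"
  unfolding coeff_deriv_def
proof (intro ballI allI)
  fix t k assume t: "t \<in> time_ivl T"
  then have "has_time_derivative u (NS_rhs R (u t)) t (time_ivl T)"
    using assms by (simp add: NS_solution_def)
  from has_time_derivative_coeff[OF this t]
  show "((\<lambda>s. u s k) has_vector_derivative NS_rhs R (u t) k) (at t within time_ivl T)" .
qed

lemma NS_solution_Sob_inf: "NS_solution R us T u \<Longrightarrow> t \<in> time_ivl T \<Longrightarrow> u t \<in> Sob_inf"
  unfolding NS_solution_def has_time_derivative_def by blast

text \<open>Continuity of the Sobolev norm in time bounds the \<open>\<ell>\<^sup>1\<close> norms on compact intervals, and the bootstrap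
  gives uniform bounds of every order there.\<close>

lemma NS_solution_tame:
  fixes u :: "real \<Rightarrow> ('d::finite) field"
  assumes u: "NS_solution R us T u" and R: "R > 0" and us: "us \<in> Sob_inf"
  shows "tame (time_ivl T) u"
  unfolding tame_def
proof (intro conjI ballI allI)
  let ?I = "time_ivl T"
  show "adm (u t)" if "t \<in> ?I" for t
    by (rule Sob_inf_adm[OF NS_solution_Sob_inf[OF u that]])
  show "continuous_on ?I (\<lambda>t. u t k)" for k
    by (rule coeff_deriv_continuous[OF NS_solution_coeff_deriv[OF u]])
  fix b q assume b: "b \<in> ?I"
  define n where "n = real CARD('d) / 2 + 1"
  obtain c where c: "\<And>v :: 'd field. v \<in> Sob_inf \<Longrightarrow> l1 v \<le> c + (sob_norm n v)\<^sup>2"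
    using l1_le_sob_norm[of n, where 'd = 'd] by (auto simp: n_def)
  have der: "((\<lambda>s. sob_inner n (u s) (u s)) has_real_derivative 2 * sob_inner n (NS_rhs R (u t)) (u t)) (at t within ?I)"
    if "t \<in> ?I" for t
    using u that unfolding NS_solution_def by (intro has_derivative_sob_inner) blast+
  have sub: "{0..b} \<subseteq> ?I" by (rule atLeastAtMost_subset_time_ivl[OF b])
  have "compact ((\<lambda>s. sob_inner n (u s) (u s)) ` {0..b})"
    by (intro compact_continuous_image compact_Icc continuous_on_subset[OF DERIV_continuous_on[OF der] sub])
  then have "bounded ((\<lambda>s. sob_inner n (u s) (u s)) ` {0..b})" by (rule compact_imp_bounded)
  then obtain S where "\<forall>x\<in>(\<lambda>s. sob_inner n (u s) (u s)) ` {0..b}. norm x \<le> S"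
    unfolding bounded_iff by (elim exE)
  then have S: "\<bar>sob_inner n (u s) (u s)\<bar> \<le> S" if "s \<in> {0..b}" for s
    using that by simp
  have "\<exists>C. \<forall>t\<in>{0..b}. decay q C (u t)"
  proof (rule decay_bootstrap[OF NS_solution_coeff_deriv[OF u] _ sub])
    show "u 0 \<in> Sob_inf" using u us by (simp add: NS_solution_def)
    fix t assume t: "t \<in> {0..b}"
    then have uS: "u t \<in> Sob_inf" using sub NS_solution_Sob_inf[OF u] by blast
    show "adm (u t)" "wiener (u t)" using uS by (simp_all add: Sob_inf_adm Sob_inf_wiener)
    show "l1 (u t) \<le> c + S"
      using c[OF uS] abs_le_D1[OF S[OF t]] by (simp add: sob_norm_square uS)
  qed (use R in auto)
  then obtain C where C: "\<And>t. t \<in> {0..b} \<Longrightarrow> decay q C (u t)" by blast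
  show "\<exists>C. \<forall>t\<in>?I. t \<le> b \<longrightarrow> decay q C (u t)"
    by (intro exI[of _ C] ballI impI C) (simp add: time_ivl_nonneg)
qed

lemma NS_solution_mild:
  fixes u :: "real \<Rightarrow> ('d::finite) field"
  assumes u: "NS_solution R us T u" and t: "t \<in> time_ivl T"
  shows "u t = mild R us u t"
proof
  fix k :: "int ^ 'd"
  define c where "c = (norm (wvec k))\<^sup>2"
  have "((\<lambda>s. R *\<^sub>R exp (s * c) *\<^sub>R NSP (u s) (u s) k) has_integral exp (t * c) *\<^sub>R u t k - u 0 k) {0..t}"
    using has_integral_integrating_factor[OF NS_solution_coeff_deriv[OF u, unfolded NS_rhs_def] t, of k]
    by (simp add: c_def mult.commute)
  then have "R *\<^sub>R integral {0..t} (\<lambda>s. exp (s * c) *\<^sub>R NSP (u s) (u s) k) = exp (t * c) *\<^sub>R u t k - u 0 k"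
    by (simp only: integral_unique flip: integral_cmul)
  then have "exp (- t * c) *\<^sub>R R *\<^sub>R integral {0..t} (\<lambda>s. exp (s * c) *\<^sub>R NSP (u s) (u s) k) =
      u t k - exp (- t * c) *\<^sub>R u 0 k"
    by (simp add: scaleR_diff_right flip: exp_add)
  then show "u t k = mild R us u t k"
    using u by (simp add: mild_def duhamel_eq heat_def NS_solution_def c_def mult.commute)
qed

section \<open>Continuation of bounded solutions\<close>

text \<open>A kernel estimate: the time integral of \<open>|k| exp (- s |k|\<^sup>2)\<close> over an interval of length \<open>\<delta>\<close> is at
  most \<open>min (\<delta> |k|) (1 / |k|) \<le> sqrt \<delta>\<close>.\<close>

lemma min_le_sqrt:
  fixes x y b :: real
  assumes "0 < x" "0 \<le> y" "0 \<le> b" "z \<le> b * x * y" "z \<le> b * x / x\<^sup>2"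
  shows "z \<le> b * sqrt y"
proof (cases "x * sqrt y \<le> 1")
  case True
  have "x * y = (x * sqrt y) * sqrt y" using assms(2) by simp
  also have "\<dots> \<le> 1 * sqrt y" using True assms(2) by (intro mult_right_mono) auto
  finally have "b * (x * y) \<le> b * sqrt y" using assms(3) by (simp add: mult_left_mono)
  then show ?thesis using assms(4) by (simp add: mult.assoc)
next
  case False
  then have "1 / x \<le> sqrt y" using assms(1) by (simp add: field_simps)
  then have "b * (1 / x) \<le> b * sqrt y" using assms(3) by (rule mult_left_mono)
  then show ?thesis using assms(1,5) by (simp add: power2_eq_square)
qed

text \<open>Two bounds for the contribution of a source that vanishes before \<open>\<tau>\<close>: the first is small for short
  times, the second one for large wave vectors.\<close>

lemma norm_duhamel_late:
  fixes f :: "real \<Rightarrow> ('d::finite) field"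
  assumes cont: "continuous_on {0..t} (\<lambda>s. f s k)" and \<tau>: "0 \<le> \<tau>" "\<tau> \<le> t"
    and zero: "\<And>s. 0 \<le> s \<Longrightarrow> s < \<tau> \<Longrightarrow> f s k = 0" and B: "\<And>s. s \<in> {0..t} \<Longrightarrow> norm (f s k) \<le> B"
  shows "norm (duhamel f t k) \<le> B * (t - \<tau>)" and "k \<noteq> 0 \<Longrightarrow> norm (duhamel f t k) \<le> B / (norm (wvec k))\<^sup>2"
proof -
  define c where "c = (norm (wvec k))\<^sup>2"
  define g where "g = (\<lambda>s. exp (- (t - s) * c) *\<^sub>R f s k)"
  have B0: "0 \<le> B" by (rule order_trans[OF norm_ge_zero B[of 0]]) (use \<tau> in simp)
  have int: "g integrable_on {0..t}"
    unfolding g_def by (intro integrable_continuous_interval continuous_intros cont)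
  have "duhamel f t k = integral {0..t} g"
    by (simp add: duhamel_def field_integral_def heat_def g_def c_def)
  also have "\<dots> = integral {0..\<tau>} g + integral {\<tau>..t} g"
    using Henstock_Kurzweil_Integration.integral_combine[OF \<tau> int] by simp
  also have "integral {0..\<tau>} g = integral {0..\<tau>} (\<lambda>s. 0)"
    by (rule integral_spike[of "{\<tau>}"]) (auto simp: g_def zero)
  finally have eq: "duhamel f t k = integral {\<tau>..t} g" by simp
  have "norm (integral {\<tau>..t} g) \<le> integral {\<tau>..t} (\<lambda>s. B)"
  proof (rule integral_norm_bound_integral)
    show "g integrable_on {\<tau>..t}"
      by (rule integrable_subinterval_real[OF int]) (use \<tau> in auto)
    fix s assume s: "s \<in> {\<tau>..t}"
    have "exp (- (t - s) * c) \<le> 1"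
      using s by (auto simp: c_def intro: mult_nonpos_nonneg)
    then have "exp (- (t - s) * c) * norm (f s k) \<le> 1 * B"
      using s \<tau> by (intro mult_mono B) auto
    then show "norm (g s) \<le> B" by (simp add: g_def)
  qed auto
  then show "norm (duhamel f t k) \<le> B * (t - \<tau>)"
    using \<tau> by (simp add: eq mult.commute)
  assume k: "k \<noteq> 0"
  then have c: "0 < c" by (simp add: c_def)
  have "((\<lambda>s. exp (s * c) *\<^sub>R f s k) has_integral integral {0..t} (\<lambda>s. exp (s * c) *\<^sub>R f s k)) {0..t}"
    by (intro integrable_integral integrable_continuous_interval continuous_intros cont)
  from norm_integrating_factor_le[OF this B c]
  show "norm (duhamel f t k) \<le> B / (norm (wvec k))\<^sup>2"
    using \<tau> by (simp add: duhamel_eq c_def)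
qed

text \<open>The space in which the fixed point problem is solved: the weight \<open>(1 + |k|)\<^sup>d\<^sup>+\<^sup>2\<close> makes both
  the coefficients and their first derivatives summable.\<close>

definition curve_ball :: "real \<Rightarrow> real \<Rightarrow> (real \<Rightarrow> ('d::finite) field) \<Rightarrow> bool" where
  "curve_ball S B v \<longleftrightarrow> (\<forall>t\<in>{0..S}. adm (v t) \<and> decay (CARD('d) + 2) B (v t)) \<and>
     (\<forall>k. continuous_on {0..S} (\<lambda>t. v t k))"

text \<open>The constant of the product estimate in the weight \<open>q = d + 2\<close>, where the \<open>\<ell>\<^sup>1\<close> norms are controlled by the
  weighted bounds themselves.\<close>

definition product_const :: "('d::finite) itself \<Rightarrow> real" where
  "product_const _ = 4 * 2 ^ (CARD('d) + 2) * lattice_sum TYPE('d)"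

lemma product_const_nonneg: "0 \<le> product_const TYPE('d::finite)"
  by (simp add: product_const_def lattice_sum_def infsum_nonneg)

lemma decay_product:
  fixes v w :: "('d::finite) field"
  assumes "adm v" "decay (CARD('d) + 2) A v" "decay (CARD('d) + 2) B w"
  shows "wt k ^ (CARD('d) + 2) * norm (NSP v w k) \<le> norm (wvec k) * (product_const TYPE('d) * A * B)"
proof -
  have AB: "0 \<le> A" "0 \<le> B" using assms by (auto intro: decay_nonneg)
  have "wt k ^ (CARD('d) + 2) * norm (NSP v w k) \<le> 2 * norm (wvec k) * 2 ^ (CARD('d) + 2) * (A * l1 w + l1 v * B)"
    using assms by (intro weighted_norm_NSP_le decay_summable(1)[OF assms(2)] decay_summable(1)[OF assms(3)]) (simp_all add: adm_def)
  also have "\<dots> \<le> 2 * norm (wvec k) * 2 ^ (CARD('d) + 2) *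
      (A * (B * lattice_sum TYPE('d)) + (A * lattice_sum TYPE('d)) * B)"
    using AB by (intro mult_left_mono add_mono mult_right_mono decay_summable(2)[OF assms(2)] decay_summable(2)[OF assms(3)]) auto
  also have "\<dots> = norm (wvec k) * (product_const TYPE('d) * A * B)"
    by (simp add: product_const_def algebra_simps)
  finally show ?thesis .
qed

lemma curve_ball_mono:
  assumes "curve_ball S B v" "S' \<le> S" "B \<le> B'"
  shows "curve_ball S' B' v"
  using assms unfolding curve_ball_def
  by (auto intro: decay_mono continuous_on_subset)

lemma curve_ball_NSP_continuous:
  fixes v :: "real \<Rightarrow> ('d::finite) field"
  assumes v: "curve_ball S B v"
  shows "continuous_on {0..S} (\<lambda>t. NSP (v t) (v t) k)"
  unfolding continuous_on_def
proof
  fix t assume t: "t \<in> {0..S}"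
  have vb: "adm (v s)" "decay (CARD('d) + 2) B (v s)" if "s \<in> {0..S}" for s
    using v that by (auto simp: curve_ball_def)
  have lim: "((\<lambda>s. v s h) \<longlongrightarrow> v t h) (at t within {0..S})" for h
    using v t unfolding curve_ball_def continuous_on_def by blast
  have ev: "eventually (\<lambda>s. div_free (v s) \<and> decay (CARD('d) + 2) B (v s)) (at t within {0..S})"
    unfolding eventually_at_filter using vb by (intro always_eventually) (auto simp: adm_def)
  show "((\<lambda>s. NSP (v s) (v s) k) \<longlongrightarrow> NSP (v t) (v t) k) (at t within {0..S})"
  proof (rule tendsto_NSP[OF lim lim ev])
    show "eventually (\<lambda>s. decay (CARD('d) + 2) B (v s)) (at t within {0..S})"
      using ev by eventually_elim blast
    show "div_free (v t)" "wiener (v t)" "wiener (v t)"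
      using vb[OF t] decay_summable(1) by (auto simp: adm_def)
  qed
qed

lemma continuous_on_duhamel_Icc:
  assumes cont: "continuous_on {0..S} (\<lambda>t. f t k)"
  shows "continuous_on {0..S} (\<lambda>t. duhamel f t k)"
proof -
  have "(\<lambda>s. exp (s * (norm (wvec k))\<^sup>2) *\<^sub>R f s k) integrable_on {0..S}"
    by (intro integrable_continuous_interval continuous_intros cont)
  from indefinite_integral_continuous_1[OF this] show ?thesis
    unfolding duhamel_eq by (intro continuous_intros)
qed

lemma curve_ball_mild:
  fixes v :: "real \<Rightarrow> ('d::finite) field"
  assumes v: "curve_ball S B v" and us: "adm us"
  shows "t \<in> {0..S} \<Longrightarrow> adm (mild R us v t)" and "continuous_on {0..S} (\<lambda>t. mild R us v t k)"
proof -
  have cont: "continuous_on {0..S} (\<lambda>t. NSP (v t) (v t) k)" for k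
    by (rule curve_ball_NSP_continuous[OF v])
  show "adm (mild R us v t)" if t: "t \<in> {0..S}"
  proof -
    have "adm (duhamel (\<lambda>s. NSP (v s) (v s)) t)"
    proof (rule adm_duhamel)
      show "continuous_on {0..t} (\<lambda>t. NSP (v t) (v t) k)" for k
        by (rule continuous_on_subset[OF cont]) (use t in auto)
      fix s assume "s \<in> {0..t}"
      then have "adm (v s)" "decay (CARD('d) + 2) B (v s)" using v t by (auto simp: curve_ball_def)
      then show "adm (NSP (v s) (v s))" by (intro adm_NSP decay_summable(1))
    qed
    then show ?thesis unfolding mild_def by (intro adm_add adm_scaleR adm_heat us)
  qed
  show "continuous_on {0..S} (\<lambda>t. mild R us v t k)"
    unfolding mild_def heat_def by (intro continuous_intros continuous_on_duhamel_Icc cont)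
qed

lemma mild_cong:
  assumes "\<And>s. 0 \<le> s \<Longrightarrow> s \<le> t \<Longrightarrow> v s = w s"
  shows "mild R us v t = mild R us w t"
proof -
  have "duhamel (\<lambda>s. NSP (v s) (v s)) t k = duhamel (\<lambda>s. NSP (w s) (w s)) t k" for k
    unfolding duhamel_def field_integral_def by (rule integral_cong) (simp add: assms heat_def)
  then show ?thesis by (simp add: mild_def)
qed


text \<open>Interpolating between the two bounds, a source of size \<open>|k| B\<close> is integrated to \<open>B\<close> times the square
  root of the elapsed time: the derivative in the nonlinearity is recovered.\<close>

lemma decay_duhamel_late:
  fixes f :: "real \<Rightarrow> ('d::finite) field"
  assumes cont: "\<And>k. continuous_on {0..t} (\<lambda>s. f s k)" and \<tau>: "0 \<le> \<tau>" "\<tau> \<le> t"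
    and zero: "\<And>s k. 0 \<le> s \<Longrightarrow> s < \<tau> \<Longrightarrow> f s k = 0"
    and B: "\<And>s k. s \<in> {0..t} \<Longrightarrow> wt k ^ q * norm (f s k) \<le> norm (wvec k) * B"
  shows "decay q (B * sqrt (t - \<tau>)) (duhamel f t)" and "decay q B (duhamel f t)"
proof -
  have B0: "0 \<le> B"
  proof -
    define e :: "int ^ 'd" where "e = (\<chi> i. 1)"
    have "0 \<le> norm (wvec e) * B"
      by (rule order_trans[OF _ B[of 0 e]]) (use \<tau> in auto)
    moreover have "e \<noteq> 0" by (simp add: e_def vec_eq_iff)
    then have "0 < norm (wvec e)" using norm_wvec_ge_1[of e] by linarith
    ultimately show ?thesis by (simp add: zero_le_mult_iff)
  qed
  have *: "wt k ^ q * norm (duhamel f t k) \<le> B * sqrt (t - \<tau>) \<and> wt k ^ q * norm (duhamel f t k) \<le> B" for k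
  proof (cases "k = 0")
    case True
    then have "norm (f s k) \<le> 0" if "s \<in> {0..t}" for s
    proof -
      have "wt k ^ q * norm (f s k) \<le> 0" using B[OF that, of k] True by simp
      moreover have "0 < wt k ^ q" by simp
      ultimately show ?thesis by (simp only: mult_le_0_iff) linarith
    qed
    then have "norm (duhamel f t k) \<le> 0 * (t - \<tau>)"
      by (intro norm_duhamel_late(1)[where f = f and k = k and \<tau> = \<tau>]) (simp_all add: cont \<tau> zero)
    then have "duhamel f t k = 0" by simp
    then show ?thesis using B0 \<tau> by simp
  next
    case False
    define \<kappa> where "\<kappa> = norm (wvec k)"
    define W where "W = wt k ^ q"
    have \<kappa>: "1 \<le> \<kappa>" unfolding \<kappa>_def by (rule norm_wvec_ge_1[OF False])
    have W: "0 < W" by (simp add: W_def)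
    have bound: "norm (f s k) \<le> \<kappa> * B / W" if "s \<in> {0..t}" for s
      using B[OF that, of k] W by (simp add: pos_le_divide_eq mult.commute \<kappa>_def W_def)
    have late: "norm (duhamel f t k) \<le> \<kappa> * B / W * (t - \<tau>)"
      by (rule norm_duhamel_late(1)[where f = f and k = k and \<tau> = \<tau>]) (simp_all add: cont \<tau> zero bound)
    have late': "norm (duhamel f t k) \<le> \<kappa> * B / W / (norm (wvec k))\<^sup>2"
      by (rule norm_duhamel_late(2)[where f = f and k = k and \<tau> = \<tau>]) (simp_all add: cont \<tau> zero bound False)
    have 1: "W * norm (duhamel f t k) \<le> B * \<kappa> * (t - \<tau>)"
      using mult_left_mono[OF late, of W] W by (simp add: mult_ac)
    have 2: "W * norm (duhamel f t k) \<le> B * \<kappa> / \<kappa>\<^sup>2"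
      using mult_left_mono[OF late', of W] W by (simp add: mult_ac \<kappa>_def)
    also have "\<dots> \<le> B" using \<kappa> mult_left_mono[OF \<kappa> B0] by (simp add: power2_eq_square pos_divide_le_eq)
    finally have 3: "W * norm (duhamel f t k) \<le> B" .
    show ?thesis
      using min_le_sqrt[of \<kappa> "t - \<tau>" B, OF _ _ B0 1 2] \<kappa> \<tau> 3 by (simp add: W_def)
  qed
  then show "decay q (B * sqrt (t - \<tau>)) (duhamel f t)" "decay q B (duhamel f t)"
    unfolding decay_def by auto
qed

lemma curve_ballD:
  fixes v :: "real \<Rightarrow> ('d::finite) field"
  assumes "curve_ball S B v" "t \<in> {0..S}"
  shows "adm (v t)" "decay (CARD('d) + 2) B (v t)" "wiener (v t)" "div_free (v t)"
proof -
  show 1: "adm (v t)" and 2: "decay (CARD('d) + 2) B (v t)"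
    using assms unfolding curve_ball_def by blast+
  show "wiener (v t)" by (rule decay_summable(1)[OF 2])
  show "div_free (v t)" using 1 unfolding adm_def by blast
qed

lemma decay_mild:
  fixes v :: "real \<Rightarrow> ('d::finite) field"
  assumes v: "curve_ball S B v" and us: "decay (CARD('d) + 2) C us" and t: "t \<in> {0..S}" and R: "R > 0"
  shows "decay (CARD('d) + 2) (C + R * (product_const TYPE('d) * B * B)) (mild R us v t)"
  unfolding mild_def
proof (rule decay_add)
  show "decay (CARD('d) + 2) C (heat t us)" using us t by (intro decay_heat) auto
  have "decay (CARD('d) + 2) (product_const TYPE('d) * B * B) (duhamel (\<lambda>s. NSP (v s) (v s)) t)"
  proof (rule decay_duhamel_late(2)[where \<tau> = 0])
    show "continuous_on {0..t} (\<lambda>s. NSP (v s) (v s) k)" for k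
      by (rule continuous_on_subset[OF curve_ball_NSP_continuous[OF v]]) (use t in auto)
    fix s k assume "s \<in> {0..t}"
    then have "s \<in> {0..S}" using t by auto
    then show "wt k ^ (CARD('d) + 2) * norm (NSP (v s) (v s) k) \<le> norm (wvec k) * (product_const TYPE('d) * B * B)"
      by (intro decay_product curve_ballD[OF v])
  qed (use t in auto)
  from decay_scaleR[OF this, of R] R
  show "decay (CARD('d) + 2) (R * (product_const TYPE('d) * B * B)) (\<lambda>k. R *\<^sub>R duhamel (\<lambda>s. NSP (v s) (v s)) t k)"
    by simp
qed

text \<open>The contraction estimate for two curves that agree up to time \<open>\<tau>\<close>: only the interval after \<open>\<tau>\<close>
  contributes, and it does so with the square root of its length.\<close>

lemma decay_mild_diff:
  fixes v w :: "real \<Rightarrow> ('d::finite) field"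
  assumes v: "curve_ball S B v" and w: "curve_ball S B w" and \<tau>: "0 \<le> \<tau>"
    and agree: "\<And>s. 0 \<le> s \<Longrightarrow> s \<le> \<tau> \<Longrightarrow> v s = w s"
    and c: "\<And>s. s \<in> {0..S} \<Longrightarrow> decay (CARD('d) + 2) c (\<lambda>k. v s k - w s k)"
    and t: "t \<in> {0..S}" and R: "R > 0" and \<delta>: "S - \<tau> \<le> \<delta>" "0 \<le> \<delta>"
  shows "decay (CARD('d) + 2) (R * (2 * product_const TYPE('d) * B * c * sqrt \<delta>)) (\<lambda>k. mild R us v t k - mild R us w t k)"
proof -
  let ?m = "CARD('d) + 2" and ?c = "product_const TYPE('d)"
  define f where "f = (\<lambda>s k. NSP (v s) (v s) k - NSP (w s) (w s) k)"
  define \<tau>' where "\<tau>' = min \<tau> t"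
  have B0: "0 \<le> B" and c0: "0 \<le> c" using decay_nonneg[OF curve_ballD(2)[OF v t]] decay_nonneg[OF c[OF t]] .
  have cont: "continuous_on {0..t} (\<lambda>s. NSP (v s) (v s) k)" "continuous_on {0..t} (\<lambda>s. NSP (w s) (w s) k)" for k
    by (rule continuous_on_subset[OF curve_ball_NSP_continuous[OF v]] continuous_on_subset[OF curve_ball_NSP_continuous[OF w]];
        use t in auto)+
  have eq: "mild R us v t k - mild R us w t k = R *\<^sub>R duhamel f t k" for k
  proof -
    have int: "(\<lambda>s. exp (- (t - s) * (norm (wvec k))\<^sup>2) *\<^sub>R NSP (v s) (v s) k) integrable_on {0..t}"
      "(\<lambda>s. exp (- (t - s) * (norm (wvec k))\<^sup>2) *\<^sub>R NSP (w s) (w s) k) integrable_on {0..t}"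
      by (intro integrable_continuous_interval continuous_intros cont)+
    have "duhamel f t k = duhamel (\<lambda>s. NSP (v s) (v s)) t k - duhamel (\<lambda>s. NSP (w s) (w s)) t k"
      unfolding duhamel_def field_integral_def heat_def f_def scaleR_diff_right
      by (rule Henstock_Kurzweil_Integration.integral_diff[OF int])
    then show ?thesis by (simp add: mild_def scaleR_diff_right)
  qed
  have "decay ?m (2 * ?c * B * c * sqrt (t - \<tau>')) (duhamel f t)"
  proof (rule decay_duhamel_late(1))
    show "continuous_on {0..t} (\<lambda>s. f s k)" for k
      unfolding f_def by (intro continuous_on_diff cont)
    show "f s k = 0" if "0 \<le> s" "s < \<tau>'" for s k
      using agree[of s] that by (simp add: f_def \<tau>'_def)
    show "0 \<le> \<tau>'" "\<tau>' \<le> t" using \<tau> t by (auto simp: \<tau>'_def)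
    fix s k assume "s \<in> {0..t}"
    then have s: "s \<in> {0..S}" using t by auto
    note vs = curve_ballD[OF v s] and ws = curve_ballD[OF w s]
    let ?d = "\<lambda>k. v s k - w s k"
    have d: "adm ?d" "decay ?m c ?d" "wiener ?d" "div_free ?d"
      using c[OF s] by (simp_all add: adm_diff vs ws decay_summable(1) div_free_diff)
    have "f s k = NSP ?d (v s) k + NSP (w s) ?d k"
      unfolding f_def by (simp add: NSP_diff_left NSP_diff_right vs ws)
    then have "wt k ^ ?m * norm (f s k) \<le> wt k ^ ?m * norm (NSP ?d (v s) k) + wt k ^ ?m * norm (NSP (w s) ?d k)"
      unfolding distrib_left[symmetric] by (auto intro!: mult_left_mono norm_triangle_ineq)
    also have "\<dots> \<le> norm (wvec k) * (?c * c * B) + norm (wvec k) * (?c * B * c)"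
      by (intro add_mono decay_product d vs ws)
    also have "\<dots> = norm (wvec k) * (2 * ?c * B * c)" by (simp add: algebra_simps)
    finally show "wt k ^ ?m * norm (f s k) \<le> norm (wvec k) * (2 * ?c * B * c)" .
  qed
  moreover have "2 * ?c * B * c * sqrt (t - \<tau>') \<le> 2 * ?c * B * c * sqrt \<delta>"
    using t \<delta> B0 c0 product_const_nonneg[where 'd = 'd]
    by (intro mult_left_mono real_sqrt_le_mono) (auto simp: \<tau>'_def)
  ultimately have "decay ?m (2 * ?c * B * c * sqrt \<delta>) (duhamel f t)" by (rule decay_mono)
  from decay_scaleR[OF this, of R] R show ?thesis by (simp add: eq)
qed

lemma adm_limit:
  assumes lim: "\<And>k. (\<lambda>j. v j k) \<longlonglongrightarrow> L k" and adm: "\<And>j. adm (v j)"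
  shows "adm L"
  unfolding adm_def div_free_iff_kdot
proof (intro conjI allI)
  fix k
  have "(\<lambda>j. cnjv (v j k)) \<longlonglongrightarrow> cnjv (L k)"
    by (rule bounded_linear.tendsto[OF bounded_linear_cnjv lim])
  moreover have "(\<lambda>j. cnjv (v j k)) \<longlonglongrightarrow> L (- k)"
    using lim[of "- k"] adm by (simp add: adm_def)
  ultimately show "cnjv (L k) = L (- k)" by (rule LIMSEQ_unique)
  have "(\<lambda>j. kdot k (v j k)) \<longlonglongrightarrow> kdot k (L k)"
    by (rule bounded_linear.tendsto[OF bounded_linear_kdot lim])
  moreover have "(\<lambda>j. kdot k (v j k)) \<longlonglongrightarrow> 0"
    using adm by (simp add: adm_def div_free_iff_kdot)
  ultimately show "kdot k (L k) = 0" by (rule LIMSEQ_unique)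
  have "(\<lambda>j. v j 0) \<longlonglongrightarrow> 0" using adm by (simp add: adm_def)
  with lim[of 0] show "L 0 = 0" by (rule LIMSEQ_unique)
qed

lemma decay_limit:
  assumes lim: "\<And>k. (\<lambda>j. v j k) \<longlonglongrightarrow> L k" and dec: "\<And>j. decay q C (v j)"
  shows "decay q C L"
  unfolding decay_def
proof
  fix k
  have "(\<lambda>j. wt k ^ q * norm (v j k)) \<longlonglongrightarrow> wt k ^ q * norm (L k)"
    by (intro tendsto_intros lim)
  then show "wt k ^ q * norm (L k) \<le> C"
    by (rule LIMSEQ_le_const2) (use decayD[OF dec] in blast)
qed

text \<open>Picard's method.  The
  iteration starts from the given solution, frozen at time \<open>\<tau>\<close>; all iterates agree with it up to
  \<open>\<tau>\<close>, so that the contraction constant involves only the length of the interval after \<open>\<tau>\<close>.\<close>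

lemma mild_fixed_point:
  fixes u :: "real \<Rightarrow> ('d::finite) field"
  assumes u: "curve_ball \<tau> M u" and fix_u: "\<And>t. t \<in> {0..\<tau>} \<Longrightarrow> u t = mild R us u t" and \<tau>: "0 \<le> \<tau>"
    and us: "adm us" "decay (CARD('d) + 2) C us" and R: "R > 0"
    and M1: "M \<le> M1" "C + R * (product_const TYPE('d) * M * M) \<le> M1"
    and \<delta>: "0 \<le> \<delta>" "R * (2 * product_const TYPE('d) * (5 * M1)) * sqrt \<delta> \<le> 1 / 2"
  shows "\<exists>v. curve_ball (\<tau> + \<delta>) (5 * M1) v \<and> (\<forall>t\<in>{0..\<tau>}. v t = u t) \<and> (\<forall>t\<in>{0..\<tau> + \<delta>}. v t = mild R us v t)"
proof -
  let ?m = "CARD('d) + 2" and ?c = "product_const TYPE('d)"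
  define S where "S = \<tau> + \<delta>"
  define v where "v = (\<lambda>j. (mild R us ^^ j) (\<lambda>t. u (min t \<tau>)))"
  have v0: "v 0 = (\<lambda>t. u (min t \<tau>))" and vS: "v (Suc j) = mild R us (v j)" for j
    by (simp_all add: v_def)
  have M0: "0 \<le> M" using decay_nonneg[OF curve_ballD(2)[OF u, of 0]] \<tau> by simp
  then have M10: "0 \<le> M1" using M1(1) by linarith
  have v0_ball: "curve_ball S M (v 0)"
    unfolding curve_ball_def v0
  proof (intro conjI ballI allI)
    fix t assume t: "t \<in> {0..S}"
    then have "min t \<tau> \<in> {0..\<tau>}" using \<tau> by auto
    then show "adm (u (min t \<tau>))" "decay ?m M (u (min t \<tau>))" by (rule curve_ballD[OF u])+
  next
    fix k
    have "continuous_on {0..\<tau>} (\<lambda>t. u t k)" using u by (simp add: curve_ball_def)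
    then show "continuous_on {0..S} (\<lambda>t. u (min t \<tau>) k)"
      by (rule continuous_on_compose2) (use \<tau> in \<open>auto intro!: continuous_intros\<close>)
  qed
  \<comment> \<open>The first step has size at most \<open>2 M1\<close> and the steps are halved, so the iterates stay below \<open>M1 + 4 M1\<close>.\<close>
  define B where "B = (\<lambda>j. M1 + 4 * M1 * (1 - (1/2) ^ j))"
  have B_le: "B j \<le> 5 * M1" for j
    using M10 by (simp add: B_def algebra_simps)
  have step: "curve_ball S (B j) (v j) \<and> (\<forall>t\<in>{0..\<tau>}. v j t = u t) \<and>
      (\<forall>t\<in>{0..S}. decay ?m (2 * M1 * (1/2) ^ j) (\<lambda>k. v (Suc j) t k - v j t k))" for j
  proof (induction j)
    case 0
    have "decay ?m (2 * M1) (\<lambda>k. v 1 t k - v 0 t k)" if t: "t \<in> {0..S}" for t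
    proof -
      have "decay ?m (C + R * (?c * M * M)) (v 1 t)"
        using decay_mild[OF v0_ball us(2) t R] by (simp add: vS)
      from decay_diff[OF decay_mono[OF this M1(2)] decay_mono[OF curve_ballD(2)[OF v0_ball t] M1(1)]]
      show ?thesis by simp
    qed
    then show ?case
      using curve_ball_mono[OF v0_ball order_refl M1(1)] by (auto simp: B_def v0)
  next
    case (Suc j)
    then have ball: "curve_ball S (B j) (v j)" and agree: "\<And>t. t \<in> {0..\<tau>} \<Longrightarrow> v j t = u t"
      and diff: "\<And>t. t \<in> {0..S} \<Longrightarrow> decay ?m (2 * M1 * (1/2) ^ j) (\<lambda>k. v (Suc j) t k - v j t k)"
      by blast+
    have ball': "curve_ball S (B (Suc j)) (v (Suc j))"
      unfolding curve_ball_def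
    proof (intro conjI ballI allI)
      fix t assume t: "t \<in> {0..S}"
      show "adm (v (Suc j) t)" unfolding vS by (rule curve_ball_mild(1)[OF ball us(1) t])
      have "decay ?m (B j + 2 * M1 * (1/2) ^ j) (\<lambda>k. v j t k + (v (Suc j) t k - v j t k))"
        by (rule decay_add[OF curve_ballD(2)[OF ball t] diff[OF t]])
      then show "decay ?m (B (Suc j)) (v (Suc j) t)"
        by (simp add: B_def algebra_simps)
    next
      show "continuous_on {0..S} (\<lambda>t. v (Suc j) t k)" for k
        unfolding vS by (rule curve_ball_mild(2)[OF ball us(1)])
    qed
    have agree': "v (Suc j) t = u t" if t: "t \<in> {0..\<tau>}" for t
    proof -
      have "v (Suc j) t = mild R us u t"
        unfolding vS by (rule mild_cong) (use agree t in auto)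
      then show ?thesis using fix_u[OF t] by simp
    qed
    have "decay ?m (2 * M1 * (1/2) ^ Suc j) (\<lambda>k. v (Suc (Suc j)) t k - v (Suc j) t k)" if t: "t \<in> {0..S}" for t
    proof -
      have "decay ?m (R * (2 * ?c * (5 * M1) * (2 * M1 * (1/2) ^ j) * sqrt \<delta>))
          (\<lambda>k. mild R us (v (Suc j)) t k - mild R us (v j) t k)"
        by (rule decay_mild_diff[OF curve_ball_mono[OF ball' order_refl B_le] curve_ball_mono[OF ball order_refl B_le] \<tau> _ diff t R])
          (use agree agree' \<delta> in \<open>auto simp: S_def\<close>)
      moreover have "R * (2 * ?c * (5 * M1) * (2 * M1 * (1/2) ^ j) * sqrt \<delta>) \<le> 2 * M1 * (1/2) ^ Suc j"
      proof -
        have "R * (2 * ?c * (5 * M1) * (2 * M1 * (1/2) ^ j) * sqrt \<delta>) =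
            (R * (2 * ?c * (5 * M1)) * sqrt \<delta>) * (2 * M1 * (1/2) ^ j)"
          by (simp only: mult_ac)
        also have "\<dots> \<le> (1 / 2) * (2 * M1 * (1/2) ^ j)"
          using M10 by (intro mult_right_mono \<delta>(2)) simp
        finally show ?thesis by simp
      qed
      ultimately show ?thesis unfolding vS by (rule decay_mono)
    qed
    then show ?case using ball' agree' by blast
  qed
  have ball: "curve_ball S (5 * M1) (v j)" for j
    using step[of j] curve_ball_mono[OF _ order_refl B_le] by blast
  define L where "L = (\<lambda>t k. v 0 t k + (\<Sum>j. v (Suc j) t k - v j t k))"
  have telescope: "v 0 t k + (\<Sum>i<j. v (Suc i) t k - v i t k) = v j t k" for j t k
    by (simp add: sum_lessThan_telescope[of "\<lambda>i. v i t k"])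
  have unif: "uniform_limit {0..S} (\<lambda>j t. v j t k) (\<lambda>t. L t k) sequentially" for k
  proof -
    have "uniform_limit {0..S} (\<lambda>n t. \<Sum>j<n. v (Suc j) t k - v j t k) (\<lambda>t. \<Sum>j. v (Suc j) t k - v j t k) sequentially"
    proof (rule Weierstrass_m_test)
      fix j t assume "t \<in> {0..S}"
      then have "decay 0 (2 * M1 * (1/2) ^ j) (\<lambda>k. v (Suc j) t k - v j t k)"
        using step[of j] decay_less by blast
      then show "norm (v (Suc j) t k - v j t k) \<le> 2 * M1 * (1/2) ^ j"
        using decayD[of 0] by fastforce
    qed (intro summable_mult summable_geometric, simp)
    from uniform_limit_add[OF uniform_limit_const this, of "\<lambda>t. v 0 t k"]
    show ?thesis by (simp add: telescope L_def)
  qed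
  have lim: "(\<lambda>j. v j t k) \<longlonglongrightarrow> L t k" if "t \<in> {0..S}" for t k
    by (rule tendsto_uniform_limitI[OF unif that])
  have Lball: "curve_ball S (5 * M1) L"
    unfolding curve_ball_def
  proof (intro conjI ballI allI)
    fix t assume t: "t \<in> {0..S}"
    show "adm (L t)" by (rule adm_limit[OF lim[OF t] curve_ballD(1)[OF ball t]])
    show "decay ?m (5 * M1) (L t)" by (rule decay_limit[OF lim[OF t] curve_ballD(2)[OF ball t]])
  next
    fix k
    show "continuous_on {0..S} (\<lambda>t. L t k)"
      by (rule uniform_limit_theorem[OF _ unif]) (use ball in \<open>auto simp: curve_ball_def intro!: always_eventually\<close>)
  qed
  have agree: "L t = u t" if "t \<in> {0..\<tau>}" for t
  proof
    fix k
    have "(\<lambda>j. v j t k) \<longlonglongrightarrow> u t k" using step that by simp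
    moreover have "(\<lambda>j. v j t k) \<longlonglongrightarrow> L t k" using that \<delta> by (intro lim) (auto simp: S_def)
    ultimately show "L t k = u t k" by (simp add: LIMSEQ_unique)
  qed
  have fixL: "L t = mild R us L t" if t: "t \<in> {0..S}" for t
  proof
    fix k :: "int ^ 'd"
    let ?g = "\<lambda>w s. exp (- (t - s) * (norm (wvec k))\<^sup>2) *\<^sub>R NSP (w s) (w s) k :: complex ^ 'd"
    have "(\<lambda>j. integral {0..t} (?g (v j))) \<longlonglongrightarrow> integral {0..t} (?g L)"
    proof (rule dominated_convergence(2))
      show "?g (v j) integrable_on {0..t}" for j
        by (intro integrable_continuous_interval continuous_intros
            continuous_on_subset[OF curve_ball_NSP_continuous[OF ball]]) (use t in auto)
      show "(\<lambda>s. norm (wvec k) * (?c * (5 * M1) * (5 * M1))) integrable_on {0..t}"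
        by (rule integrable_const_ivl)
      fix s assume "s \<in> {0..t}"
      then have s: "s \<in> {0..S}" "s \<le> t" using t by auto
      show "norm (?g (v j) s) \<le> norm (wvec k) * (?c * (5 * M1) * (5 * M1))" for j
      proof -
        have "norm (NSP (v j s) (v j s) k) \<le> wt k ^ ?m * norm (NSP (v j s) (v j s) k)"
          using mult_right_mono[OF one_le_power[OF wt_ge_1, of k ?m] norm_ge_zero[of "NSP (v j s) (v j s) k"]] by simp
        also have "\<dots> \<le> norm (wvec k) * (?c * (5 * M1) * (5 * M1))"
          by (intro decay_product curve_ballD[OF ball s(1)])
        finally have *: "norm (NSP (v j s) (v j s) k) \<le> norm (wvec k) * (?c * (5 * M1) * (5 * M1))" .
        have "exp (- (t - s) * (norm (wvec k))\<^sup>2) \<le> 1"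
          using s(2) by (auto intro: mult_nonpos_nonneg)
        then have "exp (- (t - s) * (norm (wvec k))\<^sup>2) * norm (NSP (v j s) (v j s) k) \<le>
            1 * (norm (wvec k) * (?c * (5 * M1) * (5 * M1)))"
          by (intro mult_mono *) auto
        then show ?thesis by simp
      qed
      show "(\<lambda>j. ?g (v j) s) \<longlonglongrightarrow> ?g L s"
      proof (intro tendsto_scaleR tendsto_const tendsto_NSP lim s)
        show "eventually (\<lambda>j. div_free (v j s) \<and> decay ?m (5 * M1) (v j s)) sequentially"
          "eventually (\<lambda>j. decay ?m (5 * M1) (v j s)) sequentially"
          by (intro always_eventually allI conjI curve_ballD[OF ball s(1)])+
      qed (intro curve_ballD[OF Lball s(1)])+
    qed
    then have "(\<lambda>j. mild R us (v j) t k) \<longlonglongrightarrow> mild R us L t k"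
      unfolding mild_def duhamel_def field_integral_def heat_def by (intro tendsto_intros)
    moreover have "(\<lambda>j. mild R us (v j) t k) \<longlonglongrightarrow> L t k"
      using LIMSEQ_Suc[OF lim[OF t, of k]] by (simp add: vS)
    ultimately show "L t k = mild R us L t k" by (simp add: LIMSEQ_unique)
  qed
  show ?thesis
    using Lball agree fixL unfolding S_def by blast
qed

text \<open>The contraction halves any bound for the difference, starting from the trivial one.\<close>

lemma mild_unique:
  fixes u v :: "real \<Rightarrow> ('d::finite) field"
  assumes u: "curve_ball S B u" and v: "curve_ball S B v"
    and fix_u: "\<And>t. t \<in> {0..S} \<Longrightarrow> u t = mild R us u t" and fix_v: "\<And>t. t \<in> {0..S} \<Longrightarrow> v t = mild R us v t"
    and agree: "\<And>t. t \<in> {0..\<tau>} \<Longrightarrow> u t = v t" and \<tau>: "0 \<le> \<tau>" and R: "R > 0"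
    and \<delta>: "S \<le> \<tau> + \<delta>" "0 \<le> \<delta>" "R * (2 * product_const TYPE('d) * B) * sqrt \<delta> \<le> 1 / 2"
    and t: "t \<in> {0..S}"
  shows "u t = v t"
proof -
  let ?m = "CARD('d) + 2" and ?c = "product_const TYPE('d)"
  have dec: "\<forall>s\<in>{0..S}. decay ?m (2 * B * (1/2) ^ j) (\<lambda>k. u s k - v s k)" for j
  proof (induction j)
    case 0
    then show ?case using decay_diff[OF curve_ballD(2)[OF u] curve_ballD(2)[OF v]] by simp
  next
    case (Suc j)
    show ?case
    proof
      fix s assume s: "s \<in> {0..S}"
      have B0: "0 \<le> B" using decay_nonneg[OF curve_ballD(2)[OF u t]] .
      have "decay ?m (R * (2 * ?c * B * (2 * B * (1/2) ^ j) * sqrt \<delta>)) (\<lambda>k. mild R us u s k - mild R us v s k)"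
        by (rule decay_mild_diff[OF u v \<tau> _ _ s R]) (use agree Suc \<delta> in auto)
      moreover have "R * (2 * ?c * B * (2 * B * (1/2) ^ j) * sqrt \<delta>) \<le> 2 * B * (1/2) ^ Suc j"
      proof -
        have "R * (2 * ?c * B * (2 * B * (1/2) ^ j) * sqrt \<delta>) = (R * (2 * ?c * B) * sqrt \<delta>) * (2 * B * (1/2) ^ j)"
          by (simp only: mult_ac)
        also have "\<dots> \<le> (1 / 2) * (2 * B * (1/2) ^ j)"
          using B0 by (intro mult_right_mono \<delta>(3)) simp
        finally show ?thesis by simp
      qed
      ultimately show "decay ?m (2 * B * (1/2) ^ Suc j) (\<lambda>k. u s k - v s k)"
        unfolding fix_u[OF s, symmetric] fix_v[OF s, symmetric] by (rule decay_mono)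
    qed
  qed
  show ?thesis
  proof
    fix k
    have "(\<lambda>j. 2 * B * (1/2) ^ j) \<longlonglongrightarrow> 2 * B * 0"
      by (intro tendsto_intros LIMSEQ_power_zero) simp
    moreover have "wt k ^ ?m * norm (u t k - v t k) \<le> 2 * B * (1/2) ^ j" for j
      using decayD[of ?m _ "\<lambda>k. u t k - v t k" k] dec[of j] t by blast
    ultimately have "wt k ^ ?m * norm (u t k - v t k) \<le> 0"
      using LIMSEQ_le_const[of "\<lambda>j. 2 * B * (1/2) ^ j" 0] by auto
    moreover have "0 < wt k ^ ?m" by simp
    ultimately have "norm (u t k - v t k) \<le> 0" by (simp only: mult_le_0_iff) linarith
    then show "u t k = v t k" by simp
  qed
qed

text \<open>Differentiating Duhamel's formula gives the equation for the coefficients, the bootstrap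
  gives decay of every order; so the curve is tame.\<close>

lemma mild_NS_solution:
  fixes v :: "real \<Rightarrow> ('d::finite) field"
  assumes v: "curve_ball S B v" and fix_v: "\<And>t. t \<in> {0..S} \<Longrightarrow> v t = mild R us v t"
    and us: "us \<in> Sob_inf" and R: "R > 0" and S: "S > 0"
  shows "NS_solution R us (ereal S) v"
proof (rule NS_solutionI)
  let ?I = "time_ivl (ereal S)"
  have I: "t \<in> {0..S}" if "t \<in> ?I" for t using that by (auto simp: time_ivl_def)
  show "0 < ereal S" using S by simp
  have cont: "continuous_on ?I (\<lambda>t. NSP (v t) (v t) k)" for k
    by (rule continuous_on_subset[OF curve_ball_NSP_continuous[OF v]]) (use I in auto)
  have "coeff_deriv ?I (mild R us v) (\<lambda>t k. laplace (heat t us) k +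
      R *\<^sub>R (laplace (duhamel (\<lambda>s. NSP (v s) (v s)) t) k + NSP (v t) (v t) k))"
    unfolding mild_def [abs_def]
    by (intro coeff_deriv_add coeff_deriv_scaleR coeff_deriv_heat coeff_deriv_duhamel cont)
  moreover have "laplace (heat t us) k + R *\<^sub>R (laplace (duhamel (\<lambda>s. NSP (v s) (v s)) t) k + NSP (v t) (v t) k) =
      NS_rhs R (v t) k" if "t \<in> ?I" for t k
  proof -
    have "laplace (heat t us) k + R *\<^sub>R laplace (duhamel (\<lambda>s. NSP (v s) (v s)) t) k = laplace (mild R us v t) k"
      by (simp add: laplace_def mild_def algebra_simps)
    then show ?thesis
      using fix_v[OF I[OF that]] by (simp add: NS_rhs_def scaleR_add_right flip: add.assoc)
  qed
  ultimately have "coeff_deriv ?I (mild R us v) (\<lambda>t. NS_rhs R (v t))"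
    unfolding coeff_deriv_def by simp
  then show deriv: "coeff_deriv ?I v (\<lambda>t. NS_rhs R (v t))"
    using coeff_deriv_cong_left[of ?I v "mild R us v"] fix_v I by blast
  show v0: "v 0 = us"
  proof
    fix k
    have "v 0 k = mild R us v 0 k" using fix_v[of 0] S by simp
    then show "v 0 k = us k" by (simp add: mild_def heat_def duhamel_eq)
  qed
  show "tame ?I v"
    unfolding tame_def
  proof (intro conjI ballI allI)
    show "adm (v t)" if "t \<in> ?I" for t by (rule curve_ballD[OF v I[OF that]])
    show "continuous_on ?I (\<lambda>t. v t k)" for k by (rule coeff_deriv_continuous[OF deriv])
    fix q
    have "\<exists>C. \<forall>t\<in>?I. decay q C (v t)"
    proof (rule decay_bootstrap[OF deriv])
      show "v 0 \<in> Sob_inf" using v0 us by simp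
      show "adm (v t)" "wiener (v t)" "l1 (v t) \<le> B * lattice_sum TYPE('d)" if "t \<in> ?I" for t
        using curve_ballD[OF v I[OF that]] decay_summable(2) by blast+
      show "s \<in> ?I" if "t \<in> ?I" "0 \<le> s" "s \<le> t" for s t using time_ivl_downward that .
    qed (use R in auto)
    then show "\<exists>C. \<forall>t\<in>?I. t \<le> b \<longrightarrow> decay q C (v t)" for b by blast
  qed
qed

text \<open>The weighted bound \<open>M\<close> is uniform up to \<open>T\<close>, so the admissible time step \<open>\<delta>\<close> does not shrink when the
  starting time \<open>\<tau>\<close> approaches \<open>T\<close>, and one may start at distance \<open>\<delta> / 2\<close> from \<open>T\<close>.\<close>

theorem NS_solution_continuation:
  fixes u :: "real \<Rightarrow> ('d::finite) field"
  assumes u: "NS_solution R us (ereal T) u" and R: "R > 0" and us: "us \<in> Sob_inf"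
    and bound: "\<And>t. t \<in> time_ivl (ereal T) \<Longrightarrow> l1 (u t) \<le> A"
  shows "\<exists>T' v. T < T' \<and> NS_solution R us (ereal T') v \<and> (\<forall>t\<in>time_ivl (ereal T). v t = u t)"
proof -
  let ?I = "time_ivl (ereal T)" and ?m = "CARD('d) + 2" and ?c = "product_const TYPE('d)"
  have T: "T > 0" using u by (simp add: NS_solution_def)
  have tame: "tame ?I u" by (rule NS_solution_tame[OF u R us])
  have u0: "u 0 = us" using u by (simp add: NS_solution_def)
  have "\<exists>C. \<forall>t\<in>?I. decay ?m C (u t)"
  proof (rule decay_bootstrap[OF NS_solution_coeff_deriv[OF u]])
    show "s \<in> ?I" if "t \<in> ?I" "0 \<le> s" "s \<le> t" for s t using time_ivl_downward that .
  qed (use R us u0 bound tame_adm[OF tame] tame_wiener[OF tame] in auto)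
  then obtain M where M: "\<And>t. t \<in> ?I \<Longrightarrow> decay ?m M (u t)" by blast
  have zI: "0 \<in> ?I" using T by (intro zero_in_time_ivl) simp
  then have M0: "0 \<le> M" using M decay_nonneg by blast
  have usM: "decay ?m M us" using M[OF zI] u0 by simp
  define M1 where "M1 = M + R * (?c * M * M)"
  have c0: "0 \<le> ?c" by (rule product_const_nonneg)
  have M1: "M \<le> M1" "0 \<le> M1" using M0 R c0 by (simp_all add: M1_def)
  \<comment> \<open>\<open>\<sigma> = sqrt \<delta>\<close>; the summand \<open>1\<close> only avoids a division by zero.\<close>
  define \<sigma> where "\<sigma> = 1 / (2 * (R * (2 * ?c * (5 * M1))) + 1)"
  have K: "0 \<le> R * (2 * ?c * (5 * M1))" using R c0 M1 by simp
  then have \<sigma>: "0 < \<sigma>" by (simp add: \<sigma>_def add_nonneg_pos)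
  define \<delta> where "\<delta> = \<sigma>\<^sup>2"
  have \<delta>: "0 < \<delta>" "R * (2 * ?c * (5 * M1)) * sqrt \<delta> \<le> 1 / 2"
    using \<sigma> K by (simp_all add: \<delta>_def) (simp add: \<sigma>_def divide_simps add_nonneg_pos)
  define \<tau> where "\<tau> = max 0 (T - \<delta> / 2)"
  have \<tau>: "0 \<le> \<tau>" "\<tau> < T" "T < \<tau> + \<delta>" using T \<delta>(1) by (auto simp: \<tau>_def)
  have ball: "curve_ball s M u" if "s \<in> ?I" for s
    unfolding curve_ball_def
    using atLeastAtMost_subset_time_ivl[OF that] M tame_adm[OF tame] continuous_on_subset[OF tame_cont[OF tame]] by blast
  have \<tau>I: "\<tau> \<in> ?I" using \<tau> by (simp add: time_ivl_def)
  have fix_u: "u t = mild R us u t" if "t \<in> ?I" for t by (rule NS_solution_mild[OF u that])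
  have "\<exists>v. curve_ball (\<tau> + \<delta>) (5 * M1) v \<and> (\<forall>t\<in>{0..\<tau>}. v t = u t) \<and> (\<forall>t\<in>{0..\<tau> + \<delta>}. v t = mild R us v t)"
    by (rule mild_fixed_point[OF ball[OF \<tau>I] _ \<tau>(1) Sob_inf_adm[OF us] usM R M1(1)])
      (use fix_u atLeastAtMost_subset_time_ivl[OF \<tau>I] \<delta> in \<open>auto simp: M1_def\<close>)
  then obtain v where v: "curve_ball (\<tau> + \<delta>) (5 * M1) v" "\<And>t. t \<in> {0..\<tau>} \<Longrightarrow> v t = u t"
    "\<And>t. t \<in> {0..\<tau> + \<delta>} \<Longrightarrow> v t = mild R us v t" by blast
  have "NS_solution R us (ereal (\<tau> + \<delta>)) v"
    by (rule mild_NS_solution[OF v(1,3) us R]) (use \<tau> \<delta> in auto)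
  moreover have "v t = u t" if t: "t \<in> ?I" for t
  proof -
    define S where "S = max t \<tau>"
    have S: "S \<in> ?I" "S < T" "\<tau> \<le> S" "t \<in> {0..S}" using t \<tau> by (auto simp: S_def time_ivl_def)
    have "curve_ball S (5 * M1) u" "curve_ball S (5 * M1) v"
      using curve_ball_mono[OF ball[OF S(1)]] curve_ball_mono[OF v(1)] M1 S \<tau> by auto
    then show ?thesis
    proof (rule mild_unique[where \<tau> = \<tau> and \<delta> = \<delta> and t = t, symmetric])
      show "u s = mild R us u s" if "s \<in> {0..S}" for s
        using fix_u atLeastAtMost_subset_time_ivl[OF S(1)] that by blast
      show "v s = mild R us v s" if "s \<in> {0..S}" for s
        using v(3)[of s] that S \<tau> by auto
    qed (use v(2) \<tau> \<delta> R S in auto)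
  qed
  ultimately show ?thesis using \<tau>(3) by blast
qed

section \<open>The linear control equation\<close>

text \<open>The integrating factor is \<open>exp (t - R A(t))\<close>.\<close>

lemma linear_ODE_iff_formula:
  fixes c e r :: "real \<Rightarrow> real"
  assumes T: "0 < T" and c: "continuous_on (time_ivl T) c" and e: "continuous_on (time_ivl T) e"
  defines "A \<equiv> \<lambda>t. integral {0..t} c"
  shows "(continuous_on (time_ivl T) r \<and> r 0 = 0 \<and>
      (\<forall>t\<in>time_ivl T. (r has_real_derivative - r t + R * c t * r t + e t) (at t within time_ivl T))) \<longleftrightarrow>
    (\<forall>t\<in>time_ivl T. r t = exp (- t + R * A t) * integral {0..t} (\<lambda>s. exp (s - R * A s) * e s))"
    (is "?L \<longleftrightarrow> ?R")
proof -
  let ?I = "time_ivl T"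
  have ftc: "((\<lambda>s. integral {0..s} g) has_real_derivative g t) (at t within ?I)"
    if g: "continuous_on ?I g" and t: "t \<in> ?I" for g :: "real \<Rightarrow> real" and t
  proof -
    obtain b where b: "t < b" "b \<in> ?I" using time_ivl_later[OF t] .
    have "continuous_on {0..b} g"
      by (rule continuous_on_subset[OF g atLeastAtMost_subset_time_ivl[OF b(2)]])
    then have "((\<lambda>s. integral {0..s} g) has_real_derivative g t) (at t within {0..b})"
      by (rule integral_has_real_derivative) (use b time_ivl_nonneg[OF t] in auto)
    then show ?thesis
      by (simp only: at_within_time_ivl_Icc[OF b(2) time_ivl_nonneg[OF t] b(1)])
  qed
  have A: "(A has_real_derivative c t) (at t within ?I)" if "t \<in> ?I" for t
    unfolding A_def by (rule ftc[OF c that])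
  have Ac: "continuous_on ?I A" by (rule DERIV_continuous_on[OF A])
  define g where "g = (\<lambda>s. exp (s - R * A s) * e s)"
  have g: "continuous_on ?I g"
    unfolding g_def by (intro continuous_intros Ac e)
  show ?thesis
  proof
    assume L: ?L
    show ?R
    proof
      fix t assume t: "t \<in> ?I"
      have sub: "{0..t} \<subseteq> ?I" by (rule atLeastAtMost_subset_time_ivl[OF t])
      have "(g has_integral exp (t - R * A t) * r t - exp (0 - R * A 0) * r 0) {0..t}"
      proof (rule fundamental_theorem_of_calculus)
        show "0 \<le> t" using t by (rule time_ivl_nonneg)
        fix s assume "s \<in> {0..t}"
        then have s: "s \<in> ?I" using sub by auto
        have r: "(r has_real_derivative - r s + R * c s * r s + e s) (at s within ?I)"
          using L s by blast
        have "((\<lambda>s. exp (s - R * A s) * r s) has_real_derivative g s) (at s within ?I)"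
          by (rule derivative_eq_intros A[OF s] r refl)+ (simp add: g_def algebra_simps)
        then show "((\<lambda>s. exp (s - R * A s) * r s) has_vector_derivative g s) (at s within {0..t})"
          using sub unfolding has_real_derivative_iff_has_vector_derivative
          by (rule has_vector_derivative_within_subset)
      qed
      then have "integral {0..t} g = exp (t - R * A t) * r t" using L by (simp add: integral_unique)
      then have "exp (- t + R * A t) * integral {0..t} g = exp (- t + R * A t + (t - R * A t)) * r t"
        by (simp only: exp_add mult.assoc)
      then show "r t = exp (- t + R * A t) * integral {0..t} (\<lambda>s. exp (s - R * A s) * e s)"
        by (simp add: g_def)
    qed
  next
    assume R: ?R
    define F where "F = (\<lambda>t. exp (- t + R * A t) * integral {0..t} g)"
    have rF: "r t = F t" if "t \<in> ?I" for t using R that by (simp add: F_def g_def)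
    have deriv: "(r has_real_derivative - r t + R * c t * r t + e t) (at t within ?I)" if t: "t \<in> ?I" for t
    proof -
      have "exp (- t + R * A t) * g t = e t"
        by (simp add: g_def flip: exp_add mult.assoc)
      then have "(F has_real_derivative - F t + R * c t * F t + e t) (at t within ?I)"
        unfolding F_def
        by - (rule derivative_eq_intros A[OF t] ftc[OF g t] refl | simp add: algebra_simps)+
      then have "(r has_real_derivative - F t + R * c t * F t + e t) (at t within ?I)"
        by (rule has_field_derivative_transform_within[of _ _ _ _ 1]) (simp_all add: t rF)
      then show ?thesis by (simp add: rF[OF t])
    qed
    have zero: "0 \<in> ?I" by (rule zero_in_time_ivl[OF T])
    have "r 0 = 0" using R zero by simp
    then show ?L using DERIV_continuous_on[OF deriv] deriv by blast
  qed
qed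

lemma G2_const_nonneg:
  assumes "CARD('d::finite) \<ge> 2" "G2_const TYPE('d) p n G"
  shows "0 \<le> G"
proof -
  obtain v :: "'d field" where v: "v \<in> Sob_inf" "\<And>n. 0 < sob_norm n v"
    using exists_nonzero_field[OF assms(1)] by blast
  have "0 \<le> \<bar>sob_inner p (NSP v v) v\<bar>" by simp
  also have "\<dots> \<le> 1 / 2 * G * (sob_norm p v * sob_norm n v + sob_norm n v * sob_norm p v) * sob_norm p v"
    using assms(2) Sob_inf_Sob[OF v(1)] unfolding G2_const_def by blast
  also have "\<dots> = G * (sob_norm p v * sob_norm n v * sob_norm p v)" by (simp add: algebra_simps)
  finally show ?thesis
    using mult_pos_pos[OF mult_pos_pos[OF v(2)[of p] v(2)[of n]] v(2)[of p]]
    by (simp only: zero_le_mult_iff) linarith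
qed

section \<open>Control of the solution by the approximate solution\<close>

theorem proposition2p3:
  fixes us :: "('d::finite) field" and u :: "real \<Rightarrow> 'd field"
    and R n Kn Gn :: real and N :: nat and T Tc :: ereal
    and Dn Dn1 en Rn Rn' :: "real \<Rightarrow> real"
  assumes "CARD('d) \<ge> 2"
    and "R > 0"
    and "us \<in> Sob_inf"
    and "n > real CARD('d) / 2 + 1"
    and "K_const TYPE('d) n Kn"
    and "G_const TYPE('d) n Gn"
    and "estimators R (partial_expansion R us N) n Dn Dn1 en"
    and "Tc > 0"
    and "continuous_on (time_ivl Tc) Rn'"
    and "\<And>t. t \<in> time_ivl Tc \<Longrightarrow> (Rn has_real_derivative Rn' t) (at t within time_ivl Tc)"
    and "\<And>t. t \<in> time_ivl Tc \<Longrightarrow>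
           Rn' t = - Rn t + R * (Gn * Dn t + Kn * Dn1 t) * Rn t + R * Gn * (Rn t)\<^sup>2 + en t"
    and "Rn 0 = 0"
    and "NS_maximal_solution R us T u"
  shows "T \<ge> Tc \<and>
    (\<forall>t\<in>time_ivl Tc. sob_norm n (\<lambda>k. u t k - partial_expansion R us N t k) \<le> Rn t) \<and>
    (Tc = \<infinity> \<longrightarrow> T = \<infinity>) \<and>
    (\<forall>p Kp Gp Gpn Dp Dp1 ep.
           p > n \<and> K_const TYPE('d) p Kp \<and> G_const TYPE('d) p Gp \<and> G2_const TYPE('d) p n Gpn \<and>
           estimators R (partial_expansion R us N) p Dp Dp1 ep \<longrightarrow>
           (let A = (\<lambda>t. integral {0..t} (\<lambda>s. Gp * Dp s + Kp * Dp1 s + Gpn * Rn s));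
                solves = (\<lambda>Rp. continuous_on (time_ivl Tc) Rp \<and> Rp 0 = 0 \<and>
                  (\<forall>t\<in>time_ivl Tc. (Rp has_real_derivative
                     - Rp t + R * (Gp * Dp t + Kp * Dp1 t + Gpn * Rn t) * Rp t + ep t)
                     (at t within time_ivl Tc)))
            in \<forall>Rp. (solves Rp \<longleftrightarrow> (\<forall>t\<in>time_ivl Tc.
                        Rp t = exp (- t + R * A t) * integral {0..t} (\<lambda>s. exp (s - R * A s) * ep s))) \<and>
                    (solves Rp \<longrightarrow> (\<forall>t\<in>time_ivl Tc.
                        sob_norm p (\<lambda>k. u t k - partial_expansion R us N t k) \<le> Rp t))))"
proof -
  note card = assms(1) and R = assms(2) and us = assms(3) and n = assms(4)
    and Kn = assms(5) and Gn = assms(6) and est = assms(7) and Tc = assms(8)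
    and Rn = assms(10) and Rn' = assms(11) and Rn0 = assms(12)
  let ?I = "time_ivl Tc"
  define f where "f = partial_expansion R us N"
  define f' where "f' = time_derivative {0..} f"
  define w where "w = (\<lambda>t k. u t k - f t k)"
  have sol: "NS_solution R us T u" using assms(13) by (simp add: NS_maximal_solution_def)
  then have T: "0 < T" and u0: "u 0 = us" by (simp_all add: NS_solution_def)
  have fd: "has_time_derivative f (f' t) t {0..}" if "0 \<le> t" for t
    unfolding f_def f'_def by (rule has_time_derivative_partial_expansion[OF us that])
  have fS: "f t \<in> Sob_inf" and f'S: "f' t \<in> Sob_inf" if "0 \<le> t" for t
    using fd[OF that] that by (auto simp: has_time_derivative_def)
  have uS: "u t \<in> Sob_inf" if "t \<in> time_ivl T" for t by (rule NS_solution_Sob_inf[OF sol that])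
  have sub: "?I \<subseteq> {0..}" by (auto simp: time_ivl_def)
  have w0: "sob_norm q (w 0) = 0" for q
    by (simp add: w_def u0 f_def partial_expansion_zero sob_norm_def sob_inner_def)
  have wd: "has_time_derivative w (\<lambda>k. NS_rhs R (u t) k - f' t k) t (time_ivl S)"
    if "S \<le> T" "t \<in> time_ivl S" for S t
  proof -
    have "t \<in> time_ivl T" "0 \<le> t" using time_ivl_mono[OF that(1)] that(2) time_ivl_nonneg by auto
    then show ?thesis
      unfolding w_def using sol fd[of t] that time_ivl_mono[OF that(1)]
      by (intro has_time_derivative_diff) (auto simp: NS_solution_def time_ivl_def
          elim!: has_time_derivative_subset)
  qed
  have DK: "continuous_on ?I D" if "nonneg_cont D" for D
    using that continuous_on_subset[OF _ sub] by (auto simp: nonneg_cont_def)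
  have est_n: "nonneg_cont Dn" "nonneg_cont Dn1" "nonneg_cont en"
    using est by (simp_all add: estimators_def)
  have Rnc: "continuous_on ?I Rn" by (rule DERIV_continuous_on[OF Rn])

  \<comment> \<open>The Riccati equation read as a linear equation with nonnegative source, hence \<open>\<R>\<^sub>n \<ge> 0\<close>.\<close>
  define an where "an = (\<lambda>t. - 1 + R * (Gn * Dn t + Kn * Dn1 t) + R * Gn * Rn t)"
  have Rn_nonneg: "0 \<le> Rn t" if "t \<in> ?I" for t
  proof (rule time_ivl_linear_nonneg[OF _ _ _ _ that])
    show "(Rn has_real_derivative an t * Rn t + en t) (at t within ?I)" if "t \<in> ?I" for t
      using Rn[OF that] Rn'[OF that] by (simp add: an_def algebra_simps power2_eq_square)
    show "continuous_on ?I an"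
      unfolding an_def by (intro continuous_intros DK est_n Rnc)
    show "0 \<le> en t" if "t \<in> ?I" for t
      using est_n(3) time_ivl_nonneg[OF that] by (simp add: nonneg_cont_def)
  qed (simp add: Rn0)

  \<comment> \<open>Stated for all \<open>S\<close> below both life times, since \<open>T\<^sub>c \<le> T\<close> is not yet known.\<close>
  have control_n: "sob_norm n (w t) \<le> Rn t" if S: "S \<le> T" "S \<le> Tc" and t: "t \<in> time_ivl S" for S t
  proof (rule norm_control[OF wd[OF S(1)] _ _ _ _ _ t, where r' = Rn'])
    have SI: "time_ivl S \<subseteq> ?I" by (rule time_ivl_mono[OF S(2)])
    show "sob_norm n (w 0) \<le> Rn 0" by (simp add: w0 Rn0)
    show "(Rn has_real_derivative Rn' t) (at t within time_ivl S)" if "t \<in> time_ivl S" for t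
      using DERIV_subset[OF Rn SI] that SI by blast
    show "0 \<le> Rn t" if "t \<in> time_ivl S" for t using Rn_nonneg SI that by blast
    \<comment> \<open>The last summand is the divided difference of \<open>x \<mapsto> R G x\<^sup>2\<close> between \<open>|w(t)|\<close> and \<open>\<R>\<^sub>n(t)\<close>.\<close>
    define b where "b = (\<lambda>t. - 1 + R * (Gn * Dn t + Kn * Dn1 t) + R * Gn * (sob_norm n (w t) + Rn t))"
    show "continuous_on (time_ivl S) b"
      unfolding b_def
      by (intro continuous_intros continuous_on_sob_norm[OF wd[OF S(1)]]
          continuous_on_subset[OF DK SI] continuous_on_subset[OF Rnc SI] est_n)
    fix t N assume t: "t \<in> time_ivl S" and N: "N = sob_norm n (w t)"
    have t0: "0 \<le> t" and tT: "t \<in> time_ivl T" and tI: "t \<in> ?I"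
      using t SI time_ivl_mono[OF S(1)] by (auto simp: time_ivl_def)
    have wS: "w t \<in> Sob_inf" unfolding w_def by (intro Sob_inf_diff uS fS t0 tT)
    have self: "sob_inner n (NSP (w t) (w t)) (w t) \<le> Gn * N * N\<^sup>2"
      using Gn Sob_inf_Sob[OF wS] unfolding G_const_def N by (meson abs_le_D1)
    have "sob_inner n (\<lambda>k. NS_rhs R (u t) k - f' t k) (w t) \<le>
        N * (- N + R * (Gn * Dn t + Kn * Dn1 t + Gn * N) * N + en t)"
      unfolding w_def
      by (rule energy_inequality[OF card Kn Gn R uS[OF tT] fS[OF t0] f'S[OF t0]])
        (use est t0 self N in \<open>auto simp: estimators_def w_def f_def f'_def NS_error_def\<close>)
    also have "- N + R * (Gn * Dn t + Kn * Dn1 t + Gn * N) * N + en t = Rn' t + b t * (N - Rn t)"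
      by (simp add: Rn'[OF tI] b_def N[symmetric] algebra_simps power2_eq_square)
    finally show "sob_inner n (\<lambda>k. NS_rhs R (u t) k - f' t k) (w t) \<le> N * (Rn' t + b t * (N - Rn t))" .
  qed

  have T_ge: "T \<ge> Tc"
  proof (rule ccontr)
    assume "\<not> T \<ge> Tc"
    then have less: "T < Tc" by simp
    then obtain T0 where T0: "T = ereal T0" using T by (cases T) auto
    have sub0: "{0..T0} \<subseteq> ?I"
    proof
      fix x assume x: "x \<in> {0..T0}"
      then have "ereal x \<le> T" by (simp add: T0)
      then show "x \<in> ?I" using less x by (simp add: time_ivl_def le_less_trans)
    qed
    have "compact ((\<lambda>t. Rn t + Dn t) ` {0..T0})"
      by (intro compact_continuous_image compact_Icc continuous_on_add
          continuous_on_subset[OF Rnc sub0] continuous_on_subset[OF DK sub0] est_n)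
    then have "bounded ((\<lambda>t. Rn t + Dn t) ` {0..T0})" by (rule compact_imp_bounded)
    then obtain M where "\<forall>x\<in>(\<lambda>t. Rn t + Dn t) ` {0..T0}. norm x \<le> M"
      unfolding bounded_iff by (elim exE)
    then have M: "\<bar>Rn t + Dn t\<bar> \<le> M" if "t \<in> {0..T0}" for t using that by simp
    obtain c where c: "\<And>v :: 'd field. v \<in> Sob_inf \<Longrightarrow> l1 v \<le> c + (sob_norm n v)\<^sup>2"
      using l1_le_sob_norm[of n, where 'd = 'd] n by auto
    have bound: "l1 (u t) \<le> c + M\<^sup>2" if t: "t \<in> time_ivl (ereal T0)" for t
    proof -
      have tT: "t \<in> time_ivl T" and t0: "0 \<le> t" and tT0: "t \<in> {0..T0}" using t by (auto simp: T0 time_ivl_def)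
      have wS: "w t \<in> Sob_inf" unfolding w_def by (intro Sob_inf_diff uS fS t0 tT)
      have "u t = (\<lambda>k. w t k + f t k)" by (auto simp: w_def)
      then have "sob_norm n (u t) \<le> sob_norm n (w t) + sob_norm n (f t)"
        using sob_norm_triangle[OF wS fS[OF t0], of n] by simp
      also have "\<dots> \<le> Rn t + Dn t"
        using control_n[OF order_refl less_imp_le[OF less] tT] est t0
        by (intro add_mono) (auto simp: estimators_def f_def)
      also have "\<dots> \<le> M" using M[OF tT0] by simp
      finally have "(sob_norm n (u t))\<^sup>2 \<le> M\<^sup>2"
        by (rule power_mono) (rule sob_norm_nonneg[OF uS[OF tT]])
      then show ?thesis using c[OF uS[OF tT]] by linarith
    qed
    obtain T' v where "T0 < T'" "NS_solution R us (ereal T') v" "\<forall>t\<in>time_ivl (ereal T0). v t = u t"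
      using NS_solution_continuation[OF sol[unfolded T0] R us bound] by blast
    then have "\<exists>T' v. T < T' \<and> NS_solution R us T' v \<and> (\<forall>t\<in>time_ivl T. v t = u t)"
      unfolding T0 by (intro exI[of _ "ereal T'"] exI[of _ v]) auto
    then show False using assms(13) by (simp add: NS_maximal_solution_def)
  qed

  have part_ii: "(solves \<longleftrightarrow> (\<forall>t\<in>?I. Rp t = exp (- t + R * A t) * integral {0..t} (\<lambda>s. exp (s - R * A s) * ep s))) \<and>
      (solves \<longrightarrow> (\<forall>t\<in>?I. sob_norm p (w t) \<le> Rp t))"
    if Kp: "K_const TYPE('d) p Kp" and Gp: "G_const TYPE('d) p Gp" and Gpn: "G2_const TYPE('d) p n Gpn"
      and est_p: "estimators R (partial_expansion R us N) p Dp Dp1 ep"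
      and A: "A = (\<lambda>t. integral {0..t} (\<lambda>s. Gp * Dp s + Kp * Dp1 s + Gpn * Rn s))"
      and solves: "solves \<longleftrightarrow> continuous_on ?I Rp \<and> Rp 0 = 0 \<and>
        (\<forall>t\<in>?I. (Rp has_real_derivative
           - Rp t + R * (Gp * Dp t + Kp * Dp1 t + Gpn * Rn t) * Rp t + ep t) (at t within ?I))"
    for p Kp Gp Gpn Dp Dp1 ep A solves Rp
  proof -
    define c where "c = (\<lambda>t. Gp * Dp t + Kp * Dp1 t + Gpn * Rn t)"
    have nc: "nonneg_cont Dp" "nonneg_cont Dp1" "nonneg_cont ep"
      using est_p by (simp_all add: estimators_def)
    have cc: "continuous_on ?I c" unfolding c_def by (intro continuous_intros DK nc Rnc)
    have ec: "continuous_on ?I ep" by (rule DK[OF nc(3)])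
    have "solves \<longleftrightarrow> (\<forall>t\<in>?I. Rp t = exp (- t + R * A t) * integral {0..t} (\<lambda>s. exp (s - R * A s) * ep s))"
      unfolding solves A using linear_ODE_iff_formula[OF Tc cc ec, of Rp R] by (simp only: c_def)
    moreover have "sob_norm p (w t) \<le> Rp t" if s: solves and t: "t \<in> ?I" for t
    proof -
      define a where "a = (\<lambda>t. - 1 + R * c t)"
      define Rp' where "Rp' = (\<lambda>t. a t * Rp t + ep t)"
      have ac: "continuous_on ?I a" unfolding a_def by (intro continuous_intros cc)
      have Rp: "(Rp has_real_derivative Rp' t) (at t within ?I)" if "t \<in> ?I" for t
        using s that unfolding solves Rp'_def a_def c_def by (simp add: algebra_simps)
      have Rp0: "Rp 0 = 0" using s by (simp add: solves)
      have nonneg: "0 \<le> Rp t" if "t \<in> ?I" for t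
        by (rule time_ivl_linear_nonneg[OF Rp[unfolded Rp'_def] ac _ _ that])
          (use nc(3) Rp0 in \<open>auto simp: nonneg_cont_def time_ivl_def\<close>)
      show ?thesis
      proof (rule norm_control[OF wd[OF T_ge] _ Rp nonneg ac _ t])
        show "sob_norm p (w 0) \<le> Rp 0" by (simp add: w0 Rp0)
        fix t N assume t: "t \<in> ?I" and N: "N = sob_norm p (w t)"
        have t0: "0 \<le> t" and tT: "t \<in> time_ivl T"
          using t time_ivl_mono[OF T_ge] by (auto simp: time_ivl_def)
        have wS: "w t \<in> Sob_inf" unfolding w_def by (intro Sob_inf_diff uS fS t0 tT)
        have "sob_inner p (NSP (w t) (w t)) (w t) \<le>
            1 / 2 * Gpn * (N * sob_norm n (w t) + sob_norm n (w t) * N) * N"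
          using Gpn Sob_inf_Sob[OF wS] unfolding G2_const_def N by (meson abs_le_D1)
        also have "\<dots> = Gpn * sob_norm n (w t) * N\<^sup>2" by (simp add: algebra_simps power2_eq_square)
        also have "\<dots> \<le> Gpn * Rn t * N\<^sup>2"
          by (intro mult_right_mono mult_left_mono control_n[OF T_ge order_refl t] G2_const_nonneg[OF card Gpn]) simp
        finally have self: "sob_inner p (NSP (w t) (w t)) (w t) \<le> Gpn * Rn t * N\<^sup>2" .
        have "sob_inner p (\<lambda>k. NS_rhs R (u t) k - f' t k) (w t) \<le>
            N * (- N + R * (Gp * Dp t + Kp * Dp1 t + Gpn * Rn t) * N + ep t)"
          unfolding w_def
          by (rule energy_inequality[OF card Kp Gp R uS[OF tT] fS[OF t0] f'S[OF t0]])
            (use est_p t0 self N in \<open>auto simp: estimators_def w_def f_def f'_def NS_error_def\<close>)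
        also have "- N + R * (Gp * Dp t + Kp * Dp1 t + Gpn * Rn t) * N + ep t = Rp' t + a t * (N - Rp t)"
          by (simp add: Rp'_def a_def c_def algebra_simps)
        finally show "sob_inner p (\<lambda>k. NS_rhs R (u t) k - f' t k) (w t) \<le> N * (Rp' t + a t * (N - Rp t))" .
      qed
    qed
    ultimately show ?thesis by blast
  qed

  show ?thesis
    unfolding Let_def
  proof (intro conjI allI impI)
    show "T \<ge> Tc" by (rule T_ge)
    show "\<forall>t\<in>?I. sob_norm n (\<lambda>k. u t k - partial_expansion R us N t k) \<le> Rn t"
      using control_n[OF T_ge order_refl] by (simp add: w_def f_def)
    show "T = \<infinity>" if "Tc = \<infinity>" using T_ge that by simp
  next
    fix p Kp Gp Gpn Dp Dp1 ep Rp
    assume "p > n \<and> K_const TYPE('d) p Kp \<and> G_const TYPE('d) p Gp \<and> G2_const TYPE('d) p n Gpn \<and>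
      estimators R (partial_expansion R us N) p Dp Dp1 ep"
    then have *: "K_const TYPE('d) p Kp" "G_const TYPE('d) p Gp" "G2_const TYPE('d) p n Gpn"
      "estimators R (partial_expansion R us N) p Dp Dp1 ep" by blast+
    note ii = part_ii[OF * refl refl, of Rp]
    from conjunct1[OF ii]
    show "(continuous_on ?I Rp \<and> Rp 0 = 0 \<and>
        (\<forall>t\<in>?I. (Rp has_real_derivative
           - Rp t + R * (Gp * Dp t + Kp * Dp1 t + Gpn * Rn t) * Rp t + ep t) (at t within ?I))) \<longleftrightarrow>
      (\<forall>t\<in>?I. Rp t = exp (- t + R * integral {0..t} (\<lambda>s. Gp * Dp s + Kp * Dp1 s + Gpn * Rn s)) *
        integral {0..t} (\<lambda>s. exp (s - R * integral {0..s} (\<lambda>s. Gp * Dp s + Kp * Dp1 s + Gpn * Rn s)) * ep s))" .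
    assume "continuous_on ?I Rp \<and> Rp 0 = 0 \<and>
        (\<forall>t\<in>?I. (Rp has_real_derivative
           - Rp t + R * (Gp * Dp t + Kp * Dp1 t + Gpn * Rn t) * Rp t + ep t) (at t within ?I))"
    from mp[OF conjunct2[OF ii] this]
    show "\<forall>t\<in>?I. sob_norm p (\<lambda>k. u t k - partial_expansion R us N t k) \<le> Rp t"
      by (simp only: w_def f_def)
  qed
qed

end
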